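(* Let $(X,\mu)$ be a $\sigma$-finite measure space equipped with a measure-preserving transformation $T:X\to X$, let $2\le p<\infty$, and let $f\in L^p(X)$. Then the averages $$C_N^T f(x)=\frac{1}{|\mathcal C_N|}\sum_{n\in\mathcal C_N} f(T^n x)$$ converge, as $N\to\infty$, for $\mu$-almost every $x\in X$.
   Context: Let $d\ge 3$ be an integer and let $D\subsetneq\{0,1,\dots,d-1\}$ be a set of digits with $|D|\ge 2$ and $0\in D$. The associated integer Cantor set is $$\mathcal C:=\bigcup_{J\ge 0}\Big\{\sum_{j=0}^J a_j d^j : a_j\in D\Big\}\subset\mathbb Z_{\ge 0},$$ and $\mathcal C_N:=\mathcal C\cap\{1,2,\dots,N\}$ (nonempty for all large $N$). The transformation $T$ is not assumed invertible. *)

theory Defs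
  imports "HOL-Analysis.Analysis"
begin

definition integer_cantor_set :: "nat \<Rightarrow> nat set \<Rightarrow> nat set" where
  "integer_cantor_set d D = (\<Union>J. {\<Sum>j\<le>J. a j * d ^ j | a. \<forall>j\<le>J. a j \<in> D})"

definition cantor_upto :: "nat \<Rightarrow> nat set \<Rightarrow> nat \<Rightarrow> nat set" where
  "cantor_upto d D N = integer_cantor_set d D \<inter> {1..N}"

definition measure_preserving_map :: "'a measure \<Rightarrow> ('a \<Rightarrow> 'a) \<Rightarrow> bool" where
  "measure_preserving_map M T \<longleftrightarrow>
     T \<in> measurable M M \<and>
     (\<forall>A\<in>sets M. emeasure M (T -` A \<inter> space M) = emeasure M A)"

text \<open>Elements of \<open>L\<^sup>p\<close> are represented by measurable functions rather than by
  almost-everywhere equivalence classes.\<close>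

definition Lp_functions :: "real \<Rightarrow> 'a measure \<Rightarrow> ('a \<Rightarrow> complex) set" where
  "Lp_functions p M =
     {f \<in> borel_measurable M. integrable M (\<lambda>x. norm (f x) powr p)}"

text \<open>For the finitely many \<open>N\<close> with \<open>cantor_upto d D N\<close> empty, the average is \<open>0\<close>
  by the convention \<open>x / 0 = 0\<close>; this does not affect convergence.\<close>

definition cantor_average ::
  "nat \<Rightarrow> nat set \<Rightarrow> ('a \<Rightarrow> 'a) \<Rightarrow> ('a \<Rightarrow> complex) \<Rightarrow> nat \<Rightarrow> 'a \<Rightarrow> complex" where
  "cantor_average d D T f N x =
     (\<Sum>n\<in>cantor_upto d D N. f ((T ^^ n) x)) / of_nat (card (cantor_upto d D N))"

end

theory Submission
  imports Defs
begin

text \<open>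
  The proof reduces to \<open>p = 2\<close> by splitting \<open>f\<close> at a small level: the large part is square-integrable,
  and the averages of the small part are uniformly small.

  For \<open>f\<close> in \<open>L\<^sup>2\<close>, let \<open>A J f\<close> be the average of \<open>f (T\<^sup>n x)\<close> over the numbers \<open>n\<close> with \<open>J\<close> digits from \<open>D\<close>.
  These averages satisfy an oscillation inequality: the sum over successive blocks of indices of the
  integral of \<open>sup \<bar>A J f - A i f\<bar>\<^sup>2\<close>, where \<open>i\<close> is the left end of the block and \<open>J\<close> runs through the block,
  is bounded by a constant multiple of \<open>\<parallel>f\<parallel>\<^sup>2\<close> whatever the blocks and their number. This yields almost
  everywhere convergence of \<open>A J f\<close> directly, without a dense class of functions
  (\<open>tail_oscillation_small\<close>, \<open>A_converges\<close>). By transference it is enough to prove the inequality on cyclic groups.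

  There, \<open>A J\<close> is the Fourier multiplier with symbol \<open>m\<^sub>J(z) = (\<Prod>j<J. \<phi>\<^sub>j)\<close>, where
  \<open>\<phi>\<^sub>j = phi D (z ^ d ^ j)\<close> and \<open>phi D z\<close> is the mean of \<open>z ^ a\<close> over the digits \<open>a\<close>. A theorem of Rota type handles the
  squared moduli: for every set \<open>I\<close> of positions, the multipliers \<open>\<Prod>j<J, j \<notin> I. \<bar>\<phi>\<^sub>j\<bar>\<^sup>2\<close> satisfy the
  oscillation inequality uniformly in \<open>I\<close>, because they are averages of a reverse martingale
  (\<open>rota_oscillation\<close>). What has to be dealt with is the phase of \<open>\<phi>\<^sub>j\<close>, which
  is not small when \<open>z ^ d ^ j\<close> is far from the frequencies at which \<open>phi D\<close> has modulus \<open>1\<close>. Call such a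
  position \<open>j\<close>, which depends on \<open>z\<close>, a jump. Between jumps the distance to these frequencies grows
  geometrically, and \<open>m\<^sub>J\<close> equals \<open>a\<^sub>J h\<^sub>J\<close> up to an error that is square-summable
  in \<open>J\<close>; here \<open>a\<^sub>J\<close> is a product of positive factors over the positions that are not jumps, and
  \<open>h\<^sub>J\<close> depends only on the number of jumps below \<open>J\<close> and is at most \<open>\<rho>\<^sup>r\<close> after \<open>r\<close> jumps, for some
  \<open>\<rho> < 1\<close> (\<open>frozen_error_square_sum\<close>, \<open>h_le\<close>).

  The point of the proof is that the truncation of \<open>a\<^sub>J\<close> to at most \<open>r\<close> jumps is an average of Rota multipliers:
  choose \<open>I\<close> at random, each position being included with probability \<open>\<rho>\<close>. Then
  the expectation of \<open>\<Prod>j<J, j \<notin> I. \<bar>\<phi>\<^sub>j\<bar>\<^sup>2\<close>, weighted by a multiplier that does not depend on \<open>J\<close>,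
  equals \<open>a\<^sub>J\<close> if at most \<open>r\<close> jumps lie below \<open>J\<close> and \<open>0\<close> otherwise (\<open>expectation_XV\<close>).
  The weights require the first \<open>r\<close> jumps to be in \<open>I\<close> and let the next jump cancel. Their mean square is
  of order \<open>\<rho>\<^bsup>-r\<^esup>\<close> (\<open>expectation_V_square\<close>), which the factor \<open>\<rho>\<^bsup>2r\<^esup>\<close> coming from \<open>h\<^sub>J\<close> outweighs,
  so that the sum over \<open>r\<close> converges.

  Finally, the elements of the Cantor set up to an arbitrary \<open>N\<close> are grouped into blocks
  \<open>v d\<^sup>l + {numbers with l digits}\<close> with \<open>l\<close> a fixed number of digits less than \<open>N\<close> has. For each fixed \<open>v\<close>
  the translation by \<open>v d\<^sup>l\<close> does not matter in the limit \<open>l \<longlongrightarrow> \<infinity>\<close>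
  (\<open>A_shift_negligible\<close>), and the one incomplete block is a small proportion (\<open>block_deviation\<close>).
\<close>

section \<open>Martingale inequalities on a finite set\<close>

text \<open>A partition of a finite set \<open>W\<close> is given by a labelling \<open>l\<close>: two points lie in the same class when
  their labels agree. Averaging over the classes is the conditional expectation of normalised counting
  measure on \<open>W\<close> given \<open>l\<close>. A sequence of labellings in which every label determines the next one
  is a reverse filtration.\<close>

definition class_avg :: "'w set \<Rightarrow> ('w \<Rightarrow> 'l) \<Rightarrow> ('w \<Rightarrow> complex) \<Rightarrow> 'w \<Rightarrow> complex" where
  "class_avg W l g w = (\<Sum>v | v \<in> W \<and> l v = l w. g v) / of_nat (card {v \<in> W. l v = l w})"

lemma labels_coarser:
  assumes coarse: "\<And>i v w. lab i v = lab i w \<Longrightarrow> lab (Suc i) v = lab (Suc i) w"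
    and "i \<le> j" "lab i v = lab i w"
  shows "lab j v = lab j w"
  using assms(2,3) by (induction j rule: dec_induct) (auto intro: coarse)

lemma class_avg_diff: "class_avg W l (\<lambda>v. g v - h v) w = class_avg W l g w - class_avg W l h w"
  by (simp add: class_avg_def sum_subtractf diff_divide_distrib)

lemma class_avg_const_on_class: "l v = l w \<Longrightarrow> class_avg W l g v = class_avg W l g w"
  by (simp add: class_avg_def)

lemma class_avg_eq_self:
  assumes "finite W" "w \<in> W" and "\<And>v. v \<in> W \<Longrightarrow> l v = l w \<Longrightarrow> g v = g w"
  shows "class_avg W l g w = g w"
proof -
  have "card {v \<in> W. l v = l w} \<noteq> 0" using assms(1,2) by (auto simp: card_eq_0_iff)
  moreover have "(\<Sum>v | v \<in> W \<and> l v = l w. g v) = (\<Sum>v | v \<in> W \<and> l v = l w. g w)"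
    by (intro sum.cong) (auto intro: assms(3))
  ultimately show ?thesis by (simp add: class_avg_def)
qed

lemma class_avg_adjoint:
  assumes "finite W"
  shows "(\<Sum>w\<in>W. class_avg W l g w * h w) = (\<Sum>w\<in>W. g w * class_avg W l h w)"
proof -
  let ?c = "\<lambda>w. of_nat (card {v \<in> W. l v = l w}) :: complex"
  have "(\<Sum>w\<in>W. class_avg W l g w * h w) = (\<Sum>w\<in>W. \<Sum>v\<in>W. if l v = l w then g v * h w / ?c w else 0)"
    unfolding class_avg_def sum_divide_distrib sum_distrib_right sum.inter_filter[OF assms]
    by (intro sum.cong refl) auto
  also have "\<dots> = (\<Sum>v\<in>W. \<Sum>w\<in>W. if l v = l w then g v * h w / ?c w else 0)"
    by (rule sum.swap)
  also have "\<dots> = (\<Sum>v\<in>W. \<Sum>w\<in>W. if l w = l v then g v * h w / ?c v else 0)"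
    by (intro sum.cong refl) auto
  also have "\<dots> = (\<Sum>v\<in>W. g v * class_avg W l h v)"
    unfolding class_avg_def sum_divide_distrib sum_distrib_left sum.inter_filter[OF assms]
    by (intro sum.cong refl) auto
  finally show ?thesis .
qed

lemma class_avg_tower:
  assumes "finite W" and finer: "\<And>v w. l v = l w \<Longrightarrow> l' v = l' w" and "w \<in> W"
  shows "class_avg W l' (class_avg W l g) w = class_avg W l' g w"
proof -
  define h where "h v = (if l' v = l' w then 1 else 0 :: complex)" for v
  have "(\<Sum>v | v \<in> W \<and> l' v = l' w. class_avg W l g v) = (\<Sum>v\<in>W. class_avg W l g v * h v)"
    unfolding sum.inter_filter[OF assms(1)] by (intro sum.cong refl) (simp add: h_def)
  also have "\<dots> = (\<Sum>v\<in>W. g v * class_avg W l h v)" by (rule class_avg_adjoint[OF assms(1)])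
  also have "\<dots> = (\<Sum>v\<in>W. g v * h v)"
    by (intro sum.cong refl arg_cong2[where f="(*)"] class_avg_eq_self[OF assms(1)])
       (auto simp: h_def dest: finer)
  also have "\<dots> = (\<Sum>v | v \<in> W \<and> l' v = l' w. g v)"
    unfolding sum.inter_filter[OF assms(1)] by (intro sum.cong refl) (simp add: h_def)
  finally show ?thesis by (simp add: class_avg_def)
qed

text \<open>Doob's maximal inequality in \<open>L\<^sup>2\<close> for a reverse martingale, with the supremum linearised by a
  selection \<open>\<kappa>\<close>. The proof bounds the linearised operator through its adjoint \<open>H\<close>: of two kernels
  \<open>K w1\<close>, \<open>K w2\<close>, the finer one is absorbed by the coarser one, so \<open>\<parallel>H\<parallel>\<^sup>2\<close> is at most twice the
  pairing of \<open>F\<close> and \<open>H\<close>.\<close>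

lemma class_avg_maximal:
  fixes lab :: "nat \<Rightarrow> 'w \<Rightarrow> 'l" and g :: "'w \<Rightarrow> complex" and \<kappa> :: "'w \<Rightarrow> nat"
  assumes fin: "finite W"
    and coarse: "\<And>i v w. lab i v = lab i w \<Longrightarrow> lab (Suc i) v = lab (Suc i) w"
  shows "(\<Sum>w\<in>W. (cmod (class_avg W (lab (\<kappa> w)) g w))\<^sup>2) \<le> 4 * (\<Sum>w\<in>W. (cmod (g w))\<^sup>2)"
proof -
  define c where "c w = real (card {v \<in> W. lab (\<kappa> w) v = lab (\<kappa> w) w})" for w
  define K where "K w v = (if lab (\<kappa> w) v = lab (\<kappa> w) w then 1 / c w else 0)" for w v
  define F where "F w = (\<Sum>v\<in>W. K w v * cmod (g v))" for w
  define H where "H v = (\<Sum>w\<in>W. K w v * F w)" for v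
  have cpos: "c w > 0" if "w \<in> W" for w
  proof -
    have "w \<in> {v \<in> W. lab (\<kappa> w) v = lab (\<kappa> w) w}" using that by simp
    then show ?thesis unfolding c_def of_nat_0_less_iff card_gt_0_iff using fin by auto
  qed
  have K0: "K w v \<ge> 0" for w v by (simp add: K_def c_def)
  have F0: "F w \<ge> 0" for w unfolding F_def by (intro sum_nonneg mult_nonneg_nonneg K0) auto
  have le: "cmod (class_avg W (lab (\<kappa> w)) g w) \<le> F w" for w
  proof -
    have "cmod (class_avg W (lab (\<kappa> w)) g w) \<le> (\<Sum>v | v \<in> W \<and> lab (\<kappa> w) v = lab (\<kappa> w) w. cmod (g v)) / c w"
      unfolding class_avg_def norm_divide c_def norm_of_nat
      by (intro divide_right_mono sum_norm_le) auto
    also have "\<dots> = F w" unfolding F_def K_def sum_divide_distrib sum.inter_filter[OF fin]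
      by (intro sum.cong refl) auto
    finally show ?thesis .
  qed
  \<comment> \<open>A class of the finer partition is either contained in or disjoint from a class of the coarser one.\<close>
  have key1: "(\<Sum>v\<in>W. K w1 v * K w2 v) = K w2 w1" if "w1 \<in> W" "w2 \<in> W" "\<kappa> w1 \<le> \<kappa> w2" for w1 w2
  proof -
    have *: "lab (\<kappa> w2) v = lab (\<kappa> w2) w1" if "lab (\<kappa> w1) v = lab (\<kappa> w1) w1" for v
      by (rule labels_coarser[where lab = lab, OF _ \<open>\<kappa> w1 \<le> \<kappa> w2\<close> that]) (rule coarse)
    have "(\<Sum>v\<in>W. K w1 v * K w2 v) = (\<Sum>v\<in>W. K w1 v * K w2 w1)"
    proof (intro sum.cong refl)
      fix v
      show "K w1 v * K w2 v = K w1 v * K w2 w1"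
      proof (cases "lab (\<kappa> w1) v = lab (\<kappa> w1) w1")
        case True
        show ?thesis unfolding K_def *[OF True] ..
      qed (simp add: K_def)
    qed
    also have "\<dots> = (\<Sum>v\<in>W. K w1 v) * K w2 w1" by (simp add: sum_distrib_right)
    also have "(\<Sum>v\<in>W. K w1 v) = 1"
      using cpos[OF \<open>w1 \<in> W\<close>] unfolding K_def sum.inter_filter[OF fin, symmetric] by (simp add: c_def)
    finally show ?thesis by simp
  qed
  have key: "(\<Sum>v\<in>W. K w1 v * K w2 v) \<le> K w2 w1 + K w1 w2" if "w1 \<in> W" "w2 \<in> W" for w1 w2
  proof (cases "\<kappa> w1 \<le> \<kappa> w2")
    case True then show ?thesis using key1[OF that True] K0 by simp
  next
    case False
    then have "(\<Sum>v\<in>W. K w2 v * K w1 v) = K w1 w2" using key1[OF that(2,1)] by simp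
    then show ?thesis using K0[of w2 w1] by (simp add: mult.commute)
  qed
  define f h \<gamma> where "f = (\<Sum>w\<in>W. (F w)\<^sup>2)" and "h = (\<Sum>w\<in>W. (H w)\<^sup>2)"
    and "\<gamma> = (\<Sum>w\<in>W. (cmod (g w))\<^sup>2)"
  have f0: "f \<ge> 0" "h \<ge> 0" "\<gamma> \<ge> 0" by (simp_all add: f_def h_def \<gamma>_def sum_nonneg)
  have "f = (\<Sum>w\<in>W. \<Sum>v\<in>W. F w * (K w v * cmod (g v)))"
    unfolding f_def power2_eq_square by (subst (2) F_def) (simp add: sum_distrib_left)
  also have "\<dots> = (\<Sum>v\<in>W. cmod (g v) * H v)"
    by (subst sum.swap) (simp add: H_def sum_distrib_left mult_ac)
  finally have "f\<^sup>2 \<le> \<gamma> * h"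
    using Cauchy_Schwarz_ineq_sum[of "\<lambda>v. cmod (g v)" H W] by (simp add: \<gamma>_def h_def)
  moreover have "h \<le> 4 * f"
  proof -
    have "h = (\<Sum>v\<in>W. \<Sum>w1\<in>W. \<Sum>w2\<in>W. (K w1 v * K w2 v) * (F w1 * F w2))"
      unfolding h_def power2_eq_square H_def by (simp add: sum_product mult_ac)
    also have "\<dots> = (\<Sum>w1\<in>W. \<Sum>w2\<in>W. \<Sum>v\<in>W. (K w1 v * K w2 v) * (F w1 * F w2))"
    proof -
      have "(\<Sum>v\<in>W. \<Sum>w2\<in>W. (K w1 v * K w2 v) * (F w1 * F w2))
        = (\<Sum>w2\<in>W. \<Sum>v\<in>W. (K w1 v * K w2 v) * (F w1 * F w2))" for w1
        by (rule sum.swap)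
      then show ?thesis by (subst sum.swap) simp
    qed
    also have "\<dots> = (\<Sum>w1\<in>W. \<Sum>w2\<in>W. (\<Sum>v\<in>W. K w1 v * K w2 v) * (F w1 * F w2))"
      by (simp add: sum_distrib_right)
    also have "\<dots> \<le> (\<Sum>w1\<in>W. \<Sum>w2\<in>W. (K w2 w1 + K w1 w2) * (F w1 * F w2))"
      by (intro sum_mono mult_right_mono key mult_nonneg_nonneg F0)
    also have "\<dots> = (\<Sum>w1\<in>W. \<Sum>w2\<in>W. F w1 * (K w2 w1 * F w2)) + (\<Sum>w1\<in>W. \<Sum>w2\<in>W. F w2 * (K w1 w2 * F w1))"
      unfolding sum.distrib[symmetric] by (intro sum.cong refl) (simp add: algebra_simps)
    also have "(\<Sum>w1\<in>W. \<Sum>w2\<in>W. F w2 * (K w1 w2 * F w1)) = (\<Sum>w1\<in>W. \<Sum>w2\<in>W. F w1 * (K w2 w1 * F w2))"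
      by (rule sum.swap)
    also have "(\<Sum>w1\<in>W. \<Sum>w2\<in>W. F w1 * (K w2 w1 * F w2)) = (\<Sum>w\<in>W. F w * H w)"
      by (simp add: H_def sum_distrib_left)
    finally have *: "h \<le> 2 * (\<Sum>w\<in>W. F w * H w)" by simp
    have "h\<^sup>2 \<le> (2 * (\<Sum>w\<in>W. F w * H w))\<^sup>2" using * f0 by (intro power_mono) auto
    also have "\<dots> \<le> 4 * (f * h)"
      using Cauchy_Schwarz_ineq_sum[of F H W] by (simp add: f_def h_def power_mult_distrib)
    finally have "h * h \<le> (4 * f) * h" by (simp add: power2_eq_square)
    then show ?thesis using f0 by (cases "h = 0") (auto simp: mult_le_cancel_right)
  qed
  ultimately have "f * f \<le> (4 * \<gamma>) * f"
    using mult_left_mono[OF \<open>h \<le> 4 * f\<close> f0(3)] by (simp add: power2_eq_square)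
  then have "f \<le> 4 * \<gamma>" using f0 by (cases "f = 0") (auto simp: mult_le_cancel_right)
  moreover have "(\<Sum>w\<in>W. (cmod (class_avg W (lab (\<kappa> w)) g w))\<^sup>2) \<le> f"
    unfolding f_def by (intro sum_mono power_mono le) auto
  ultimately show ?thesis by (simp add: \<gamma>_def)
qed

lemma class_avg_cnj: "class_avg W l (\<lambda>v. cnj (g v)) w = cnj (class_avg W l g w)"
  by (simp add: class_avg_def)

lemma class_avg_pythagoras:
  assumes fin: "finite W" and finer: "\<And>v w. l v = l w \<Longrightarrow> l' v = l' w"
  shows "(\<Sum>w\<in>W. (cmod (class_avg W l g w - class_avg W l' g w))\<^sup>2)
    = (\<Sum>w\<in>W. (cmod (class_avg W l g w))\<^sup>2) - (\<Sum>w\<in>W. (cmod (class_avg W l' g w))\<^sup>2)"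
proof -
  let ?A = "class_avg W l g" and ?B = "class_avg W l' g"
  have tower: "class_avg W l' ?A w = ?B w" if "w \<in> W" for w
    using class_avg_tower[where l=l and l'=l', OF fin finer that] by blast
  have idem: "class_avg W l' ?B w = ?B w" if "w \<in> W" for w
    using class_avg_tower[where l=l' and l'=l' and g=g, OF fin _ that] by blast
  have "(\<Sum>w\<in>W. ?A w * cnj (?B w)) = (\<Sum>w\<in>W. ?A w * class_avg W l' (\<lambda>v. cnj (?B v)) w)"
    by (intro sum.cong refl) (simp add: class_avg_cnj idem)
  also have "\<dots> = (\<Sum>w\<in>W. class_avg W l' ?A w * cnj (?B w))"
    by (rule class_avg_adjoint[OF fin, symmetric])
  also have "\<dots> = (\<Sum>w\<in>W. ?B w * cnj (?B w))" by (intro sum.cong refl) (simp add: tower)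
  finally have *: "(\<Sum>w\<in>W. ?A w * cnj (?B w)) = (\<Sum>w\<in>W. ?B w * cnj (?B w))" .
  then have "cnj (\<Sum>w\<in>W. ?A w * cnj (?B w)) = cnj (\<Sum>w\<in>W. ?B w * cnj (?B w))" by simp
  then have **: "(\<Sum>w\<in>W. ?B w * cnj (?A w)) = (\<Sum>w\<in>W. ?B w * cnj (?B w))" 
    by (simp add: mult.commute)
  have "complex_of_real (\<Sum>w\<in>W. (cmod (?A w - ?B w))\<^sup>2) = (\<Sum>w\<in>W. (?A w - ?B w) * cnj (?A w - ?B w))"
    by (simp only: complex_norm_square of_real_sum)
  also have "\<dots> = (\<Sum>w\<in>W. ?A w * cnj (?A w)) - (\<Sum>w\<in>W. ?B w * cnj (?B w))"
    using * ** by (simp add: algebra_simps sum_subtractf sum.distrib)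
  also have "\<dots> = complex_of_real ((\<Sum>w\<in>W. (cmod (?A w))\<^sup>2) - (\<Sum>w\<in>W. (cmod (?B w))\<^sup>2))"
    by (simp only: complex_norm_square of_real_sum of_real_diff)
  finally show ?thesis by (simp only: of_real_eq_iff)
qed

lemma cmod_diff_square_le: "(cmod (x - y))\<^sup>2 \<le> 2 * (cmod x)\<^sup>2 + 2 * (cmod y)\<^sup>2"
proof -
  have "(cmod (x - y))\<^sup>2 \<le> (cmod x + cmod y)\<^sup>2" by (intro power_mono norm_triangle_ineq4) auto
  also have "\<dots> \<le> 2 * (cmod x)\<^sup>2 + 2 * (cmod y)\<^sup>2" 
    using sum_squares_bound[of "cmod x" "cmod y"] by (simp add: power2_sum)
  finally show ?thesis .
qed

text \<open>On a block \<open>js k \<le> i < js (Suc k)\<close> the increment of the reverse martingale is governed by the single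
  function \<open>f k\<close>, the difference of the two averages at the ends of the block. The maximal inequality
  applies to it, and the functions \<open>f k\<close> are orthogonal.\<close>

lemma class_avg_oscillation:
  fixes lab :: "nat \<Rightarrow> 'w \<Rightarrow> 'l" and g :: "'w \<Rightarrow> complex" and \<kappa> :: "'w \<Rightarrow> nat \<Rightarrow> nat" and js :: "nat \<Rightarrow> nat"
  assumes fin: "finite W"
    and coarse: "\<And>i v w. lab i v = lab i w \<Longrightarrow> lab (Suc i) v = lab (Suc i) w"
    and sel: "\<And>w k. w \<in> W \<Longrightarrow> k < n \<Longrightarrow> js k \<le> \<kappa> w k \<and> \<kappa> w k < js (Suc k)"
  shows "(\<Sum>w\<in>W. \<Sum>k<n. (cmod (class_avg W (lab (\<kappa> w k)) g w - class_avg W (lab (js k)) g w))\<^sup>2)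
    \<le> 10 * (\<Sum>w\<in>W. (cmod (g w))\<^sup>2)"
proof (cases "W = {}")
  case False
  let ?E = "\<lambda>i. class_avg W (lab i)"
  have lc: "\<And>v w. lab i v = lab i w \<Longrightarrow> lab j v = lab j w" if "i \<le> j" for i j
    by (rule labels_coarser[where lab = lab, OF _ that]) (rule coarse)
  have tower: "?E j (?E i g) w = ?E j g w" if "i \<le> j" "w \<in> W" for i j w
    using class_avg_tower[where l="lab i" and l'="lab j" and g=g, OF fin lc[OF that(1)] that(2)] by blast
  have absorb: "?E i (?E j g) w = ?E j g w" if "i \<le> j" "w \<in> W" for i j w
    by (intro class_avg_eq_self[OF fin that(2)] class_avg_const_on_class) (rule lc[OF that(1)])
  define f where "f k w = ?E (js k) g w - ?E (js (Suc k)) g w" for k w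
  have block: "(\<Sum>w\<in>W. (cmod (?E (\<kappa> w k) g w - ?E (js k) g w))\<^sup>2)
     \<le> 10 * ((\<Sum>w\<in>W. (cmod (?E (js k) g w))\<^sup>2) - (\<Sum>w\<in>W. (cmod (?E (js (Suc k)) g w))\<^sup>2))"
    if k: "k < n" for k
  proof -
    have "js k \<le> js (Suc k)" using sel[OF _ k] False by fastforce
    have eq: "?E (\<kappa> w k) g w - ?E (js k) g w = ?E (\<kappa> w k) (f k) w - f k w" if "w \<in> W" for w
      using sel[OF that k] that
      by (simp add: f_def[abs_def] class_avg_diff tower absorb)
    have "(\<Sum>w\<in>W. (cmod (?E (\<kappa> w k) g w - ?E (js k) g w))\<^sup>2)
      \<le> (\<Sum>w\<in>W. 2 * (cmod (?E (\<kappa> w k) (f k) w))\<^sup>2 + 2 * (cmod (f k w))\<^sup>2)"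
      using cmod_diff_square_le by (intro sum_mono) (simp add: eq)
    also have "\<dots> = 2 * (\<Sum>w\<in>W. (cmod (?E (\<kappa> w k) (f k) w))\<^sup>2) + 2 * (\<Sum>w\<in>W. (cmod (f k w))\<^sup>2)"
      by (simp add: sum.distrib sum_distrib_left)
    also have "\<dots> \<le> 10 * (\<Sum>w\<in>W. (cmod (f k w))\<^sup>2)"
      using class_avg_maximal[where lab=lab and \<kappa>="\<lambda>w. \<kappa> w k" and g="f k", OF fin coarse] by simp
    also have "(\<Sum>w\<in>W. (cmod (f k w))\<^sup>2) = (\<Sum>w\<in>W. (cmod (?E (js k) g w))\<^sup>2) - (\<Sum>w\<in>W. (cmod (?E (js (Suc k)) g w))\<^sup>2)"
      unfolding f_def using lc[OF \<open>js k \<le> js (Suc k)\<close>] by (intro class_avg_pythagoras[OF fin]) blast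
    finally show ?thesis .
  qed
  have "(\<Sum>w\<in>W. \<Sum>k<n. (cmod (?E (\<kappa> w k) g w - ?E (js k) g w))\<^sup>2)
      = (\<Sum>k<n. \<Sum>w\<in>W. (cmod (?E (\<kappa> w k) g w - ?E (js k) g w))\<^sup>2)" by (rule sum.swap)
  also have "\<dots> \<le> (\<Sum>k<n. 10 * ((\<Sum>w\<in>W. (cmod (?E (js k) g w))\<^sup>2) - (\<Sum>w\<in>W. (cmod (?E (js (Suc k)) g w))\<^sup>2)))"
    by (intro sum_mono block) auto
  also have "\<dots> = 10 * ((\<Sum>w\<in>W. (cmod (?E (js 0) g w))\<^sup>2) - (\<Sum>w\<in>W. (cmod (?E (js n) g w))\<^sup>2))"
    unfolding sum_distrib_left[symmetric]
    by (subst sum_lessThan_telescope'[where f="\<lambda>k. \<Sum>w\<in>W. (cmod (?E (js k) g w))\<^sup>2"]) (rule refl)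
  also have "\<dots> \<le> 10 * (\<Sum>w\<in>W. (cmod (?E (js 0) g w))\<^sup>2)" by (simp add: sum_nonneg)
  also have "(\<Sum>w\<in>W. (cmod (?E (js 0) g w))\<^sup>2) \<le> (\<Sum>w\<in>W. (cmod (g w))\<^sup>2)"
  proof -
    have "class_avg W (\<lambda>v. v) g w = g w" if "w \<in> W" for w
      by (rule class_avg_eq_self[OF fin that]) auto
    then have "(\<Sum>w\<in>W. (cmod (g w - ?E (js 0) g w))\<^sup>2) = (\<Sum>w\<in>W. (cmod (g w))\<^sup>2) - (\<Sum>w\<in>W. (cmod (?E (js 0) g w))\<^sup>2)"
      using class_avg_pythagoras[where l="\<lambda>v. v" and l'="lab (js 0)" and g=g, OF fin] by simp
    moreover have "(\<Sum>w\<in>W. (cmod (g w - ?E (js 0) g w))\<^sup>2) \<ge> 0" by (intro sum_nonneg) auto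
    ultimately show ?thesis by simp
  qed
  finally show ?thesis by simp
qed simp

section \<open>Fourier series on a cyclic group\<close>

text \<open>Functions on the cyclic group of order \<open>M\<close> are represented by \<open>M\<close>-periodic functions on the
  naturals; \<open>trig M \<alpha>\<close> is the one with Fourier coefficients \<open>\<alpha>\<close>.\<close>

definition uroot :: "nat \<Rightarrow> nat \<Rightarrow> complex" where
  "uroot M \<xi> = cis (2 * pi * real \<xi> / real M)"

definition trig :: "nat \<Rightarrow> (nat \<Rightarrow> complex) \<Rightarrow> nat \<Rightarrow> complex" where
  "trig M \<alpha> n = (\<Sum>\<xi><M. \<alpha> \<xi> * uroot M \<xi> ^ n)"

lemma norm_root [simp]: "cmod (uroot M \<xi>) = 1"
  by (simp add: uroot_def)

lemma root_power_modulus: "0 < M \<Longrightarrow> uroot M \<xi> ^ M = 1"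
  using cis_multiple_2pi[of "real \<xi>"] by (simp add: uroot_def Complex.DeMoivre)

lemma root_power_mod: "0 < M \<Longrightarrow> uroot M \<xi> ^ (n mod M) = uroot M \<xi> ^ n"
proof -
  assume M: "0 < M"
  have "uroot M \<xi> ^ n = uroot M \<xi> ^ (M * (n div M) + n mod M)" by simp
  also have "\<dots> = uroot M \<xi> ^ (n mod M)" using root_power_modulus[OF M] by (simp only: power_add power_mult) simp
  finally show ?thesis ..
qed

lemma trig_mod: "0 < M \<Longrightarrow> trig M \<alpha> (n mod M) = trig M \<alpha> n"
  by (simp add: trig_def root_power_mod)

lemma sum_root_powers:
  assumes "\<xi> < M" "\<zeta> < M"
  shows "(\<Sum>n<M. uroot M \<xi> ^ n * cnj (uroot M \<zeta> ^ n)) = (if \<xi> = \<zeta> then of_nat M else 0)"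
proof -
  have M: "0 < M" using assms by simp
  define w where "w = uroot M \<xi> * cnj (uroot M \<zeta>)"
  have eq: "(\<Sum>n<M. uroot M \<xi> ^ n * cnj (uroot M \<zeta> ^ n)) = (\<Sum>n<M. w ^ n)"
    by (simp add: w_def power_mult_distrib)
  show ?thesis
  proof (cases "\<xi> = \<zeta>")
    case True
    then have "w = 1" by (simp add: w_def complex_norm_square[symmetric])
    then show ?thesis using True eq by simp
  next
    case False
    have "w ^ M = 1" using root_power_modulus[OF M]
      by (simp add: w_def power_mult_distrib flip: complex_cnj_power)
    moreover have "w \<noteq> 1"
    proof
      assume "w = 1"
      have "w = cis (2 * pi * real \<xi> / real M - 2 * pi * real \<zeta> / real M)"
        by (simp add: w_def uroot_def cis_cnj cis_mult)
      then have "cos (2 * pi * real \<xi> / real M - 2 * pi * real \<zeta> / real M) = 1"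
        using \<open>w = 1\<close> by (metis Re_complex_of_real cis.sel(1) of_real_1)
      then obtain k :: int where "2 * pi * real \<xi> / real M - 2 * pi * real \<zeta> / real M = of_int k * 2 * pi"
        by (auto simp: cos_one_2pi_int)
      then have "2 * pi * (real \<xi> - real \<zeta>) = 2 * pi * (of_int k * real M)"
        using M by (simp add: field_simps)
      then have "real \<xi> - real \<zeta> = of_int k * real M" by simp
      then have "real_of_int (int \<xi> - int \<zeta>) = real_of_int (k * int M)" by simp
      then have *: "int \<xi> - int \<zeta> = k * int M" by (simp only: of_int_eq_iff)
      have "\<bar>int \<xi> - int \<zeta>\<bar> < int M" using assms by auto
      then have "\<bar>k\<bar> * int M < 1 * int M" unfolding * by (simp add: abs_mult)
      then have "\<bar>k\<bar> < 1" using M by (simp only: mult_less_cancel_right)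
      then have "k = 0" by simp
      then show False using * False by simp
    qed
    ultimately show ?thesis using False eq geometric_sum[of w M] by simp
  qed
qed

lemma trig_parseval:
  "(\<Sum>n<M. (cmod (trig M \<alpha> n))\<^sup>2) = real M * (\<Sum>\<xi><M. (cmod (\<alpha> \<xi>))\<^sup>2)"
proof -
  have "complex_of_real (\<Sum>n<M. (cmod (trig M \<alpha> n))\<^sup>2) 
      = (\<Sum>n<M. \<Sum>\<xi><M. \<Sum>\<zeta><M. (\<alpha> \<xi> * cnj (\<alpha> \<zeta>)) * (uroot M \<xi> ^ n * cnj (uroot M \<zeta> ^ n)))"
    unfolding of_real_sum complex_norm_square trig_def cnj_sum sum_product
    by (intro sum.cong refl) simp
  also have "\<dots> = (\<Sum>\<xi><M. \<Sum>\<zeta><M. \<Sum>n<M. (\<alpha> \<xi> * cnj (\<alpha> \<zeta>)) * (uroot M \<xi> ^ n * cnj (uroot M \<zeta> ^ n)))"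
  proof -
    have "(\<Sum>n<M. \<Sum>\<zeta><M. (\<alpha> \<xi> * cnj (\<alpha> \<zeta>)) * (uroot M \<xi> ^ n * cnj (uroot M \<zeta> ^ n)))
      = (\<Sum>\<zeta><M. \<Sum>n<M. (\<alpha> \<xi> * cnj (\<alpha> \<zeta>)) * (uroot M \<xi> ^ n * cnj (uroot M \<zeta> ^ n)))" for \<xi>
      by (rule sum.swap)
    then show ?thesis by (subst sum.swap) simp
  qed
  also have "\<dots> = (\<Sum>\<xi><M. \<Sum>\<zeta><M. (\<alpha> \<xi> * cnj (\<alpha> \<zeta>)) * (if \<xi> = \<zeta> then of_nat M else 0))"
    unfolding sum_distrib_left[symmetric]
    by (intro sum.cong refl arg_cong2[where f="(*)"] sum_root_powers) auto
  also have "\<dots> = (\<Sum>\<xi><M. \<alpha> \<xi> * cnj (\<alpha> \<xi>) * of_nat M)"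
    by (intro sum.cong refl) (simp add: if_distrib[where f="\<lambda>x. _ * x"] cong: if_cong)
  also have "\<dots> = complex_of_real (real M * (\<Sum>\<xi><M. (cmod (\<alpha> \<xi>))\<^sup>2))"
    unfolding of_real_mult of_real_sum complex_norm_square by (simp add: sum_distrib_left mult.commute)
  finally show ?thesis by (simp only: of_real_eq_iff)
qed

lemma trig_representation:
  obtains \<alpha> where "\<And>n. n < M \<Longrightarrow> trig M \<alpha> n = F n"
proof
  fix n assume n: "n < M"
  define \<alpha> where "\<alpha> \<xi> = (\<Sum>l<M. F l * cnj (uroot M \<xi> ^ l)) / of_nat M" for \<xi>
  have comm: "uroot M \<xi> ^ n = uroot M n ^ \<xi>" for \<xi> n
    unfolding uroot_def Complex.DeMoivre by (simp add: mult_ac)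
  have "trig M \<alpha> n = (\<Sum>\<xi><M. \<Sum>l<M. F l / of_nat M * (uroot M n ^ \<xi> * cnj (uroot M l ^ \<xi>)))"
    unfolding trig_def \<alpha>_def sum_divide_distrib sum_distrib_right
  proof (intro sum.cong refl)
    fix \<xi> l
    show "F l * cnj (uroot M \<xi> ^ l) / of_nat M * uroot M \<xi> ^ n
        = F l / of_nat M * (uroot M n ^ \<xi> * cnj (uroot M l ^ \<xi>))"
      unfolding comm[of \<xi> n] comm[of \<xi> l] by simp
  qed
  also have "\<dots> = (\<Sum>l<M. F l / of_nat M * (\<Sum>\<xi><M. uroot M n ^ \<xi> * cnj (uroot M l ^ \<xi>)))"
    unfolding sum_distrib_left by (rule sum.swap)
  also have "\<dots> = (\<Sum>l<M. F l / of_nat M * (if n = l then of_nat M else 0))"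
    using n by (intro sum.cong refl arg_cong2[where f="(*)"] sum_root_powers) auto
  also have "\<dots> = F n" using n by (simp add: if_distrib[where f="\<lambda>x. _ * x"] cong: if_cong)
  finally show "trig M (\<lambda>\<xi>. (\<Sum>l<M. F l * cnj (uroot M \<xi> ^ l)) / of_nat M) n = F n" 
    by (simp add: \<alpha>_def[abs_def])
qed

lemma trig_sum: "trig M (\<lambda>\<xi>. \<Sum>i\<in>A. f i \<xi>) n = (\<Sum>i\<in>A. trig M (f i) n)"
  unfolding trig_def sum_distrib_right by (rule sum.swap)

lemma trig_scale: "trig M (\<lambda>\<xi>. b * f \<xi>) n = b * trig M f n"
  by (simp add: trig_def sum_distrib_left mult_ac)

lemma trig_add: "trig M (\<lambda>\<xi>. f \<xi> + h \<xi>) n = trig M f n + trig M h n"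
  by (simp add: trig_def sum.distrib algebra_simps)

lemma trig_diff: "trig M (\<lambda>\<xi>. f \<xi> - h \<xi>) n = trig M f n - trig M h n"
  by (simp add: trig_def sum_subtractf algebra_simps)

lemma trig_shift: "trig M \<alpha> (n + l) = trig M (\<lambda>\<xi>. uroot M \<xi> ^ l * \<alpha> \<xi>) n"
  by (simp add: trig_def power_add mult_ac)

section \<open>Product symbols and their jumps\<close>

text \<open>The expectation of a product of independent factors, over a random subset of \<open>{..<n}\<close>.\<close>

lemma sum_Pow_prod:
  fixes f g :: "nat \<Rightarrow> 'b::comm_semiring_1"
  shows "(\<Sum>I\<in>Pow {..<n}. \<Prod>j<n. if j \<in> I then f j else g j) = (\<Prod>j<n. f j + g j)"
proof -
  have "(\<Prod>j<n. if j \<in> I then f j else g j) = (\<Prod>j\<in>I. f j) * (\<Prod>j\<in>{..<n} - I. g j)" 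
    if "I \<in> Pow {..<n}" for I
  proof -
    have "{..<n} \<inter> I = I" using that by auto
    then show ?thesis by (simp add: prod.If_cases Int_def Diff_eq)
  qed
  then show ?thesis by (subst prod_add[OF finite_lessThan]) (intro sum.cong refl)
qed

text \<open>The values at one fixed frequency of the factors \<open>\<phi> j\<close> of a product symbol, and the distances \<open>\<tau> j\<close>
  to the trivial frequency. A position is bad if \<open>\<tau> j\<close> is at least \<open>\<delta>\<close>; at bad positions the symbol
  loses a factor \<open>\<rho>\<close>, and over runs of good positions \<open>\<tau>\<close> grows geometrically, so that sums
  over such a run are dominated by the value at its end. The condition \<open>1/2 \<le> \<rho>\<close> makes \<open>\<rho>\<close> usable as a
  probability below; it costs nothing, since \<open>\<rho>\<close> may be increased.\<close>

locale digit_symbol =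
  fixes \<phi> :: "nat \<Rightarrow> complex" and \<tau> :: "nat \<Rightarrow> real" and \<delta> \<rho> C :: real
  assumes phi_le: "cmod (\<phi> j) \<le> 1"
    and phi_near: "cmod (1 - \<phi> j) \<le> C * \<tau> j"
    and phi_bad: "\<delta> \<le> \<tau> j \<Longrightarrow> cmod (\<phi> j) \<le> \<rho>"
    and tau_grow: "\<tau> j < \<delta> \<Longrightarrow> 2 * \<tau> j \<le> \<tau> (Suc j)"
    and tau0: "0 \<le> \<tau> j" and tau2: "\<tau> j \<le> 2"
    and rho: "1/2 \<le> \<rho>" "\<rho> < 1" and C0: "0 \<le> C"
begin

abbreviation bad :: "nat \<Rightarrow> bool" where "bad j \<equiv> \<delta> \<le> \<tau> j"

text \<open>At a good position, \<open>c j\<close> is the mean of the factor that equals \<open>1\<close> with probability \<open>\<rho>\<close> and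
  \<open>psi j = \<bar>\<phi> j\<bar>\<^sup>2\<close> otherwise; bad positions do not contribute to the product \<open>a\<close>. The product symbol is \<open>m\<close>,
  and \<open>h J\<close> is the quotient \<open>m / a\<close> frozen at the last jump, that is, just after the last bad position
  below \<open>J\<close>.\<close>

definition psi :: "nat \<Rightarrow> real" where "psi j = (cmod (\<phi> j))\<^sup>2"

definition jumps :: "nat \<Rightarrow> nat" where "jumps J = card {j. j < J \<and> bad j}"

definition c :: "nat \<Rightarrow> real" where "c j = (if bad j then 1 else \<rho> + (1 - \<rho>) * psi j)"

definition a :: "nat \<Rightarrow> real" where "a J = (\<Prod>j<J. c j)"

definition m :: "nat \<Rightarrow> complex" where "m J = (\<Prod>j<J. \<phi> j)"

primrec h :: "nat \<Rightarrow> complex" where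
  "h 0 = 1"
| "h (Suc J) = (if bad J then m (Suc J) / of_real (a (Suc J)) else h J)"

lemma chi_bounds: "0 \<le> psi j" "psi j \<le> 1"
  using phi_le[of j] by (auto simp: psi_def power_le_one)

lemma chi_bad: "bad j \<Longrightarrow> psi j \<le> \<rho>\<^sup>2"
  using phi_bad[of j] by (auto simp: psi_def power_mono)

lemma c_pos: "0 < c j" using chi_bounds(1)[of j] rho by (auto simp: c_def add_pos_nonneg)

lemma c_le_1: "c j \<le> 1"
proof -
  have "(1 - \<rho>) * psi j \<le> 1 - \<rho>" using chi_bounds[of j] rho by (intro mult_left_le) auto
  then show ?thesis by (simp add: c_def)
qed

lemma a_pos: "0 < a J" by (simp add: a_def prod_pos c_pos)

lemma a_le_1: "a J \<le> 1" unfolding a_def by (intro prod_le_1) (auto simp: c_le_1 c_pos less_imp_le)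

lemma jumps_0 [simp]: "jumps 0 = 0" by (simp add: jumps_def)

lemma jumps_Suc: "jumps (Suc J) = jumps J + (if bad J then 1 else 0)"
proof (cases "bad J")
  case True
  then have "{j. j < Suc J \<and> bad j} = insert J {j. j < J \<and> bad j}" by (auto simp: less_Suc_eq)
  then show ?thesis using True by (simp add: jumps_def)
next
  case False
  then have "{j. j < Suc J \<and> bad j} = {j. j < J \<and> bad j}" by (auto simp: less_Suc_eq)
  then show ?thesis using False by (simp add: jumps_def)
qed

lemma jumps_mono: "i \<le> j \<Longrightarrow> jumps i \<le> jumps j"
  by (rule lift_Suc_mono_le[of jumps]) (auto simp: jumps_Suc)

lemma jumps_le: "jumps J \<le> J"
  by (induction J) (auto simp: jumps_Suc)

lemma m_Suc: "m (Suc J) = m J * \<phi> J" by (simp add: m_def)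

lemma a_Suc: "a (Suc J) = a J * c J" by (simp add: a_def)

text \<open>This is where \<open>\<rho> \<ge> 1/2\<close> is needed: \<open>t \<le> \<rho> + (1 - \<rho>) t\<^sup>2\<close> for \<open>0 \<le> t \<le> 1\<close>.\<close>

lemma phi_le_c: "\<not> bad j \<Longrightarrow> cmod (\<phi> j) \<le> c j"
proof -
  assume "\<not> bad j"
  have "0 \<le> (1 - cmod (\<phi> j)) * (\<rho> - (1 - \<rho>) * cmod (\<phi> j))"
  proof (intro mult_nonneg_nonneg)
    have "(1 - \<rho>) * cmod (\<phi> j) \<le> (1 - \<rho>) * 1" using rho phi_le by (intro mult_left_mono) auto
    also have "\<dots> \<le> \<rho>" using rho by simp
    finally show "0 \<le> \<rho> - (1 - \<rho>) * cmod (\<phi> j)" by simp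
  qed (use phi_le in auto)
  then show ?thesis using \<open>\<not> bad j\<close> by (simp add: c_def psi_def algebra_simps power2_eq_square)
qed

lemma m_le: "cmod (m J) \<le> a J * \<rho> ^ jumps J"
proof (induction J)
  case (Suc J)
  have "cmod (\<phi> J) \<le> c J * \<rho> ^ (if bad J then 1 else 0)"
    using phi_le_c[of J] phi_bad[of J] by (simp add: c_def)
  then have "cmod (m J) * cmod (\<phi> J) \<le> (a J * \<rho> ^ jumps J) * (c J * \<rho> ^ (if bad J then 1 else 0))"
    using Suc a_pos[of J] rho by (intro mult_mono) auto
  then show ?case by (simp add: m_Suc a_Suc jumps_Suc norm_mult power_add mult_ac)
qed (simp add: m_def a_def)

lemma h_le: "cmod (h J) \<le> \<rho> ^ jumps J"
proof (induction J)
  case (Suc J)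
  show ?case
  proof (cases "bad J")
    case True
    then show ?thesis using m_le[of "Suc J"] a_pos[of "Suc J"] by (simp add: norm_divide field_simps)
  next
    case False then show ?thesis using Suc by (simp add: jumps_Suc)
  qed
qed simp

text \<open>Since it changes only at jumps, \<open>h J\<close> is a function of the number of jumps below \<open>J\<close>.\<close>

lemma h_cong: 
  assumes "jumps i = jumps j" shows "h i = h j"
proof -
  have *: "h j = h i" if "i \<le> j" "jumps i = jumps j" for i j
    using that
  proof (induction j rule: dec_induct)
    case (step n)
    have "jumps i \<le> jumps n" "jumps n \<le> jumps (Suc n)" using step.hyps by (auto intro!: jumps_mono)
    then have "jumps n = jumps i" "jumps (Suc n) = jumps n" using step.prems by linarith+
    then have "\<not> bad n" by (auto simp: jumps_Suc)
    then show ?case using step.IH \<open>jumps n = jumps i\<close> by simp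
  qed simp
  show ?thesis
  proof (cases "i \<le> j")
    case True
    show ?thesis by (rule *[OF True assms, symmetric])
  next
    case False
    then show ?thesis by (intro *[OF _ assms[symmetric]]) simp
  qed
qed

text \<open>Freezing \<open>m / a\<close> between jumps costs little: the errors along a run of good positions add up
  geometrically to a multiple of the last distance.\<close>

lemma frozen_error: "cmod (m J - of_real (a J) * h J) \<le> 2 * C * \<rho> ^ jumps J * \<tau> J"
proof (induction J)
  case 0 then show ?case using C0 tau0 by (simp add: m_def a_def)
next
  case (Suc J)
  show ?case
  proof (cases "bad J")
    case True
    then show ?thesis using a_pos[of "Suc J"] C0 tau0[of "Suc J"] rho by simp
  next
    case False
    have cphi: "cmod (\<phi> J - of_real (c J)) \<le> 2 * C * \<tau> J"
    proof -
      have "1 - cmod (\<phi> J) \<le> cmod (1 - \<phi> J)" using norm_triangle_ineq2[of 1 "\<phi> J"] by simp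
      moreover have "0 \<le> 1 - c J" "1 - c J \<le> 1 - cmod (\<phi> J)" using c_le_1[of J] phi_le_c[OF False] by auto
      moreover have eq: "\<phi> J - of_real (c J) = of_real (1 - c J) - (1 - \<phi> J)" by simp
      have "cmod (\<phi> J - of_real (c J)) \<le> (1 - c J) + cmod (1 - \<phi> J)"
        using norm_triangle_ineq4[of "complex_of_real (1 - c J)" "1 - \<phi> J"] \<open>0 \<le> 1 - c J\<close>
        unfolding eq by (simp only: norm_of_real abs_of_nonneg)
      ultimately show ?thesis using phi_near[of J] by simp
    qed
    have "m (Suc J) - of_real (a (Suc J)) * h (Suc J)
        = \<phi> J * (m J - of_real (a J) * h J) + (\<phi> J - of_real (c J)) * (of_real (a J) * h J)"
      using False by (simp add: m_Suc a_Suc algebra_simps)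
    then have "cmod (m (Suc J) - of_real (a (Suc J)) * h (Suc J))
       \<le> cmod (\<phi> J) * cmod (m J - of_real (a J) * h J) + cmod (\<phi> J - of_real (c J)) * (a J * cmod (h J))"
      using norm_triangle_ineq[of "\<phi> J * (m J - of_real (a J) * h J)" "(\<phi> J - of_real (c J)) * (of_real (a J) * h J)"]
        a_pos[of J] by (simp add: norm_mult)
    also have "\<dots> \<le> 1 * (2 * C * \<rho> ^ jumps J * \<tau> J) + (2 * C * \<tau> J) * (1 * \<rho> ^ jumps J)"
      using Suc phi_le h_le cphi a_le_1 a_pos[of J] C0 tau0[of J]
      by (intro add_mono mult_mono) (auto simp: less_imp_le)
    also have "\<dots> = 2 * C * \<rho> ^ jumps J * (2 * \<tau> J)" by simp
    also have "\<dots> \<le> 2 * C * \<rho> ^ jumps J * \<tau> (Suc J)"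
      using tau_grow[of J] False C0 rho by (intro mult_left_mono) auto
    finally show ?thesis using False by (simp add: jumps_Suc)
  qed
qed

text \<open>The potential \<open>P\<close> drops by at least the \<open>n\<close>-th summand in every step: at good positions because
  \<open>\<tau>\<close> doubles, at bad positions because the factor \<open>\<rho>\<^sup>2\<close> is gained.\<close>

lemma sum_jump_tau: "(\<Sum>j<n. (\<rho> ^ jumps j * \<tau> j)\<^sup>2) \<le> 8 / (1 - \<rho>)"
proof -
  define A where "A = 8 / (1 - \<rho>)"
  define P where "P n = (\<rho> ^ jumps n)\<^sup>2 * (A - (\<tau> n)\<^sup>2 / 3)" for n
  have A8: "A * (1 - \<rho>) = 8" 
    unfolding A_def times_divide_eq_left using rho by (intro nonzero_mult_div_cancel_right) simp
  have A_ge: "A \<ge> 8" using rho by (simp add: A_def field_simps)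
  have t4: "(\<tau> j)\<^sup>2 \<le> 4" for j using power_mono[OF tau2 tau0, of j 2] by simp
  have P0: "P n \<ge> 0" for n unfolding P_def using A_ge t4[of n] by (intro mult_nonneg_nonneg) auto
  have step: "(\<rho> ^ jumps n * \<tau> n)\<^sup>2 \<le> P n - P (Suc n)" for n
  proof (cases "bad n")
    case True
    have "\<rho>\<^sup>2 \<le> \<rho>" using rho by (simp add: power2_eq_square mult_left_le)
    have A1: "A * (1 - \<rho>\<^sup>2) \<ge> 8" 
      using mult_left_mono[of "1 - \<rho>" "1 - \<rho>\<^sup>2" A] A8 A_ge \<open>\<rho>\<^sup>2 \<le> \<rho>\<close> by simp
    have T0: "\<rho>\<^sup>2 * ((\<tau> (Suc n))\<^sup>2 / 3) \<ge> 0" by simp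
    have "(\<tau> n)\<^sup>2 \<le> (A - (\<tau> n)\<^sup>2 / 3) - \<rho>\<^sup>2 * (A - (\<tau> (Suc n))\<^sup>2 / 3)"
    proof -
      have "\<rho>\<^sup>2 * (A - (\<tau> (Suc n))\<^sup>2 / 3) = A * \<rho>\<^sup>2 - \<rho>\<^sup>2 * ((\<tau> (Suc n))\<^sup>2 / 3)"
        "A * (1 - \<rho>\<^sup>2) = A - A * \<rho>\<^sup>2" by (simp_all add: algebra_simps)
      then show ?thesis using t4[of n] A1 T0 by linarith
    qed
    then have "(\<rho> ^ jumps n)\<^sup>2 * (\<tau> n)\<^sup>2 \<le> (\<rho> ^ jumps n)\<^sup>2 * ((A - (\<tau> n)\<^sup>2 / 3) - \<rho>\<^sup>2 * (A - (\<tau> (Suc n))\<^sup>2 / 3))"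
      by (intro mult_left_mono) auto
    then show ?thesis using True by (simp add: P_def jumps_Suc power_mult_distrib algebra_simps)
  next
    case False
    have "(2 * \<tau> n)\<^sup>2 \<le> (\<tau> (Suc n))\<^sup>2" using tau_grow[of n] False tau0[of n] by (intro power_mono) auto
    then have "(\<tau> n)\<^sup>2 \<le> (A - (\<tau> n)\<^sup>2 / 3) - (A - (\<tau> (Suc n))\<^sup>2 / 3)" by (simp add: power_mult_distrib)
    then have "(\<rho> ^ jumps n)\<^sup>2 * (\<tau> n)\<^sup>2 \<le> (\<rho> ^ jumps n)\<^sup>2 * ((A - (\<tau> n)\<^sup>2 / 3) - (A - (\<tau> (Suc n))\<^sup>2 / 3))"
      by (intro mult_left_mono) auto
    then show ?thesis using False by (simp add: P_def jumps_Suc power_mult_distrib algebra_simps)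
  qed
  have "(\<Sum>j<n. (\<rho> ^ jumps j * \<tau> j)\<^sup>2) \<le> (\<Sum>j<n. P j - P (Suc j))" by (intro sum_mono step)
  also have "\<dots> = P 0 - P n" by (rule sum_lessThan_telescope')
  also have "\<dots> \<le> A"
  proof -
    have "P 0 \<le> A" by (simp add: P_def)
    then show ?thesis using P0[of n] by linarith
  qed
  finally show ?thesis by (simp add: A_def)
qed

text \<open>Let \<open>I\<close> be a random set that contains each position \<open>j < L\<close> independently with probability \<open>\<rho>\<close>.
  The factor \<open>X J I\<close> damps the positions below \<open>J\<close> that are not in \<open>I\<close>. The weight \<open>V L r I\<close>, which does
  not depend on \<open>J\<close>, forces the first \<open>r\<close> jumps into \<open>I\<close> and compensates for the probability
  of that event; at the jump number \<open>r\<close> (counted from \<open>0\<close>) its two values solve a linear system: mean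
  \<open>1\<close> if the jump is not yet damped, and mean \<open>0\<close> if it is. Consequently the expectation of \<open>X J I * V L r I\<close>
  is \<open>a J\<close> as long as at most \<open>r\<close> jumps lie below \<open>J\<close>, and \<open>0\<close> afterwards.\<close>

definition v :: "nat \<Rightarrow> bool \<Rightarrow> nat \<Rightarrow> real" where
  "v r b j = (if \<not> bad j \<or> r < jumps j then 1
     else if jumps j < r then (if b then 1 / \<rho> else 0)
     else if b then - psi j / (\<rho> * (1 - psi j)) else 1 / ((1 - \<rho>) * (1 - psi j)))"

definition V :: "nat \<Rightarrow> nat \<Rightarrow> nat set \<Rightarrow> real" where
  "V L r I = (\<Prod>j<L. v r (j \<in> I) j)"

definition X :: "nat \<Rightarrow> nat set \<Rightarrow> real" where
  "X J I = (\<Prod>j<J. if j \<in> I then 1 else psi j)"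

end

text \<open>The law of the random set \<open>I\<close>.\<close>

definition bern :: "real \<Rightarrow> nat \<Rightarrow> nat set \<Rightarrow> real" where
  "bern \<rho> L I = (\<Prod>j<L. if j \<in> I then \<rho> else 1 - \<rho>)"

context digit_symbol begin

lemma chi_less_1: "bad j \<Longrightarrow> psi j < 1"
  using chi_bad[of j] rho power_strict_mono[of \<rho> 1 2] by simp

lemma v_mean_before: "\<rho> * v r True j + (1 - \<rho>) * v r False j = 1"
  using chi_less_1[of j] rho by (auto simp: v_def divide_simps)

lemma v_mean_after:
  assumes "\<not> (bad j \<and> r < jumps j)"
  shows "\<rho> * v r True j + (1 - \<rho>) * v r False j * psi j = (if bad j \<and> jumps j = r then 0 else c j)"
proof -
  consider "\<not> bad j" | "bad j" "jumps j < r" | "bad j" "jumps j = r" using assms by linarith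
  then show ?thesis
  proof cases
    case 3
    then have "1 - psi j \<noteq> 0" "\<rho> \<noteq> 0" "1 - \<rho> \<noteq> 0" using chi_less_1[of j] rho by auto
    then show ?thesis using 3 by (simp add: v_def)
  qed (use rho in \<open>simp_all add: v_def c_def\<close>)
qed

lemma exists_jump:
  assumes "r < jumps J" obtains j where "j < J" "bad j" "jumps j = r"
proof -
  have "\<exists>j<J. bad j \<and> jumps j = r" using assms
  proof (induction J)
    case (Suc J)
    show ?case
    proof (cases "r < jumps J")
      case True then show ?thesis using Suc.IH by (auto intro: less_SucI)
    next
      case False
      then show ?thesis using Suc.prems by (intro exI[of _ J]) (auto simp: jumps_Suc split: if_splits)
    qed
  qed simp
  then show thesis using that by blast
qed

lemma expectation_XV:
  assumes "J \<le> L"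
  shows "(\<Sum>I\<in>Pow {..<L}. bern \<rho> L I * (X J I * V L r I)) = (if jumps J \<le> r then a J else 0)"
proof -
  define x where "x j = (if j < J then psi j else 1)" for j
  have X: "X J I = (\<Prod>j<L. if j \<in> I then 1 else x j)" for I
  proof -
    have "(\<Prod>j<L. if j \<in> I then 1 else x j) = (\<Prod>j<J. if j \<in> I then 1 else x j)"
      using assms by (intro prod.mono_neutral_right) (auto simp: x_def)
    then show ?thesis by (simp add: X_def x_def cong: if_cong)
  qed
  have "(\<Sum>I\<in>Pow {..<L}. bern \<rho> L I * (X J I * V L r I))
     = (\<Sum>I\<in>Pow {..<L}. \<Prod>j<L. if j \<in> I then \<rho> * v r True j else (1 - \<rho>) * v r False j * x j)"
    unfolding bern_def X V_def prod.distrib[symmetric] by (intro sum.cong prod.cong refl) auto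
  also have "\<dots> = (\<Prod>j<L. \<rho> * v r True j + (1 - \<rho>) * v r False j * x j)" by (rule sum_Pow_prod)
  also have "\<dots> = (if jumps J \<le> r then a J else 0)"
  proof (cases "jumps J \<le> r")
    case True
    have "(\<Prod>j<L. \<rho> * v r True j + (1 - \<rho>) * v r False j * x j) = (\<Prod>j<L. if j < J then c j else 1)"
    proof (intro prod.cong refl)
      fix j
      show "\<rho> * v r True j + (1 - \<rho>) * v r False j * x j = (if j < J then c j else 1)"
      proof (cases "j < J")
        case jJ: True
        have "jumps (Suc j) \<le> jumps J" using jJ by (intro jumps_mono) simp
        then have *: "bad j \<Longrightarrow> jumps j < r" using True by (simp add: jumps_Suc)
        then have "\<not> (bad j \<and> r < jumps j)" by auto
        from v_mean_after[OF this] show ?thesis using jJ * by (auto simp: x_def)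
      qed (use v_mean_before in \<open>simp add: x_def\<close>)
    qed
    also have "\<dots> = (\<Prod>j<J. if j < J then c j else 1)"
      using assms by (intro prod.mono_neutral_right) auto
    finally show ?thesis using True by (simp add: a_def)
  next
    case False
    then obtain j where j: "j < J" "bad j" "jumps j = r" by (auto elim: exists_jump simp: not_le)
    then have "\<rho> * v r True j + (1 - \<rho>) * v r False j * x j = 0"
      using v_mean_after[of j r] by (simp add: x_def)
    then have "(\<Prod>j<L. \<rho> * v r True j + (1 - \<rho>) * v r False j * x j) = 0"
      using j(1) assms by (intro prod_zero) (auto intro!: bexI[of _ j])
    then show ?thesis using False by simp
  qed
  finally show ?thesis .
qed

text \<open>A bound for the second moment of the factor of \<open>V\<close> at the jump number \<open>r\<close>.\<close>

definition K :: real where "K = (1 / \<rho> + 1 / (1 - \<rho>)) / (1 - \<rho>\<^sup>2)\<^sup>2"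

lemma K_ge_1: "1 \<le> K"
proof -
  have "(1 - \<rho>\<^sup>2)\<^sup>2 \<le> 1" using rho by (intro power_le_one) (auto simp: power_le_one)
  moreover have "0 < 1 - \<rho>\<^sup>2" using rho power_strict_mono[of \<rho> 1 2] by simp
  moreover have "1 \<le> 1 / \<rho> + 1 / (1 - \<rho>)"
  proof -
    have "1 \<le> 1 / \<rho>" "0 \<le> 1 / (1 - \<rho>)" using rho by auto
    then show ?thesis by linarith
  qed
  ultimately show ?thesis unfolding K_def by (simp add: le_divide_eq)
qed

lemma v_second_moment:
  "\<rho> * (v r True j)\<^sup>2 + (1 - \<rho>) * (v r False j)\<^sup>2 \<le> 
     (if \<not> bad j \<or> r < jumps j then 1 else if jumps j < r then 1 / \<rho> else K)"
proof (cases "bad j \<and> jumps j = r")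
  case True
  have lt: "0 < 1 - psi j" using chi_less_1[of j] True by simp
  have le: "0 < 1 - \<rho>\<^sup>2" "1 - \<rho>\<^sup>2 \<le> 1 - psi j" using chi_bad[of j] True rho power_strict_mono[of \<rho> 1 2] by auto
  have "\<rho> * (v r True j)\<^sup>2 + (1 - \<rho>) * (v r False j)\<^sup>2 = ((psi j)\<^sup>2 / \<rho> + 1 / (1 - \<rho>)) / (1 - psi j)\<^sup>2"
  proof -
    have "x * (p / (x * y))\<^sup>2 = p\<^sup>2 / x / y\<^sup>2" if "0 < x" for x p y :: real
      using that by (simp add: power_divide power_mult_distrib power2_eq_square)
    from this[of \<rho> "- psi j" "1 - psi j"] this[of "1 - \<rho>" 1 "1 - psi j"] show ?thesis
      using True rho by (simp add: v_def add_divide_distrib)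
  qed
  also have "\<dots> \<le> (1 / \<rho> + 1 / (1 - \<rho>)) / (1 - \<rho>\<^sup>2)\<^sup>2"
    using le rho chi_bounds[of j]
    by (intro frac_le add_mono divide_right_mono power_mono) (auto simp: power_le_one)
  finally show ?thesis using True by (simp add: K_def)
qed (use rho in \<open>auto simp: v_def power2_eq_square\<close>)

text \<open>The price of the weights is \<open>\<rho>\<^bsup>-r\<^esup>\<close> in mean square. The symbol itself has decayed to \<open>\<rho>\<^sup>r\<close> after
  \<open>r\<close> jumps, hence to \<open>\<rho>\<^bsup>2r\<^esup>\<close> in mean square, which wins.\<close>

lemma expectation_V_square:
  "(\<Sum>I\<in>Pow {..<L}. bern \<rho> L I * (V L r I)\<^sup>2) \<le> K / \<rho> ^ r"
proof -
  define q where "q j = \<rho> * (v r True j)\<^sup>2 + (1 - \<rho>) * (v r False j)\<^sup>2" for j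
  have "(\<Sum>I\<in>Pow {..<L}. bern \<rho> L I * (V L r I)\<^sup>2)
     = (\<Sum>I\<in>Pow {..<L}. \<Prod>j<L. if j \<in> I then \<rho> * (v r True j)\<^sup>2 else (1 - \<rho>) * (v r False j)\<^sup>2)"
    unfolding bern_def V_def prod_power_distrib prod.distrib[symmetric] 
    by (intro sum.cong prod.cong refl) auto
  also have "\<dots> = (\<Prod>j<L. q j)" unfolding q_def by (rule sum_Pow_prod)
  also have "\<dots> \<le> (1 / \<rho>) ^ min (jumps L) r * (if r < jumps L then K else 1)"
  proof (induction L)
    case (Suc n)
    have q0: "0 \<le> q n" using rho by (simp add: q_def)
    have q: "q n \<le> (if \<not> bad n \<or> r < jumps n then 1 else if jumps n < r then 1 / \<rho> else K)"
      unfolding q_def by (rule v_second_moment)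
    have "(\<Prod>j<Suc n. q j) \<le> ((1 / \<rho>) ^ min (jumps n) r * (if r < jumps n then K else 1)) *
        (if \<not> bad n \<or> r < jumps n then 1 else if jumps n < r then 1 / \<rho> else K)"
      unfolding prod.lessThan_Suc
      by (rule mult_mono[OF Suc.IH q _ q0]) (use K_ge_1 rho in \<open>simp\<close>)
    also have "\<dots> = (1 / \<rho>) ^ min (jumps (Suc n)) r * (if r < jumps (Suc n) then K else 1)"
    proof -
      consider "\<not> bad n" | "bad n" "jumps n < r" | "bad n" "jumps n = r" | "bad n" "r < jumps n" by linarith
      then show ?thesis
      proof cases
        case 2
        then have "min (jumps n) r = jumps n" "min (Suc (jumps n)) r = Suc (jumps n)" by auto
        then show ?thesis using 2 by (simp add: jumps_Suc)
      next
        case 4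
        then have "min (jumps n) r = r" "min (Suc (jumps n)) r = r" by auto
        then show ?thesis using 4 by (simp add: jumps_Suc)
      qed (simp_all add: jumps_Suc)
    qed
    finally show ?case .
  qed simp
  also have "\<dots> \<le> (1 / \<rho>) ^ r * K"
  proof -
    have "1 \<le> 1 / \<rho>" using rho by simp
    then show ?thesis
      by (rule mult_mono[OF power_increasing[OF min.cobounded2]]) (use rho K_ge_1 in simp_all)
  qed
  finally show ?thesis by (simp add: power_divide)
qed

text \<open>The value of \<open>h\<close> after \<open>s\<close> jumps, and \<open>0\<close> if there are fewer than \<open>s\<close> jumps below \<open>L\<close>.\<close>

definition \<eta> :: "nat \<Rightarrow> nat \<Rightarrow> complex" where
  "\<eta> L s = (if \<exists>J\<le>L. jumps J = s then h (SOME J. jumps J = s) else 0)"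

lemma eta_jumps: "J \<le> L \<Longrightarrow> \<eta> L (jumps J) = h J"
proof -
  assume "J \<le> L"
  have "jumps (SOME i. jumps i = jumps J) = jumps J" by (rule someI[of _ J]) simp
  then have "h (SOME i. jumps i = jumps J) = h J" by (rule h_cong)
  then show ?thesis using \<open>J \<le> L\<close> by (auto simp: \<eta>_def)
qed

lemma eta_top: "L < s \<Longrightarrow> \<eta> L s = 0"
proof -
  assume "L < s"
  then have "\<not> (\<exists>J\<le>L. jumps J = s)" using jumps_le by (meson le_trans not_le)
  then show ?thesis unfolding \<eta>_def by (rule if_not_P)
qed

lemma eta_le: "cmod (\<eta> L s) \<le> \<rho> ^ s"
proof (cases "\<exists>J\<le>L. jumps J = s")
  case True
  then obtain J where "J \<le> L" "jumps J = s" by blast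
  then show ?thesis using eta_jumps[of J L] h_le[of J] by simp
next
  case False
  then have "\<eta> L s = 0" unfolding \<eta>_def by (rule if_not_P)
  then show ?thesis using rho by simp
qed

lemma h_telescope:
  assumes "J \<le> L"
  shows "h J = (\<Sum>r\<le>L. (\<eta> L r - \<eta> L (Suc r)) * (if jumps J \<le> r then 1 else 0))"
proof -
  have "(\<Sum>r\<le>L. (\<eta> L r - \<eta> L (Suc r)) * (if jumps J \<le> r then 1 else 0))
     = (\<Sum>r=jumps J..L. \<eta> L r - \<eta> L (Suc r))"
    by (intro sum.mono_neutral_cong_right) auto
  also have "\<dots> = \<eta> L (jumps J) - \<eta> L (Suc L)"
    using jumps_le[of J] assms sum_Suc_diff[of "jumps J" L "\<lambda>r. - \<eta> L r"] by simp
  finally show ?thesis using assms by (simp add: eta_jumps eta_top)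
qed

end

section \<open>The symbol of the digit averages\<close>

text \<open>The Fourier transform of the uniform distribution on the digits, as a function of a point \<open>z\<close> of the
  unit circle, and a substitute for the distance of \<open>z\<close> to the frequencies at which it has modulus \<open>1\<close>:
  if \<open>0\<close> is a digit, these are the zeros of \<open>dist_one D\<close>. The exponent \<open>Gcd D\<close> takes care of digit sets with a common divisor.\<close>

definition phi :: "nat set \<Rightarrow> complex \<Rightarrow> complex" where
  "phi D z = (\<Sum>a\<in>D. z ^ a) / of_nat (card D)"

definition dist_one :: "nat set \<Rightarrow> complex \<Rightarrow> real" where
  "dist_one D z = cmod (1 - z ^ Gcd D)"

lemma norm_one_minus_power:
  assumes "cmod z = 1" shows "cmod (1 - z ^ n) \<le> real n * cmod (1 - z)"
  using norm_power_diff[of 1 z n] assms by simp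


text \<open>A quantitative form of Bezout's identity in the circle group.\<close>

lemma gcd_powers_close:
  assumes "finite D"
  shows "\<exists>B\<ge>0. \<forall>z. cmod z = 1 \<longrightarrow> cmod (1 - z ^ Gcd D) \<le> B * (\<Sum>a\<in>D. cmod (1 - z ^ a))"
  using assms
proof (induction D rule: finite_induct)
  case (insert a D)
  then obtain B where B: "0 \<le> B" "\<And>z. cmod z = 1 \<Longrightarrow> cmod (1 - z ^ Gcd D) \<le> B * (\<Sum>a\<in>D. cmod (1 - z ^ a))"
    by blast
  show ?case
  proof (cases "a = 0")
    case True
    then show ?thesis using B insert.hyps by (intro exI[of _ B]) simp
  next
    case False
    obtain x y where xy: "a * x = Gcd D * y + gcd a (Gcd D)" using bezout_nat[OF False] by blast
    have "cmod (1 - z ^ Gcd (insert a D)) \<le> (real x + real y * B) * (\<Sum>a\<in>insert a D. cmod (1 - z ^ a))"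
      if z: "cmod z = 1" for z
    proof -
      define S where "S = (\<Sum>a\<in>D. cmod (1 - z ^ a))"
      have S0: "0 \<le> S" by (simp add: S_def sum_nonneg)
      have "cmod (1 - z ^ gcd a (Gcd D)) = cmod (z ^ (Gcd D * y) * (1 - z ^ gcd a (Gcd D)))"
        using z by (simp add: norm_mult norm_power)
      also have "z ^ (Gcd D * y) * (1 - z ^ gcd a (Gcd D)) = z ^ (Gcd D * y) - z ^ (a * x)"
        unfolding xy by (simp add: power_add algebra_simps)
      also have "\<dots> = (1 - (z ^ a) ^ x) - (1 - (z ^ Gcd D) ^ y)"
        by (simp add: power_mult)
      also have "cmod \<dots> \<le> cmod (1 - (z ^ a) ^ x) + cmod (1 - (z ^ Gcd D) ^ y)"
        by (rule norm_triangle_ineq4)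
      also have "\<dots> \<le> real x * cmod (1 - z ^ a) + real y * cmod (1 - z ^ Gcd D)"
        using z by (intro add_mono norm_one_minus_power) (auto simp: norm_power)
      also have "\<dots> \<le> real x * cmod (1 - z ^ a) + real y * (B * S)"
        using B(2)[OF z] by (intro add_mono mult_left_mono) (auto simp: S_def)
      also have "\<dots> \<le> (real x + real y * B) * (cmod (1 - z ^ a) + S)"
        using B(1) S0 by (simp add: algebra_simps)
      finally show ?thesis using insert.hyps by (simp add: S_def)
    qed
    then show ?thesis using B(1) by (intro exI[of _ "real x + real y * B"]) auto
  qed
qed (intro exI[of _ 0], simp)

lemma phi_variance:
  assumes fin: "finite D" and ne: "D \<noteq> {}" and z: "cmod z = 1"
  shows "(\<Sum>a\<in>D. (cmod (z ^ a - phi D z))\<^sup>2) = real (card D) * (1 - (cmod (phi D z))\<^sup>2)"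
proof -
  let ?p = "phi D z" and ?k = "of_nat (card D) :: complex"
  have k: "?k \<noteq> 0" using fin ne by simp
  then have s: "(\<Sum>a\<in>D. z ^ a) = ?k * ?p" by (simp add: phi_def)
  have s': "(\<Sum>a\<in>D. cnj (z ^ a)) = ?k * cnj ?p"
    using arg_cong[OF s, of cnj] by simp
  have one: "z ^ a * cnj (z ^ a) = 1" for a
    unfolding complex_norm_square[symmetric] using z by (simp add: norm_power)
  have "complex_of_real (\<Sum>a\<in>D. (cmod (z ^ a - ?p))\<^sup>2)
     = (\<Sum>a\<in>D. 1 - z ^ a * cnj ?p - ?p * cnj (z ^ a) + ?p * cnj ?p)"
    unfolding of_real_sum complex_norm_square 
    by (intro sum.cong refl) (use one in \<open>simp add: algebra_simps\<close>)
  also have "\<dots> = ?k - (\<Sum>a\<in>D. z ^ a) * cnj ?p - ?p * (\<Sum>a\<in>D. cnj (z ^ a)) + ?k * (?p * cnj ?p)"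
    by (simp only: sum.distrib sum_subtractf sum_distrib_left sum_distrib_right) simp
  also have "\<dots> = ?k * (1 - ?p * cnj ?p)" unfolding s s' by (simp add: algebra_simps)
  also have "\<dots> = complex_of_real (real (card D) * (1 - (cmod ?p)\<^sup>2))"
    by (simp only: of_real_mult of_real_diff complex_norm_square of_real_of_nat_eq of_real_1)
  finally show ?thesis by (simp only: of_real_eq_iff)
qed

lemma norm_phi_le_1:
  assumes "finite D" "D \<noteq> {}" "cmod z = 1" shows "cmod (phi D z) \<le> 1"
proof -
  have "cmod (\<Sum>a\<in>D. z ^ a) \<le> real (card D)"
    using norm_sum[of "\<lambda>a. z ^ a" D] assms by (simp add: norm_power)
  then show ?thesis using assms by (simp add: phi_def norm_divide divide_le_eq_1 card_gt_0_iff)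
qed

lemma norm_one_minus_phi:
  assumes "finite D" "D \<noteq> {}" "D \<subseteq> {0..<d}" and z: "cmod z = 1"
  shows "cmod (1 - phi D z) \<le> real d * dist_one D z"
proof -
  have k: "card D \<noteq> 0" using assms by simp
  have "1 - phi D z = (\<Sum>a\<in>D. 1 - z ^ a) / of_nat (card D)"
    using k by (simp add: phi_def sum_subtractf diff_divide_distrib)
  moreover have "cmod (\<Sum>a\<in>D. 1 - z ^ a) \<le> (\<Sum>a\<in>D. real d * dist_one D z)"
  proof (rule sum_norm_le)
    fix a assume "a \<in> D"
    then obtain b where b: "a = Gcd D * b" using Gcd_dvd by (metis dvdE)
    have "real b * dist_one D z \<le> real d * dist_one D z"
    proof (cases "Gcd D = 0")
      case False
      then have "b \<le> a" using b by (cases "Gcd D") auto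
      moreover have "a < d" using \<open>a \<in> D\<close> assms by auto
      ultimately show ?thesis by (intro mult_right_mono) (auto simp: dist_one_def)
    next
      case True
      have "dist_one D z = 0" unfolding dist_one_def True by simp
      then show ?thesis by simp
    qed
    moreover have "cmod (1 - (z ^ Gcd D) ^ b) \<le> real b * cmod (1 - z ^ Gcd D)"
      using z by (intro norm_one_minus_power) (simp add: norm_power)
    ultimately show "cmod (1 - z ^ a) \<le> real d * dist_one D z"
      by (simp add: b power_mult dist_one_def)
  qed
  ultimately show ?thesis using k by (simp add: norm_divide divide_le_eq mult.commute)
qed

text \<open>The deficit \<open>1 - \<bar>phi D z\<bar>\<^sup>2\<close> is the variance of \<open>z ^ a\<close> over the digits \<open>a\<close>; since \<open>0\<close> is a digit, it
  controls every \<open>\<bar>1 - z ^ a\<bar>\<^sup>2\<close>, and by Bezout the distance to the trivial frequencies.\<close>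

lemma phi_spectral_gap:
  assumes fin: "finite D" and "0 \<in> D"
  shows "\<exists>c>0. \<forall>z. cmod z = 1 \<longrightarrow> c * (dist_one D z)\<^sup>2 \<le> 1 - (cmod (phi D z))\<^sup>2"
proof -
  obtain B where B: "0 \<le> B" "\<And>z. cmod z = 1 \<Longrightarrow> cmod (1 - z ^ Gcd D) \<le> B * (\<Sum>a\<in>D. cmod (1 - z ^ a))"
    using gcd_powers_close[OF fin] by blast
  have ne: "D \<noteq> {}" using assms by auto
  define k where "k = real (card D)"
  have k: "0 < k" using fin ne by (simp add: k_def card_gt_0_iff)
  define C where "C = (B * k)\<^sup>2 * (2 * k) + 1"
  have C: "0 < C" using k by (simp add: C_def add_nonneg_pos)
  have "(dist_one D z)\<^sup>2 \<le> C * (1 - (cmod (phi D z))\<^sup>2)" if z: "cmod z = 1" for z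
  proof -
    define V where "V = 1 - (cmod (phi D z))\<^sup>2"
    have V0: "0 \<le> V" using norm_phi_le_1[OF fin ne z] by (simp add: V_def power_le_one)
    have each: "(cmod (1 - z ^ a))\<^sup>2 \<le> 2 * k * V" if "a \<in> D" for a
    proof (cases "a = 0")
      case False
      let ?p = "phi D z"
      have "(cmod (1 - z ^ a))\<^sup>2 \<le> (cmod (1 - ?p) + cmod (z ^ a - ?p))\<^sup>2"
        using norm_triangle_ineq4[of "1 - ?p" "z ^ a - ?p"] by (intro power_mono) auto
      also have "\<dots> \<le> 2 * ((cmod (1 - ?p))\<^sup>2 + (cmod (z ^ a - ?p))\<^sup>2)"
        using sum_squares_bound[of "cmod (1 - ?p)" "cmod (z ^ a - ?p)"] by (simp add: power2_sum)
      also have "(cmod (1 - ?p))\<^sup>2 + (cmod (z ^ a - ?p))\<^sup>2 = (\<Sum>b\<in>{0,a}. (cmod (z ^ b - ?p))\<^sup>2)"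
        using False by simp
      also have "\<dots> \<le> (\<Sum>b\<in>D. (cmod (z ^ b - ?p))\<^sup>2)"
        using fin \<open>0 \<in> D\<close> that by (intro sum_mono2) auto
      also have "\<dots> = k * V" unfolding k_def V_def by (rule phi_variance[OF fin ne z])
      finally show ?thesis by simp
    qed (use k V0 in simp)
    have "cmod (1 - z ^ a) \<le> sqrt (2 * k * V)" if "a \<in> D" for a
      using each[OF that] by (rule real_le_rsqrt)
    then have "(\<Sum>a\<in>D. cmod (1 - z ^ a)) \<le> k * sqrt (2 * k * V)"
      using sum_bounded_above[of D "\<lambda>a. cmod (1 - z ^ a)" "sqrt (2 * k * V)"] by (simp add: k_def)
    then have "dist_one D z \<le> B * (k * sqrt (2 * k * V))"
      using B(2)[OF z] B(1) mult_left_mono by (fastforce simp: dist_one_def)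
    then have "(dist_one D z)\<^sup>2 \<le> (B * (k * sqrt (2 * k * V)))\<^sup>2"
      by (rule power_mono) (unfold dist_one_def, rule norm_ge_zero)
    also have "\<dots> = (B * k)\<^sup>2 * (2 * k) * V" using k V0 by (simp add: power_mult_distrib)
    also have "\<dots> \<le> C * V" using V0 by (intro mult_right_mono) (auto simp: C_def)
    finally show ?thesis by (simp add: V_def)
  qed
  then show ?thesis using C
    by (intro exI[of _ "1 / C"]) (auto simp: divide_le_eq mult.commute)
qed

lemma dist_one_expand:
  assumes d: "3 \<le> d" and z: "cmod z = 1" and small: "dist_one D z < 1 / (real d)\<^sup>2"
  shows "2 * dist_one D z \<le> dist_one D (z ^ d)"
proof -
  define w where "w = z ^ Gcd D"
  have w: "cmod w = 1" using z by (simp add: w_def norm_power)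
  have small': "cmod (1 - w) * (real d)\<^sup>2 < 1" 
    using small d by (simp add: dist_one_def w_def field_simps)
  have "cmod (of_nat d - (\<Sum>i<d. w ^ i)) = cmod (\<Sum>i<d. 1 - w ^ i)" by (simp add: sum_subtractf)
  also have "\<dots> \<le> (\<Sum>i<d. real d * cmod (1 - w))"
  proof (rule sum_norm_le)
    fix i assume "i \<in> {..<d}"
    then show "cmod (1 - w ^ i) \<le> real d * cmod (1 - w)"
      using norm_one_minus_power[OF w, of i] mult_right_mono[of "real i" "real d" "cmod (1 - w)"] by auto
  qed
  also have "\<dots> = cmod (1 - w) * (real d)\<^sup>2" by (simp add: power2_eq_square)
  finally have "cmod (of_nat d - (\<Sum>i<d. w ^ i)) \<le> 1" using small' by simp
  then have "2 \<le> cmod (\<Sum>i<d. w ^ i)"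
    using norm_triangle_ineq2[of "of_nat d :: complex" "of_nat d - (\<Sum>i<d. w ^ i)"] d by simp
  then have "2 * cmod (1 - w) \<le> cmod (\<Sum>i<d. w ^ i) * cmod (1 - w)" by (intro mult_right_mono) auto
  also have "\<dots> = cmod (1 - w ^ d)"
    unfolding one_diff_power_eq by (simp add: norm_mult mult.commute)
  finally show ?thesis by (simp add: dist_one_def w_def power_mult[symmetric] mult.commute)
qed

text \<open>The symbol of the average over all numbers with \<open>J\<close> digits from \<open>D\<close>.\<close>

definition symb :: "nat \<Rightarrow> nat set \<Rightarrow> nat \<Rightarrow> complex \<Rightarrow> complex" where
  "symb d D J z = (\<Prod>j<J. phi D (z ^ (d ^ j)))"

lemma cantor_digit_symbol:
  assumes d: "3 \<le> d" and D: "D \<subseteq> {0..<d}" "0 \<in> D"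
  shows "\<exists>\<delta> \<rho>. \<forall>z. cmod z = 1 \<longrightarrow>
    digit_symbol (\<lambda>j. phi D (z ^ (d ^ j))) (\<lambda>j. dist_one D (z ^ (d ^ j))) \<delta> \<rho> (real d)"
proof -
  have fin: "finite D" using D finite_subset by blast
  have ne: "D \<noteq> {}" using D by auto
  obtain c where c: "0 < c" "\<And>z. cmod z = 1 \<Longrightarrow> c * (dist_one D z)\<^sup>2 \<le> 1 - (cmod (phi D z))\<^sup>2"
    using phi_spectral_gap[OF fin D(2)] by blast
  define \<delta> where "\<delta> = 1 / (real d)\<^sup>2"
  define \<rho> where "\<rho> = max (1/2) (sqrt (1 - c * \<delta>\<^sup>2))"
  have \<delta>: "0 < \<delta>" using d by (simp add: \<delta>_def)
  have "digit_symbol (\<lambda>j. phi D (z ^ (d ^ j))) (\<lambda>j. dist_one D (z ^ (d ^ j))) \<delta> \<rho> (real d)"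
    if z: "cmod z = 1" for z
  proof
    fix j
    have zj: "cmod (z ^ (d ^ j)) = 1" using z by (simp add: norm_power)
    show "cmod (phi D (z ^ d ^ j)) \<le> 1" by (rule norm_phi_le_1[OF fin ne zj])
    show "cmod (1 - phi D (z ^ d ^ j)) \<le> real d * dist_one D (z ^ d ^ j)"
      by (rule norm_one_minus_phi[OF fin ne D(1) zj])
    show "cmod (phi D (z ^ d ^ j)) \<le> \<rho>" if "\<delta> \<le> dist_one D (z ^ d ^ j)"
    proof -
      have "c * \<delta>\<^sup>2 \<le> c * (dist_one D (z ^ d ^ j))\<^sup>2" using that \<delta> c(1) by (intro mult_left_mono power_mono) auto
      then have "(cmod (phi D (z ^ d ^ j)))\<^sup>2 \<le> 1 - c * \<delta>\<^sup>2" using c(2)[OF zj] by linarith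
      then show ?thesis by (simp add: \<rho>_def real_le_rsqrt le_max_iff_disj)
    qed
    show "2 * dist_one D (z ^ d ^ j) \<le> dist_one D (z ^ d ^ Suc j)" if "dist_one D (z ^ d ^ j) < \<delta>"
      using dist_one_expand[OF d zj] that by (simp add: \<delta>_def power_mult[symmetric] mult.commute)
    show "0 \<le> dist_one D (z ^ d ^ j)" by (simp add: dist_one_def)
    show "dist_one D (z ^ d ^ j) \<le> 2" 
      using norm_triangle_ineq4[of 1 "(z ^ d ^ j) ^ Gcd D"] zj by (simp add: dist_one_def norm_power)
  next
    have "sqrt (1 - c * \<delta>\<^sup>2) < 1" using c(1) \<delta> by (simp add: real_sqrt_lt_1_iff)
    then show "\<rho> < 1" by (simp add: \<rho>_def)
  qed (auto simp: \<rho>_def)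
  then show ?thesis by blast
qed

text \<open>By the spectral gap, the summands are dominated by the decrements of \<open>\<bar>symb d D l z\<bar>\<^sup>2\<close>.\<close>

lemma symb_square_function:
  assumes "D \<subseteq> {0..<d}" "0 \<in> D"
  shows "\<exists>C. \<forall>z. cmod z = 1 \<longrightarrow> (\<forall>L. (\<Sum>l<L. (cmod (symb d D l z) * dist_one D (z ^ (d ^ l)))\<^sup>2) \<le> C)"
proof -
  have fin: "finite D" using assms finite_subset by blast
  obtain c where c: "0 < c" "\<And>z. cmod z = 1 \<Longrightarrow> c * (dist_one D z)\<^sup>2 \<le> 1 - (cmod (phi D z))\<^sup>2"
    using phi_spectral_gap[OF fin assms(2)] by blast
  have "(\<Sum>l<L. (cmod (symb d D l z) * dist_one D (z ^ (d ^ l)))\<^sup>2) \<le> 1 / c" if z: "cmod z = 1" for z L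
  proof -
    let ?P = "\<lambda>l. (cmod (symb d D l z))\<^sup>2 / c"
    have "(cmod (symb d D l z) * dist_one D (z ^ (d ^ l)))\<^sup>2 \<le> ?P l - ?P (Suc l)" for l
    proof -
      have "(dist_one D (z ^ (d ^ l)))\<^sup>2 \<le> (1 - (cmod (phi D (z ^ (d ^ l))))\<^sup>2) / c"
        using c(2)[of "z ^ (d ^ l)"] c(1) z by (simp add: norm_power field_simps)
      then have "(cmod (symb d D l z))\<^sup>2 * (dist_one D (z ^ (d ^ l)))\<^sup>2 
         \<le> (cmod (symb d D l z))\<^sup>2 * ((1 - (cmod (phi D (z ^ (d ^ l))))\<^sup>2) / c)"
        by (intro mult_left_mono) auto
      then show ?thesis
        by (simp add: symb_def norm_mult power_mult_distrib diff_divide_distrib algebra_simps)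
    qed
    then have "(\<Sum>l<L. (cmod (symb d D l z) * dist_one D (z ^ (d ^ l)))\<^sup>2) \<le> (\<Sum>l<L. ?P l - ?P (Suc l))"
      by (intro sum_mono)
    also have "\<dots> = ?P 0 - ?P L" by (rule sum_lessThan_telescope')
    also have "\<dots> \<le> 1 / c" using c(1) by (simp add: symb_def)
    finally show ?thesis .
  qed
  then show ?thesis by blast
qed

section \<open>A maximal theorem of Rota type\<close>

text \<open>The position after \<open>J\<close> steps of the walk whose \<open>j\<close>-th step is \<open>s j * d ^ j\<close>, with the steps in \<open>I\<close>
  and those from \<open>L\<close> on suppressed.\<close>

definition partial_walk :: "nat \<Rightarrow> nat set \<Rightarrow> nat \<Rightarrow> nat \<Rightarrow> (nat \<Rightarrow> nat) \<Rightarrow> nat" where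
  "partial_walk d I L J s = (\<Sum>j<L. if j < J \<and> j \<notin> I then s j * d ^ j else 0)"

text \<open>The walk starts at a point of the cyclic group of order \<open>M\<close>; its state space consists of the pairs of
  a starting point and a digit sequence. The label records the position at time \<open>J\<close> and all later
  digits, and so determines the label at time \<open>J + 1\<close>.\<close>

definition walk_label :: "nat \<Rightarrow> nat set \<Rightarrow> nat \<Rightarrow> nat \<Rightarrow> nat \<Rightarrow> nat \<times> (nat \<Rightarrow> nat) \<Rightarrow> nat \<times> (nat \<Rightarrow> nat)" where
  "walk_label M I L d J w = ((fst w + partial_walk d I L J (snd w)) mod M, \<lambda>j. if J \<le> j \<and> j < L then snd w j else 0)"

lemma walk_label_coarse:
  assumes "walk_label M I L d J v = walk_label M I L d J w"
  shows "walk_label M I L d (Suc J) v = walk_label M I L d (Suc J) w"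
proof -
  have tail: "snd v j = snd w j" if "J \<le> j" "j < L" for j
    using fun_cong[OF arg_cong[OF assms, of snd], of j] that by (simp add: walk_label_def)
  define t where "t s = (if J < L \<and> J \<notin> I then s J * d ^ J else (0::nat))" for s :: "nat \<Rightarrow> nat"
  have walk: "partial_walk d I L (Suc J) s = partial_walk d I L J s + t s" for s
  proof -
    have "partial_walk d I L (Suc J) s = (\<Sum>j<L. (if j < J \<and> j \<notin> I then s j * d ^ j else 0) + (if j = J then t s else 0))"
      unfolding partial_walk_def by (intro sum.cong refl) (auto simp: t_def less_Suc_eq)
    also have "\<dots> = partial_walk d I L J s + t s"
      by (simp add: sum.distrib partial_walk_def t_def)
    finally show ?thesis .
  qed
  have "t (snd v) = t (snd w)" using tail[of J] by (simp add: t_def)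
  moreover have "(fst v + partial_walk d I L J (snd v)) mod M = (fst w + partial_walk d I L J (snd w)) mod M"
    using arg_cong[OF assms, of fst] by (simp add: walk_label_def)
  then have "(fst v + partial_walk d I L J (snd v) + t (snd v)) mod M = (fst w + partial_walk d I L J (snd w) + t (snd v)) mod M"
    by (rule mod_add_cong) simp
  ultimately show ?thesis using tail by (auto simp: walk_label_def walk add.assoc)
qed

lemma sum_power_partial_walk:
  fixes z :: complex
  assumes "\<And>j. j < L \<Longrightarrow> finite (B j)"
  shows "(\<Sum>s\<in>PiE {..<L} B. z ^ partial_walk d I L J s)
    = (\<Prod>j<L. \<Sum>a\<in>B j. if j < J \<and> j \<notin> I then (z ^ (d ^ j)) ^ a else 1)"
proof -
  have "z ^ partial_walk d I L J s = (\<Prod>j<L. if j < J \<and> j \<notin> I then (z ^ (d ^ j)) ^ s j else 1)" for s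
    unfolding partial_walk_def power_sum by (intro prod.cong refl) (auto simp: power_mult[symmetric] mult.commute)
  then show ?thesis using assms by (subst prod_sum_PiE) auto
qed

text \<open>The symbol of the digit averages with the factors at the positions in \<open>I\<close> omitted.\<close>

definition partial_symb :: "nat \<Rightarrow> nat set \<Rightarrow> nat set \<Rightarrow> nat \<Rightarrow> complex \<Rightarrow> complex" where
  "partial_symb d D I J z = (\<Prod>j<J. if j \<in> I then 1 else phi D (z ^ (d ^ j)))"

lemma sum_power_walk_free:
  assumes D: "finite D" "D \<noteq> {}" and "J \<le> L"
  shows "(\<Sum>s\<in>PiE {..<L} (\<lambda>j. if j < J then D else {s0 j}). z ^ partial_walk d I L J s)
      = of_nat (card D) ^ J * partial_symb d D I J z" (is ?A)
    and "(\<Sum>s\<in>PiE {..<L} (\<lambda>_. D). z ^ partial_walk d I L J s)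
      = of_nat (card D) ^ L * partial_symb d D I J z" (is ?B)
proof -
  let ?k = "of_nat (card D) :: complex"
  have k: "?k \<noteq> 0" using D by simp
  have S: "(\<Sum>a\<in>D. w ^ a) = ?k * phi D w" for w
    using k by (simp add: phi_def)
  have digit: "(\<Sum>a\<in>D. if j < J \<and> j \<notin> I then (z ^ (d ^ j)) ^ a else 1) 
     = ?k * (if j < J then if j \<in> I then 1 else phi D (z ^ (d ^ j)) else 1)" for j
    by (simp add: S)
  have cut: "(\<Prod>j<L. if j < J then x j else 1) = (\<Prod>j<J. x j)" for x :: "nat \<Rightarrow> complex"
  proof -
    have "(\<Prod>j<L. if j < J then x j else 1) = (\<Prod>j<J. if j < J then x j else 1)"
      using assms(3) by (intro prod.mono_neutral_right) auto
    then show ?thesis by simp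
  qed
  have "(\<Sum>s\<in>PiE {..<L} (\<lambda>j. if j < J then D else {s0 j}). z ^ partial_walk d I L J s)
     = (\<Prod>j<L. \<Sum>a\<in>(if j < J then D else {s0 j}). if j < J \<and> j \<notin> I then (z ^ (d ^ j)) ^ a else 1)"
    using D(1) by (intro sum_power_partial_walk) auto
  also have "\<dots> = (\<Prod>j<L. if j < J then ?k * (if j \<in> I then 1 else phi D (z ^ (d ^ j))) else 1)"
    by (intro prod.cong refl) (auto simp: S)
  also have "\<dots> = ?k ^ J * partial_symb d D I J z"
    unfolding cut by (simp add: prod.distrib partial_symb_def)
  finally show ?A .
  have "(\<Sum>s\<in>PiE {..<L} (\<lambda>_. D). z ^ partial_walk d I L J s)
     = (\<Prod>j<L. ?k * (if j < J then if j \<in> I then 1 else phi D (z ^ (d ^ j)) else 1))"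
    unfolding digit[symmetric] using D(1) by (intro sum_power_partial_walk) auto
  also have "\<dots> = ?k ^ L * partial_symb d D I J z"
    by (simp only: prod.distrib cut partial_symb_def) simp
  finally show ?B .
qed

text \<open>A path with given label is determined by its first \<open>J\<close> digits, which may be chosen freely. As
  \<open>x\<close> has to be a natural number, subtracting the new walk is replaced by adding \<open>M - 1\<close> times it.\<close>

lemma walk_label_class:
  fixes d I J L
  assumes M: "0 < M" and w: "w \<in> {..<M} \<times> PiE {..<L} (\<lambda>_. D)"
  defines "W \<equiv> {..<M} \<times> PiE {..<L} (\<lambda>_. D)"
    and "B \<equiv> PiE {..<L} (\<lambda>j. if j < J then D else {snd w j})"
    and "x \<equiv> \<lambda>s. (fst w + partial_walk d I L J (snd w) + (M - 1) * partial_walk d I L J s) mod M"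
  shows "bij_betw (\<lambda>s. (x s, s)) B {v \<in> W. walk_label M I L d J v = walk_label M I L d J w}"
proof (rule bij_betwI')
  fix s t assume "s \<in> B" "t \<in> B"
  show "((x s, s) = (x t, t)) = (s = t)" by auto
next
  fix s assume s: "s \<in> B"
  have "s j = snd w j" if "J \<le> j" "j < L" for j
    using s that by (force simp: B_def PiE_def Pi_def)
  moreover have "s \<in> PiE {..<L} (\<lambda>_. D)"
  proof (rule PiE_I)
    fix j assume "j \<in> {..<L}"
    then have "s j \<in> (if j < J then D else {snd w j})" "snd w j \<in> D"
      using PiE_mem[OF s[unfolded B_def]] w by (auto dest: PiE_mem)
    then show "s j \<in> D" by (auto split: if_splits)
  qed (use PiE_arb[OF s[unfolded B_def]] in simp)
  moreover have "(x s + partial_walk d I L J s) mod M = (fst w + partial_walk d I L J (snd w)) mod M"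
  proof -
    have "(M - 1) * p + p = M * p" for p using M by (cases M) auto
    then have eq: "fst w + partial_walk d I L J (snd w) + (M - 1) * partial_walk d I L J s + partial_walk d I L J s
       = fst w + partial_walk d I L J (snd w) + M * partial_walk d I L J s" by (simp only: add.assoc)
    show ?thesis unfolding x_def mod_add_left_eq eq by simp
  qed
  moreover have "x s < M" using M by (simp add: x_def)
  ultimately show "(x s, s) \<in> {v \<in> W. walk_label M I L d J v = walk_label M I L d J w}"
    by (auto simp: W_def walk_label_def)
next
  fix v assume v: "v \<in> {v \<in> W. walk_label M I L d J v = walk_label M I L d J w}"
  then have "v \<in> W" and lab: "walk_label M I L d J v = walk_label M I L d J w" by simp_all
  then have vW: "fst v < M" "snd v \<in> PiE {..<L} (\<lambda>_. D)" by (simp_all add: W_def mem_Times_iff)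
  have "snd v j = snd w j" if "J \<le> j" "j < L" for j
    using fun_cong[OF arg_cong[OF lab, of snd], of j] that by (simp add: walk_label_def)
  then have sB: "snd v \<in> B" using PiE_mem[OF vW(2)] PiE_arb[OF vW(2)] unfolding B_def by (intro PiE_I) auto
  have eq: "(fst v + partial_walk d I L J (snd v)) mod M = (fst w + partial_walk d I L J (snd w)) mod M"
    using arg_cong[OF lab, of fst] by (simp add: walk_label_def)
  have "x (snd v) = (fst v + partial_walk d I L J (snd v) + (M - 1) * partial_walk d I L J (snd v)) mod M"
    unfolding x_def by (rule mod_add_cong[OF eq[symmetric] refl])
  also have "\<dots> = (fst v + M * partial_walk d I L J (snd v)) mod M"
  proof -
    have "p + (M - 1) * p = M * p" for p using M by (cases M) auto
    then show ?thesis by (simp only: add.assoc)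
  qed
  also have "\<dots> = fst v" using vW(1) by simp
  finally show "\<exists>s\<in>B. v = (x s, s)" using sB by (intro bexI[of _ "snd v"]) (auto simp: prod_eq_iff)
qed

lemma class_avg_root:
  assumes M: "0 < M" and w: "w \<in> {..<M} \<times> PiE {..<L} (\<lambda>_. D)" and D: "finite D" "D \<noteq> {}" and J: "J \<le> L"
  shows "class_avg ({..<M} \<times> PiE {..<L} (\<lambda>_. D)) (walk_label M I L d J) (\<lambda>v. uroot M \<xi> ^ fst v) w
    = uroot M \<xi> ^ fst w * uroot M \<xi> ^ partial_walk d I L J (snd w) * cnj (partial_symb d D I J (uroot M \<xi>))"
proof -
  define W where "W = {..<M} \<times> PiE {..<L} (\<lambda>_. D)"
  define B where "B = PiE {..<L} (\<lambda>j. if j < J then D else {snd w j})"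
  define x where "x s = (fst w + partial_walk d I L J (snd w) + (M - 1) * partial_walk d I L J s) mod M" for s
  define z where "z = uroot M \<xi>"
  have z: "cmod z = 1" "z ^ M = 1" using root_power_modulus[OF M] by (simp_all add: z_def)
  have bij: "bij_betw (\<lambda>s. (x s, s)) B {v \<in> W. walk_label M I L d J v = walk_label M I L d J w}"
    unfolding x_def[abs_def] B_def W_def by (rule walk_label_class[OF M w])
  have card: "card {v \<in> W. walk_label M I L d J v = walk_label M I L d J w} = card D ^ J"
  proof -
    have "card B = (\<Prod>j<L. if j < J then card D else 1)"
      unfolding B_def by (subst card_PiE) (auto intro!: prod.cong)
    also have "\<dots> = (\<Prod>j<J. if j < J then card D else 1)"
      using J by (intro prod.mono_neutral_right) auto
    finally show ?thesis using bij_betw_same_card[OF bij] by simp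
  qed
  have inv: "z ^ (M - 1) = cnj z"
  proof -
    have "z ^ (M - 1) * z = 1" using z(2) M by (simp flip: power_Suc2)
    moreover have "cnj z * z = 1" using z(1) by (simp add: mult.commute complex_norm_square[symmetric])
    ultimately show ?thesis using z(1) by (metis mult_cancel_right norm_zero zero_neq_one)
  qed
  have "(\<Sum>v | v \<in> W \<and> walk_label M I L d J v = walk_label M I L d J w. z ^ fst v) = (\<Sum>s\<in>B. z ^ x s)"
    using sum.reindex_bij_betw[OF bij, of "\<lambda>v. z ^ fst v"] by simp
  also have "\<dots> = (\<Sum>s\<in>B. z ^ fst w * z ^ partial_walk d I L J (snd w) * cnj z ^ partial_walk d I L J s)"
    unfolding x_def z_def root_power_mod[OF M] power_add power_mult inv[unfolded z_def] ..
  also have "\<dots> = z ^ fst w * z ^ partial_walk d I L J (snd w) * (\<Sum>s\<in>B. cnj z ^ partial_walk d I L J s)"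
    by (simp add: sum_distrib_left)
  also have "(\<Sum>s\<in>B. cnj z ^ partial_walk d I L J s) = of_nat (card D) ^ J * cnj (partial_symb d D I J z)"
    unfolding B_def sum_power_walk_free(1)[OF D J]
    by (simp add: partial_symb_def phi_def if_distrib[where f=cnj] cong: if_cong)
  finally show ?thesis using D unfolding class_avg_def W_def[symmetric] card z_def[symmetric] by simp
qed

lemma norm_average_square:
  fixes f :: "'b \<Rightarrow> complex"
  assumes "finite A"
  shows "(cmod ((\<Sum>s\<in>A. f s) / of_nat (card A)))\<^sup>2 \<le> (\<Sum>s\<in>A. (cmod (f s))\<^sup>2) / real (card A)"
proof (cases "A = {}")
  case False
  then have k: "0 < real (card A)" using assms by (simp add: card_gt_0_iff)
  have "(cmod (\<Sum>s\<in>A. f s))\<^sup>2 \<le> (\<Sum>s\<in>A. 1 * cmod (f s))\<^sup>2"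
    using norm_sum[of f A] by (intro power_mono) auto
  also have "\<dots> \<le> real (card A) * (\<Sum>s\<in>A. (cmod (f s))\<^sup>2)"
    using Cauchy_Schwarz_ineq_sum[of "\<lambda>_. 1" "\<lambda>s. cmod (f s)" A] by simp
  finally show ?thesis using k by (simp add: norm_divide power_divide divide_simps power2_eq_square mult_ac)
qed simp

text \<open>A finite version of Rota's theorem. Conditioning a function of the starting point on the position at
  time \<open>J\<close> and all later digits gives a reverse martingale; averaging the result over the digit sequences
  gives the operator with symbol \<open>\<bar>partial_symb d D I J\<bar>\<^sup>2\<close>, where one factor comes from running
  the walk and its conjugate from undoing it. The bound does not depend on \<open>I\<close>.\<close>

lemma rota_oscillation:
  fixes d L :: nat and I :: "nat set" and \<alpha> :: "nat \<Rightarrow> complex" and js :: "nat \<Rightarrow> nat" and \<kappa> :: "nat \<Rightarrow> nat \<Rightarrow> nat"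
  assumes M: "0 < M" and D: "finite D" "D \<noteq> {}"
    and sel: "\<And>x k. x < M \<Longrightarrow> k < n \<Longrightarrow> js k \<le> \<kappa> x k \<and> \<kappa> x k < js (Suc k)"
    and top: "\<And>k. k < n \<Longrightarrow> js (Suc k) \<le> L"
  defines "Y \<equiv> \<lambda>J \<xi>. of_real ((cmod (partial_symb d D I J (uroot M \<xi>)))\<^sup>2) * \<alpha> \<xi>"
  shows "(\<Sum>x<M. \<Sum>k<n. (cmod (trig M (Y (\<kappa> x k)) x - trig M (Y (js k)) x))\<^sup>2)
    \<le> 10 * (\<Sum>x<M. (cmod (trig M \<alpha> x))\<^sup>2)"
proof -
  define P where "P = PiE {..<L} (\<lambda>_. D)"
  define W where "W = {..<M} \<times> P"
  let ?lab = "walk_label M I L d"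
  define E where "E J = class_avg W (?lab J) (\<lambda>v. trig M \<alpha> (fst v))" for J
  have finP: "finite P" unfolding P_def using D by (intro finite_PiE) auto
  have finW: "finite W" using finP by (simp add: W_def)
  have P_ne: "P \<noteq> {}" using D by (simp add: P_def PiE_eq_empty_iff)
  have cardP: "of_nat (card P) = (of_nat (card D) :: complex) ^ L" by (simp add: P_def card_PiE)
  have k: "(of_nat (card D) :: complex) \<noteq> 0" using D by simp
  have E: "E J (x, s) = trig M (\<lambda>\<xi>. \<alpha> \<xi> * uroot M \<xi> ^ partial_walk d I L J s * cnj (partial_symb d D I J (uroot M \<xi>))) x"
    if "x < M" "s \<in> P" "J \<le> L" for x s J
  proof -
    have w: "(x, s) \<in> {..<M} \<times> PiE {..<L} (\<lambda>_. D)" using that by (simp add: P_def)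
    have "E J (x, s) = (\<Sum>\<xi><M. \<alpha> \<xi> * class_avg W (?lab J) (\<lambda>v. uroot M \<xi> ^ fst v) (x, s))"
      unfolding E_def class_avg_def trig_def sum_distrib_left times_divide_eq_right sum_divide_distrib
      by (rule sum.swap)
    then show ?thesis
      unfolding W_def P_def class_avg_root[OF M w D that(3)] trig_def by (simp add: mult_ac)
  qed
  have avg: "trig M (Y J) x = (\<Sum>s\<in>P. E J (x, s)) / of_nat (card P)" if "x < M" "J \<le> L" for x J
  proof -
    have "(\<Sum>s\<in>P. E J (x, s)) = (\<Sum>s\<in>P. \<Sum>\<xi><M. \<alpha> \<xi> * uroot M \<xi> ^ partial_walk d I L J s * cnj (partial_symb d D I J (uroot M \<xi>)) * uroot M \<xi> ^ x)"
      by (intro sum.cong refl) (simp add: E that trig_def)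
    also have "\<dots> = (\<Sum>\<xi><M. \<Sum>s\<in>P. (\<alpha> \<xi> * cnj (partial_symb d D I J (uroot M \<xi>)) * uroot M \<xi> ^ x) * uroot M \<xi> ^ partial_walk d I L J s)"
      by (subst sum.swap) (simp add: mult_ac)
    also have "\<dots> = (\<Sum>\<xi><M. of_nat (card P) * (Y J \<xi> * uroot M \<xi> ^ x))"
      unfolding sum_distrib_left[symmetric] P_def sum_power_walk_free(2)[OF D that(2)] 
      unfolding P_def[symmetric] cardP Y_def complex_norm_square sum_distrib_left by (simp add: mult_ac)
    finally show ?thesis using k by (simp add: trig_def sum_distrib_left[symmetric] cardP)
  qed
  have "(\<Sum>x<M. \<Sum>k<n. (cmod (trig M (Y (\<kappa> x k)) x - trig M (Y (js k)) x))\<^sup>2)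
    \<le> (\<Sum>x<M. \<Sum>k<n. (\<Sum>s\<in>P. (cmod (E (\<kappa> x k) (x, s) - E (js k) (x, s)))\<^sup>2) / real (card P))"
  proof (intro sum_mono)
    fix x k assume "x \<in> {..<M}" "k \<in> {..<n}"
    then have x: "x < M" and le: "\<kappa> x k \<le> L" "js k \<le> L" using sel[of x k] top[of k] by auto
    have "trig M (Y (\<kappa> x k)) x - trig M (Y (js k)) x = (\<Sum>s\<in>P. E (\<kappa> x k) (x, s) - E (js k) (x, s)) / of_nat (card P)"
      unfolding avg[OF x le(1)] avg[OF x le(2)] by (simp add: sum_subtractf diff_divide_distrib)
    then show "(cmod (trig M (Y (\<kappa> x k)) x - trig M (Y (js k)) x))\<^sup>2
       \<le> (\<Sum>s\<in>P. (cmod (E (\<kappa> x k) (x, s) - E (js k) (x, s)))\<^sup>2) / real (card P)"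
      using norm_average_square[OF finP] by simp
  qed
  also have "\<dots> = (\<Sum>x<M. \<Sum>s\<in>P. \<Sum>k<n. (cmod (E (\<kappa> x k) (x, s) - E (js k) (x, s)))\<^sup>2) / real (card P)"
    unfolding sum_divide_distrib[symmetric] by (subst sum.swap) simp
  also have "(\<Sum>x<M. \<Sum>s\<in>P. \<Sum>k<n. (cmod (E (\<kappa> x k) (x, s) - E (js k) (x, s)))\<^sup>2)
     = (\<Sum>w\<in>W. \<Sum>k<n. (cmod (E (\<kappa> (fst w) k) w - E (js k) w))\<^sup>2)"
    unfolding W_def by (subst sum.cartesian_product) (simp add: case_prod_unfold)
  also have "\<dots> \<le> 10 * (\<Sum>w\<in>W. (cmod (trig M \<alpha> (fst w)))\<^sup>2)"
    unfolding E_def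
    by (rule class_avg_oscillation[OF finW, where lab="?lab"])
       (auto intro: walk_label_coarse simp: W_def sel)
  also have "(\<Sum>w\<in>W. (cmod (trig M \<alpha> (fst w)))\<^sup>2) = real (card P) * (\<Sum>x<M. (cmod (trig M \<alpha> x))\<^sup>2)"
  proof -
    have "(\<Sum>w\<in>W. (cmod (trig M \<alpha> (fst w)))\<^sup>2) = (\<Sum>x<M. \<Sum>s\<in>P. (cmod (trig M \<alpha> x))\<^sup>2)"
      unfolding W_def by (subst sum.cartesian_product) (simp add: case_prod_unfold)
    then show ?thesis by (simp add: sum_distrib_left)
  qed
  finally show ?thesis using finP P_ne by (simp add: divide_right_mono card_gt_0_iff)
qed

section \<open>The oscillation inequality on a cyclic group\<close>

context digit_symbol begin

lemma m_decomposition: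
  assumes "J \<le> L"
  shows "m J = (m J - of_real (a J) * h J) + (\<Sum>r\<le>L. \<Sum>I\<in>Pow {..<L}. of_real (bern \<rho> L I) *
     (of_real (X J I) * ((\<eta> L r - \<eta> L (Suc r)) * of_real (V L r I))))"
proof -
  have "(\<Sum>I\<in>Pow {..<L}. of_real (bern \<rho> L I) * (of_real (X J I) * ((\<eta> L r - \<eta> L (Suc r)) * of_real (V L r I))))
     = of_real (a J) * ((\<eta> L r - \<eta> L (Suc r)) * (if jumps J \<le> r then 1 else 0))" for r
  proof -
    have "(\<Sum>I\<in>Pow {..<L}. of_real (bern \<rho> L I) * (of_real (X J I) * ((\<eta> L r - \<eta> L (Suc r)) * of_real (V L r I))))
      = (\<eta> L r - \<eta> L (Suc r)) * of_real (\<Sum>I\<in>Pow {..<L}. bern \<rho> L I * (X J I * V L r I))"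
      unfolding of_real_sum sum_distrib_left by (intro sum.cong refl) simp
    then show ?thesis by (simp add: expectation_XV[OF assms])
  qed
  then show ?thesis using h_telescope[OF assms] by (simp add: sum_distrib_left[symmetric])
qed

lemma jump_weight_bound:
  "(\<Sum>I\<in>Pow {..<L}. bern \<rho> L I * (cmod ((\<eta> L r - \<eta> L (Suc r)) * of_real (V L r I)))\<^sup>2) \<le> 4 * K * \<rho> ^ r"
proof -
  have "cmod (\<eta> L r - \<eta> L (Suc r)) \<le> cmod (\<eta> L r) + cmod (\<eta> L (Suc r))" by (rule norm_triangle_ineq4)
  also have "\<dots> \<le> \<rho> ^ r + \<rho> ^ r"
    by (intro add_mono eta_le order_trans[OF eta_le power_decreasing]) (use rho in auto)
  finally have "(cmod (\<eta> L r - \<eta> L (Suc r)))\<^sup>2 \<le> (2 * \<rho> ^ r)\<^sup>2" by (intro power_mono) auto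
  then have g: "(cmod (\<eta> L r - \<eta> L (Suc r)))\<^sup>2 \<le> 4 * (\<rho> ^ r * \<rho> ^ r)" by (simp add: power2_eq_square)
  have "(\<Sum>I\<in>Pow {..<L}. bern \<rho> L I * (cmod ((\<eta> L r - \<eta> L (Suc r)) * of_real (V L r I)))\<^sup>2)
     = (cmod (\<eta> L r - \<eta> L (Suc r)))\<^sup>2 * (\<Sum>I\<in>Pow {..<L}. bern \<rho> L I * (V L r I)\<^sup>2)"
    unfolding sum_distrib_left norm_mult power_mult_distrib norm_of_real power2_abs by (intro sum.cong refl) simp
  also have "\<dots> \<le> (4 * (\<rho> ^ r * \<rho> ^ r)) * (K / \<rho> ^ r)"
    using g expectation_V_square[of L r] rho
    by (intro mult_mono) (auto intro!: sum_nonneg mult_nonneg_nonneg prod_nonneg simp: bern_def)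
  also have "\<dots> = 4 * K * \<rho> ^ r" using rho by simp
  finally show ?thesis .
qed

lemma frozen_error_square_sum:
  "(\<Sum>J<n. (cmod (m J - of_real (a J) * h J))\<^sup>2) \<le> 32 * C\<^sup>2 / (1 - \<rho>)"
proof -
  have "(\<Sum>J<n. (cmod (m J - of_real (a J) * h J))\<^sup>2) \<le> (\<Sum>J<n. (2 * C)\<^sup>2 * (\<rho> ^ jumps J * \<tau> J)\<^sup>2)"
  proof (intro sum_mono)
    fix J
    have "(cmod (m J - of_real (a J) * h J))\<^sup>2 \<le> (2 * C * \<rho> ^ jumps J * \<tau> J)\<^sup>2"
      by (intro power_mono frozen_error) auto
    then show "(cmod (m J - of_real (a J) * h J))\<^sup>2 \<le> (2 * C)\<^sup>2 * (\<rho> ^ jumps J * \<tau> J)\<^sup>2"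
      by (simp add: power_mult_distrib mult_ac)
  qed
  also have "\<dots> = (2 * C)\<^sup>2 * (\<Sum>J<n. (\<rho> ^ jumps J * \<tau> J)\<^sup>2)" by (simp only: sum_distrib_left)
  also have "\<dots> \<le> (2 * C)\<^sup>2 * (8 / (1 - \<rho>))" by (intro mult_left_mono sum_jump_tau) auto
  finally show ?thesis by (simp add: power_mult_distrib)
qed

end

lemma sum_bern: "(\<Sum>I\<in>Pow {..<L}. bern \<rho> L I) = 1"
  unfolding bern_def by (subst sum_Pow_prod) simp

lemma bern_nonneg: "0 \<le> \<rho> \<Longrightarrow> \<rho> \<le> 1 \<Longrightarrow> 0 \<le> bern \<rho> L I"
  unfolding bern_def by (intro prod_nonneg) auto

lemma norm_weighted_sum_square:
  fixes G :: "'i \<Rightarrow> complex" and w :: "'i \<Rightarrow> real"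
  assumes "\<And>i. i \<in> A \<Longrightarrow> 0 \<le> w i"
  shows "(cmod (\<Sum>i\<in>A. of_real (w i) * G i))\<^sup>2 \<le> (\<Sum>i\<in>A. w i) * (\<Sum>i\<in>A. w i * (cmod (G i))\<^sup>2)"
proof -
  have "cmod (\<Sum>i\<in>A. of_real (w i) * G i) \<le> (\<Sum>i\<in>A. w i * cmod (G i))"
    using assms by (intro sum_norm_le) (auto simp: norm_mult)
  then have "(cmod (\<Sum>i\<in>A. of_real (w i) * G i))\<^sup>2 \<le> (\<Sum>i\<in>A. w i * cmod (G i))\<^sup>2" by (intro power_mono) auto
  also have "(\<Sum>i\<in>A. w i * cmod (G i)) = (\<Sum>i\<in>A. sqrt (w i) * (sqrt (w i) * cmod (G i)))"
    using assms by (intro sum.cong refl) (simp add: mult.assoc[symmetric])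
  also have "\<dots>\<^sup>2 \<le> (\<Sum>i\<in>A. (sqrt (w i))\<^sup>2) * (\<Sum>i\<in>A. (sqrt (w i) * cmod (G i))\<^sup>2)"
    by (rule Cauchy_Schwarz_ineq_sum)
  also have "\<dots> = (\<Sum>i\<in>A. w i) * (\<Sum>i\<in>A. w i * (cmod (G i))\<^sup>2)"
    using assms by (simp add: power_mult_distrib cong: sum.cong)
  finally show ?thesis .
qed

text \<open>The average of \<open>F (n + m)\<close> over all \<open>m\<close> with \<open>J\<close> digits from \<open>D\<close>, one digit at a time.\<close>

primrec digit_avg :: "nat \<Rightarrow> nat set \<Rightarrow> nat \<Rightarrow> (nat \<Rightarrow> complex) \<Rightarrow> nat \<Rightarrow> complex" where
  "digit_avg d D 0 F n = F n"
| "digit_avg d D (Suc J) F n = (\<Sum>a\<in>D. digit_avg d D J F (n + a * d ^ J)) / of_nat (card D)"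

lemma digit_avg_trig:
  "digit_avg d D J (trig M \<alpha>) n = trig M (\<lambda>\<xi>. symb d D J (uroot M \<xi>) * \<alpha> \<xi>) n"
proof (induction J arbitrary: n)
  case (Suc J)
  have "digit_avg d D (Suc J) (trig M \<alpha>) n
     = (\<Sum>a\<in>D. trig M (\<lambda>\<xi>. uroot M \<xi> ^ (a * d ^ J) * (symb d D J (uroot M \<xi>) * \<alpha> \<xi>)) n) / of_nat (card D)"
    by (simp add: Suc trig_shift)
  also have "\<dots> = (1 / of_nat (card D)) * trig M (\<lambda>\<xi>. \<Sum>a\<in>D. uroot M \<xi> ^ (a * d ^ J) * (symb d D J (uroot M \<xi>) * \<alpha> \<xi>)) n"
    by (simp add: trig_sum)
  also have "\<dots> = trig M (\<lambda>\<xi>. (1 / of_nat (card D)) * (\<Sum>a\<in>D. uroot M \<xi> ^ (a * d ^ J) * (symb d D J (uroot M \<xi>) * \<alpha> \<xi>))) n"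
    by (rule trig_scale[symmetric])
  also have "(\<lambda>\<xi>. (1 / of_nat (card D)) * (\<Sum>a\<in>D. uroot M \<xi> ^ (a * d ^ J) * (symb d D J (uroot M \<xi>) * \<alpha> \<xi>)))
     = (\<lambda>\<xi>. symb d D (Suc J) (uroot M \<xi>) * \<alpha> \<xi>)"
  proof
    fix \<xi>
    have "symb d D (Suc J) (uroot M \<xi>) = symb d D J (uroot M \<xi>) * ((\<Sum>a\<in>D. uroot M \<xi> ^ (a * d ^ J)) / of_nat (card D))"
      by (simp add: symb_def phi_def power_mult[symmetric] mult.commute)
    then show "(1 / of_nat (card D)) * (\<Sum>a\<in>D. uroot M \<xi> ^ (a * d ^ J) * (symb d D J (uroot M \<xi>) * \<alpha> \<xi>))
       = symb d D (Suc J) (uroot M \<xi>) * \<alpha> \<xi>"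
      by (simp add: sum_distrib_right[symmetric])
  qed
  finally show ?case .
qed (simp add: symb_def)

lemma sum_geometric_le:
  fixes q :: real assumes "0 < q" "q < 1" shows "(\<Sum>r\<le>L. q ^ r) \<le> 1 / (1 - q)"
  using assms by (simp add: sum_gp0 divide_right_mono)

lemma sum_selected_le:
  fixes f :: "nat \<Rightarrow> real"
  assumes "\<And>k. k < n \<Longrightarrow> js k \<le> \<kappa> k \<and> \<kappa> k < js (Suc k)" and f: "\<And>i. 0 \<le> f i"
  shows "(\<Sum>k<n. f (\<kappa> k)) \<le> (\<Sum>i<js n. f i)"
  using assms(1)
proof (induction n)
  case (Suc n)
  have "js n \<le> \<kappa> n" "\<kappa> n < js (Suc n)" using Suc.prems[of n] by auto
  then have "(\<Sum>k<Suc n. f (\<kappa> k)) \<le> (\<Sum>i<js n. f i) + (\<Sum>i\<in>{js n..<js (Suc n)}. f i)"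
    using Suc f member_le_sum[of "\<kappa> n" "{js n..<js (Suc n)}" f] by (simp add: add_mono)
  also have "\<dots> = (\<Sum>i<js (Suc n). f i)"
    using \<open>js n \<le> \<kappa> n\<close> \<open>\<kappa> n < js (Suc n)\<close>
    by (subst sum.union_disjoint[symmetric]) (auto intro!: sum.cong)
  finally show ?case .
qed (simp add: f sum_nonneg)

lemma trig_square_family:
  assumes "\<And>\<xi>. \<xi> < M \<Longrightarrow> (\<Sum>i\<in>A. (cmod (w i \<xi>))\<^sup>2) \<le> C"
  shows "(\<Sum>x<M. \<Sum>i\<in>A. (cmod (trig M (\<lambda>\<xi>. w i \<xi> * \<alpha> \<xi>) x))\<^sup>2) \<le> C * (\<Sum>x<M. (cmod (trig M \<alpha> x))\<^sup>2)"
proof -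
  have "(\<Sum>x<M. \<Sum>i\<in>A. (cmod (trig M (\<lambda>\<xi>. w i \<xi> * \<alpha> \<xi>) x))\<^sup>2)
      = (\<Sum>i\<in>A. \<Sum>x<M. (cmod (trig M (\<lambda>\<xi>. w i \<xi> * \<alpha> \<xi>) x))\<^sup>2)" by (rule sum.swap)
  also have "\<dots> = (\<Sum>i\<in>A. real M * (\<Sum>\<xi><M. (cmod (w i \<xi>))\<^sup>2 * (cmod (\<alpha> \<xi>))\<^sup>2))"
    by (simp add: trig_parseval norm_mult power_mult_distrib)
  also have "\<dots> = real M * (\<Sum>\<xi><M. (\<Sum>i\<in>A. (cmod (w i \<xi>))\<^sup>2) * (cmod (\<alpha> \<xi>))\<^sup>2)"
    unfolding sum_distrib_left[symmetric] sum_distrib_right by (subst sum.swap) simp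
  also have "\<dots> \<le> real M * (\<Sum>\<xi><M. C * (cmod (\<alpha> \<xi>))\<^sup>2)"
    using assms by (intro mult_left_mono sum_mono mult_right_mono) auto
  also have "\<dots> = C * (\<Sum>x<M. (cmod (trig M \<alpha> x))\<^sup>2)" by (simp add: trig_parseval sum_distrib_left mult_ac)
  finally show ?thesis .
qed

text \<open>The symbol of \<open>digit_avg\<close> is split, at each frequency, into the error of freezing and a weighted sum over \<open>r\<close>
  and \<open>I\<close> of the symbols in \<open>rota_oscillation\<close> times multipliers \<open>U r I\<close> that do not depend on \<open>J\<close>. The
  error is summed in square over all \<open>J\<close>. The weights \<open>q ^ r\<close> with \<open>q = sqrt \<rho>\<close> balance the decay
  \<open>\<rho> ^ r\<close> of the mean square of \<open>U r I\<close> against the sum over \<open>r\<close>.\<close>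

lemma digit_avg_oscillation_trig:
  assumes d: "3 \<le> d" and D: "D \<subseteq> {0..<d}" "0 \<in> D"
  shows "\<exists>C. \<forall>M n (js :: nat \<Rightarrow> nat) (\<kappa> :: nat \<Rightarrow> nat \<Rightarrow> nat) \<alpha>. 0 < M \<longrightarrow> (\<forall>x<M. \<forall>k<n. js k \<le> \<kappa> x k \<and> \<kappa> x k < js (Suc k)) \<longrightarrow>
     (\<Sum>x<M. \<Sum>k<n. (cmod (digit_avg d D (\<kappa> x k) (trig M \<alpha>) x - digit_avg d D (js k) (trig M \<alpha>) x))\<^sup>2)
      \<le> C * (\<Sum>x<M. (cmod (trig M \<alpha> x))\<^sup>2)"
proof -
  have fin: "finite D" and ne: "D \<noteq> {}" using D finite_subset by auto
  obtain \<delta> \<rho> where sym: "\<And>z. cmod z = 1 \<Longrightarrow>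
     digit_symbol (\<lambda>j. phi D (z ^ (d ^ j))) (\<lambda>j. dist_one D (z ^ (d ^ j))) \<delta> \<rho> (real d)"
    using cantor_digit_symbol[OF d D] by blast
  have rho: "1/2 \<le> \<rho>" "\<rho> < 1" using digit_symbol.rho[OF sym[of 1]] by simp_all
  define q where "q = sqrt \<rho>"
  have q: "0 < q" "q < 1" "q * q = \<rho>" using rho by (auto simp: q_def)
  define K where "K = digit_symbol.K \<rho>"
  define Ce where "Ce = 32 * (real d)\<^sup>2 / (1 - \<rho>)"
  define C where "C = 8 * Ce + 2 * ((1 / (1 - q)) * (10 * (4 * K / (1 - q))))"
  show ?thesis
  proof (intro exI[of _ C] allI impI)
    fix M n :: nat and js :: "nat \<Rightarrow> nat" and \<kappa> :: "nat \<Rightarrow> nat \<Rightarrow> nat" and \<alpha> :: "nat \<Rightarrow> complex"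
    assume M: "0 < M" and sel': "\<forall>x<M. \<forall>k<n. js k \<le> \<kappa> x k \<and> \<kappa> x k < js (Suc k)"
    have sel: "js k \<le> \<kappa> x k" "\<kappa> x k < js (Suc k)" if "x < M" "k < n" for x k using sel' that by auto
    have js: "js k < js (Suc k)" if "k < n" for k using sel[OF M that] by simp
    define L where "L = js n"
    have top: "js (Suc k) \<le> L" if "k < n" for k
    proof -
      have "Suc k \<le> n" using that by simp
      then have "\<lbrakk>\<And>i. i < n \<Longrightarrow> js i < js (Suc i)\<rbrakk> \<Longrightarrow> js (Suc k) \<le> js n"
      proof (induction n rule: dec_induct)
        case (step i)
        then show ?case using less_imp_le[OF step.prems[of i]] by (auto intro: order_trans)
      qed simp
      then show ?thesis using js by (simp add: L_def)
    qed
    define N where "N = (\<Sum>x<M. (cmod (trig M \<alpha> x))\<^sup>2)"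
    let ?\<phi> = "\<lambda>\<xi> j. phi D (uroot M \<xi> ^ (d ^ j))" and ?\<tau> = "\<lambda>\<xi> j. dist_one D (uroot M \<xi> ^ (d ^ j))"
    interpret S: digit_symbol "?\<phi> \<xi>" "?\<tau> \<xi>" \<delta> \<rho> "real d" for \<xi>
      by (rule sym) simp
    define e where "e J \<xi> = S.m \<xi> J - of_real (S.a \<xi> J) * S.h \<xi> J" for J \<xi>
    define U where "U r I \<xi> = (S.\<eta> \<xi> L r - S.\<eta> \<xi> L (Suc r)) * of_real (S.V \<xi> L r I)" for r I \<xi>
    define Y where "Y J r I = trig M (\<lambda>\<xi>. of_real ((cmod (partial_symb d D I J (uroot M \<xi>)))\<^sup>2) * (U r I \<xi> * \<alpha> \<xi>))" for J r I
    define A where "A = {..L} \<times> Pow {..<L}"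
    define w where "w p = q ^ fst p * bern \<rho> L (snd p)" for p
    have w0: "0 \<le> w p" for p using q rho by (simp add: w_def bern_nonneg)
    have wsum: "(\<Sum>p\<in>A. w p) \<le> 1 / (1 - q)"
    proof -
      have "(\<Sum>p\<in>A. w p) = (\<Sum>r\<le>L. q ^ r * (\<Sum>I\<in>Pow {..<L}. bern \<rho> L I))"
        unfolding A_def w_def sum_distrib_left by (subst sum.cartesian_product) (simp add: case_prod_unfold)
      then show ?thesis using sum_geometric_le[OF q(1,2), of L] by (simp add: sum_bern)
    qed
    have decomp: "digit_avg d D J (trig M \<alpha>) x = trig M (\<lambda>\<xi>. e J \<xi> * \<alpha> \<xi>) x
       + (\<Sum>p\<in>A. of_real (w p) * (Y J (fst p) (snd p) x / of_real (q ^ fst p)))" if "J \<le> L" for J x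
    proof -
      have X: "S.X \<xi> J I = (cmod (partial_symb d D I J (uroot M \<xi>)))\<^sup>2" for \<xi> I
        unfolding S.X_def partial_symb_def S.psi_def prod_norm[symmetric] prod_power_distrib
        by (intro prod.cong refl) simp
      have "symb d D J (uroot M \<xi>) * \<alpha> \<xi> = e J \<xi> * \<alpha> \<xi> + (\<Sum>r\<le>L. \<Sum>I\<in>Pow {..<L}. of_real (bern \<rho> L I) *
          (of_real ((cmod (partial_symb d D I J (uroot M \<xi>)))\<^sup>2) * (U r I \<xi> * \<alpha> \<xi>)))" for \<xi>
      proof -
        have "symb d D J (uroot M \<xi>) = S.m \<xi> J" by (simp add: symb_def S.m_def)
        also have "\<dots> = e J \<xi> + (\<Sum>r\<le>L. \<Sum>I\<in>Pow {..<L}. of_real (bern \<rho> L I) * (of_real (S.X \<xi> J I) * U r I \<xi>))"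
          unfolding e_def U_def by (rule S.m_decomposition[OF that])
        finally show ?thesis unfolding X
          by (simp only: distrib_right sum_distrib_right mult.assoc)
      qed
      then have "digit_avg d D J (trig M \<alpha>) x = trig M (\<lambda>\<xi>. e J \<xi> * \<alpha> \<xi>) x
         + (\<Sum>r\<le>L. \<Sum>I\<in>Pow {..<L}. of_real (bern \<rho> L I) * Y J r I x)"
        unfolding digit_avg_trig Y_def by (simp only: trig_add trig_sum trig_scale)
      also have "(\<Sum>r\<le>L. \<Sum>I\<in>Pow {..<L}. of_real (bern \<rho> L I) * Y J r I x)
         = (\<Sum>p\<in>A. of_real (bern \<rho> L (snd p)) * Y J (fst p) (snd p) x)"
        unfolding A_def by (subst sum.cartesian_product) (simp add: case_prod_unfold)
      also have "\<dots> = (\<Sum>p\<in>A. of_real (w p) * (Y J (fst p) (snd p) x / of_real (q ^ fst p)))"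
        using q by (intro sum.cong refl) (simp add: w_def)
      finally show ?thesis .
    qed
    define G where "G p x k = (Y (\<kappa> x k) (fst p) (snd p) x - Y (js k) (fst p) (snd p) x) / of_real (q ^ fst p)" for p x k
    define R where "R J x = trig M (\<lambda>\<xi>. e J \<xi> * \<alpha> \<xi>) x" for J x
    have point: "(cmod (digit_avg d D (\<kappa> x k) (trig M \<alpha>) x - digit_avg d D (js k) (trig M \<alpha>) x))\<^sup>2
       \<le> 4 * (cmod (R (\<kappa> x k) x))\<^sup>2 + 4 * (cmod (R (js k) x))\<^sup>2 + 2 * (1 / (1 - q) * (\<Sum>p\<in>A. w p * (cmod (G p x k))\<^sup>2))"
      if "x < M" "k < n" for x k
    proof -
      have le: "\<kappa> x k \<le> L" "js k \<le> L" using sel[OF that] top[OF that(2)] by auto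
      have "digit_avg d D (\<kappa> x k) (trig M \<alpha>) x - digit_avg d D (js k) (trig M \<alpha>) x
         = (R (\<kappa> x k) x - R (js k) x) - (- (\<Sum>p\<in>A. of_real (w p) * G p x k))"
        unfolding decomp[OF le(1)] decomp[OF le(2)] R_def G_def diff_divide_distrib right_diff_distrib sum_subtractf
        by simp
      then have "(cmod (digit_avg d D (\<kappa> x k) (trig M \<alpha>) x - digit_avg d D (js k) (trig M \<alpha>) x))\<^sup>2
         \<le> 2 * (cmod (R (\<kappa> x k) x - R (js k) x))\<^sup>2 + 2 * (cmod (\<Sum>p\<in>A. of_real (w p) * G p x k))\<^sup>2"
        using cmod_diff_square_le[of "R (\<kappa> x k) x - R (js k) x" "- (\<Sum>p\<in>A. of_real (w p) * G p x k)"] by simp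
      moreover have "(cmod (R (\<kappa> x k) x - R (js k) x))\<^sup>2 \<le> 2 * (cmod (R (\<kappa> x k) x))\<^sup>2 + 2 * (cmod (R (js k) x))\<^sup>2"
        by (rule cmod_diff_square_le)
      moreover have "(cmod (\<Sum>p\<in>A. of_real (w p) * G p x k))\<^sup>2 \<le> (\<Sum>p\<in>A. w p) * (\<Sum>p\<in>A. w p * (cmod (G p x k))\<^sup>2)"
        by (rule norm_weighted_sum_square) (rule w0)
      moreover have "\<dots> \<le> 1 / (1 - q) * (\<Sum>p\<in>A. w p * (cmod (G p x k))\<^sup>2)"
        by (intro mult_right_mono wsum sum_nonneg mult_nonneg_nonneg w0) auto
      ultimately show ?thesis by linarith
    qed
    have err: "(\<Sum>x<M. \<Sum>J<L. (cmod (R J x))\<^sup>2) \<le> Ce * N"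
      unfolding R_def N_def
    proof (rule trig_square_family)
      fix \<xi>
      show "(\<Sum>J<L. (cmod (e J \<xi>))\<^sup>2) \<le> Ce"
        unfolding e_def Ce_def by (rule S.frozen_error_square_sum)
    qed
    have err1: "(\<Sum>x<M. \<Sum>k<n. (cmod (R (\<kappa> x k) x))\<^sup>2) \<le> Ce * N"
    proof -
      have "(\<Sum>x<M. \<Sum>k<n. (cmod (R (\<kappa> x k) x))\<^sup>2) \<le> (\<Sum>x<M. \<Sum>J<L. (cmod (R J x))\<^sup>2)"
        unfolding L_def
      proof (rule sum_mono)
        fix x assume "x \<in> {..<M}"
        then show "(\<Sum>k<n. (cmod (R (\<kappa> x k) x))\<^sup>2) \<le> (\<Sum>J<js n. (cmod (R J x))\<^sup>2)"
          using sel by (intro sum_selected_le[where \<kappa>="\<kappa> x"]) auto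
      qed
      then show ?thesis using err by linarith
    qed
    have err2: "(\<Sum>x<M. \<Sum>k<n. (cmod (R (js k) x))\<^sup>2) \<le> Ce * N"
    proof -
      have "(\<Sum>x<M. \<Sum>k<n. (cmod (R (js k) x))\<^sup>2) \<le> (\<Sum>x<M. \<Sum>J<L. (cmod (R J x))\<^sup>2)"
        unfolding L_def using js by (intro sum_mono sum_selected_le) auto
      then show ?thesis using err by linarith
    qed
    have main: "(\<Sum>x<M. \<Sum>k<n. \<Sum>p\<in>A. w p * (cmod (G p x k))\<^sup>2) \<le> 10 * (4 * K / (1 - q)) * N"
    proof -
      have Gp: "(\<Sum>x<M. \<Sum>k<n. (cmod (G p x k))\<^sup>2) \<le> (10 * real M * (\<Sum>\<xi><M. (cmod (U (fst p) (snd p) \<xi>))\<^sup>2 * (cmod (\<alpha> \<xi>))\<^sup>2)) / \<rho> ^ fst p" for p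
      proof -
        have qq: "(q ^ fst p)\<^sup>2 = \<rho> ^ fst p" using q(3) by (metis power2_eq_square power_mult_distrib)
        have "(\<Sum>x<M. \<Sum>k<n. (cmod (G p x k))\<^sup>2)
          = (\<Sum>x<M. \<Sum>k<n. (cmod (Y (\<kappa> x k) (fst p) (snd p) x - Y (js k) (fst p) (snd p) x))\<^sup>2) / \<rho> ^ fst p"
          unfolding G_def norm_divide power_divide norm_of_real power2_abs qq sum_divide_distrib[symmetric] ..
        also have "\<dots> \<le> (10 * (\<Sum>x<M. (cmod (trig M (\<lambda>\<xi>. U (fst p) (snd p) \<xi> * \<alpha> \<xi>) x))\<^sup>2)) / \<rho> ^ fst p"
          unfolding Y_def
          by (intro divide_right_mono rota_oscillation[where js=js and \<kappa>=\<kappa> and L=L and n=n and I="snd p" and d=d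
              and \<alpha>="\<lambda>\<xi>. U (fst p) (snd p) \<xi> * \<alpha> \<xi>", OF M fin ne])
             (use sel top rho in simp_all)
        finally show ?thesis by (simp add: trig_parseval norm_mult power_mult_distrib)
      qed
      have "(\<Sum>x<M. \<Sum>k<n. \<Sum>p\<in>A. w p * (cmod (G p x k))\<^sup>2) = (\<Sum>p\<in>A. w p * (\<Sum>x<M. \<Sum>k<n. (cmod (G p x k))\<^sup>2))"
        unfolding sum_distrib_left by (subst sum.swap, subst (2) sum.swap) (rule refl)
      also have "\<dots> \<le> (\<Sum>p\<in>A. w p * ((10 * real M * (\<Sum>\<xi><M. (cmod (U (fst p) (snd p) \<xi>))\<^sup>2 * (cmod (\<alpha> \<xi>))\<^sup>2)) / \<rho> ^ fst p))"
        by (intro sum_mono mult_left_mono Gp w0)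
      also have "\<dots> = 10 * real M * (\<Sum>p\<in>A. \<Sum>\<xi><M. (w p / \<rho> ^ fst p * (cmod (U (fst p) (snd p) \<xi>))\<^sup>2) * (cmod (\<alpha> \<xi>))\<^sup>2)"
        by (simp add: sum_distrib_left sum_divide_distrib mult_ac)
      also have "\<dots> = 10 * real M * (\<Sum>\<xi><M. (\<Sum>p\<in>A. w p / \<rho> ^ fst p * (cmod (U (fst p) (snd p) \<xi>))\<^sup>2) * (cmod (\<alpha> \<xi>))\<^sup>2)"
        unfolding sum_distrib_right by (subst sum.swap) (rule refl)
      also have "\<dots> \<le> 10 * real M * (\<Sum>\<xi><M. (4 * K / (1 - q)) * (cmod (\<alpha> \<xi>))\<^sup>2)"
      proof (intro mult_left_mono sum_mono mult_right_mono)
        fix \<xi>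
        have "(\<Sum>p\<in>A. w p / \<rho> ^ fst p * (cmod (U (fst p) (snd p) \<xi>))\<^sup>2)
           = (\<Sum>r\<le>L. q ^ r / \<rho> ^ r * (\<Sum>I\<in>Pow {..<L}. bern \<rho> L I * (cmod (U r I \<xi>))\<^sup>2))"
          unfolding A_def w_def sum_distrib_left by (subst sum.cartesian_product) (simp add: case_prod_unfold mult_ac)
        also have "\<dots> \<le> (\<Sum>r\<le>L. q ^ r / \<rho> ^ r * (4 * K * \<rho> ^ r))"
          unfolding U_def K_def using q rho by (intro sum_mono mult_left_mono S.jump_weight_bound) auto
        also have "\<dots> = 4 * K * (\<Sum>r\<le>L. q ^ r)" using rho by (simp add: sum_distrib_left mult_ac)
        also have "\<dots> \<le> 4 * K * (1 / (1 - q))"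
          using S.K_ge_1 unfolding K_def[symmetric] by (intro mult_left_mono sum_geometric_le q) auto
        finally show "(\<Sum>p\<in>A. w p / \<rho> ^ fst p * (cmod (U (fst p) (snd p) \<xi>))\<^sup>2) \<le> 4 * K / (1 - q)" by simp
      qed auto
      also have "\<dots> = 10 * (4 * K / (1 - q)) * N" unfolding N_def trig_parseval by (simp add: sum_distrib_left mult_ac)
      finally show ?thesis .
    qed
    have "(\<Sum>x<M. \<Sum>k<n. (cmod (digit_avg d D (\<kappa> x k) (trig M \<alpha>) x - digit_avg d D (js k) (trig M \<alpha>) x))\<^sup>2)
      \<le> (\<Sum>x<M. \<Sum>k<n. 4 * (cmod (R (\<kappa> x k) x))\<^sup>2 + 4 * (cmod (R (js k) x))\<^sup>2 + 2 * (1 / (1 - q) * (\<Sum>p\<in>A. w p * (cmod (G p x k))\<^sup>2)))"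
      by (intro sum_mono point) auto
    also have "\<dots> = 4 * (\<Sum>x<M. \<Sum>k<n. (cmod (R (\<kappa> x k) x))\<^sup>2) + 4 * (\<Sum>x<M. \<Sum>k<n. (cmod (R (js k) x))\<^sup>2)
       + 2 * (1 / (1 - q) * (\<Sum>x<M. \<Sum>k<n. \<Sum>p\<in>A. w p * (cmod (G p x k))\<^sup>2))"
      by (simp only: sum.distrib sum_distrib_left)
    also have "\<dots> \<le> 4 * (Ce * N) + 4 * (Ce * N) + 2 * (1 / (1 - q) * (10 * (4 * K / (1 - q)) * N))"
      using err1 err2 main q by (intro add_mono mult_left_mono) auto
    also have "\<dots> = C * N" by (simp add: C_def algebra_simps)
    finally show "(\<Sum>x<M. \<Sum>k<n. (cmod (digit_avg d D (\<kappa> x k) (trig M \<alpha>) x - digit_avg d D (js k) (trig M \<alpha>) x))\<^sup>2)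
      \<le> C * (\<Sum>x<M. (cmod (trig M \<alpha> x))\<^sup>2)" by (simp add: N_def)
  qed
qed


lemma periodic_trig:
  fixes F :: "nat \<Rightarrow> complex"
  assumes "0 < M" "\<And>x. F (x mod M) = F x"
  obtains \<alpha> where "F = trig M \<alpha>"
proof -
  obtain \<alpha> where \<alpha>: "\<And>n. n < M \<Longrightarrow> trig M \<alpha> n = F n" by (rule trig_representation[where M=M and F=F]) blast
  have "F n = trig M \<alpha> n" for n
    using \<alpha>[of "n mod M"] assms trig_mod[OF assms(1), of \<alpha> n] by simp
  then show thesis using that by blast
qed

lemma digit_avg_oscillation_cyclic:
  assumes d: "3 \<le> d" and D: "D \<subseteq> {0..<d}" "0 \<in> D"
  obtains C where "\<And>M n (js :: nat \<Rightarrow> nat) (\<kappa> :: nat \<Rightarrow> nat \<Rightarrow> nat) F. 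
     0 < M \<Longrightarrow> (\<And>x. F (x mod M) = F x) \<Longrightarrow>
     (\<And>x k. x < M \<Longrightarrow> k < n \<Longrightarrow> js k \<le> \<kappa> x k \<and> \<kappa> x k < js (Suc k)) \<Longrightarrow>
     (\<Sum>x<M. \<Sum>k<n. (cmod (digit_avg d D (\<kappa> x k) F x - digit_avg d D (js k) F x))\<^sup>2)
      \<le> C * (\<Sum>x<M. (cmod (F x))\<^sup>2)"
proof -
  obtain C where C: "\<forall>M n (js :: nat \<Rightarrow> nat) (\<kappa> :: nat \<Rightarrow> nat \<Rightarrow> nat) \<alpha>. 0 < M \<longrightarrow> (\<forall>x<M. \<forall>k<n. js k \<le> \<kappa> x k \<and> \<kappa> x k < js (Suc k)) \<longrightarrow>
     (\<Sum>x<M. \<Sum>k<n. (cmod (digit_avg d D (\<kappa> x k) (trig M \<alpha>) x - digit_avg d D (js k) (trig M \<alpha>) x))\<^sup>2)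
      \<le> C * (\<Sum>x<M. (cmod (trig M \<alpha> x))\<^sup>2)"
    using digit_avg_oscillation_trig[OF assms] by blast
  show thesis
  proof (rule that[of C])
    fix M n :: nat and js :: "nat \<Rightarrow> nat" and \<kappa> :: "nat \<Rightarrow> nat \<Rightarrow> nat" and F :: "nat \<Rightarrow> complex"
    assume M: "0 < M" and F: "\<And>x. F (x mod M) = F x"
      and sel: "\<And>x k. x < M \<Longrightarrow> k < n \<Longrightarrow> js k \<le> \<kappa> x k \<and> \<kappa> x k < js (Suc k)"
    obtain \<alpha> where \<alpha>: "F = trig M \<alpha>" using periodic_trig[where F=F, OF M F] by blast
    show "(\<Sum>x<M. \<Sum>k<n. (cmod (digit_avg d D (\<kappa> x k) F x - digit_avg d D (js k) F x))\<^sup>2)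
      \<le> C * (\<Sum>x<M. (cmod (F x))\<^sup>2)"
      unfolding \<alpha> using C[rule_format, of M n js \<kappa> \<alpha>] M sel by blast
  qed
qed

text \<open>Shifting an average over \<open>l\<close> digits by a multiple of \<open>Gcd D * d ^ l\<close> is negligible in the square mean
  over all \<open>l\<close>.\<close>

lemma digit_avg_shift_cyclic:
  assumes D: "D \<subseteq> {0..<d}" "0 \<in> D" and v: "Gcd D dvd v"
  obtains C where "\<And>M L F. 
     0 < M \<Longrightarrow> (\<And>x. F (x mod M) = F x) \<Longrightarrow>
     (\<Sum>x<M. \<Sum>l<L. (cmod (digit_avg d D l F (x + v * d ^ l) - digit_avg d D l F x))\<^sup>2)
      \<le> C * (\<Sum>x<M. (cmod (F x))\<^sup>2)"
proof -
  obtain C where C: "\<And>z L. cmod z = 1 \<Longrightarrow> (\<Sum>l<L. (cmod (symb d D l z) * dist_one D (z ^ (d ^ l)))\<^sup>2) \<le> C"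
    using symb_square_function[OF D] by blast
  obtain b where b: "v = Gcd D * b" using v by blast
  show thesis
  proof (rule that[of "(real b)\<^sup>2 * C"])
    fix M L :: nat and F :: "nat \<Rightarrow> complex"
    assume M: "0 < M" and F: "\<And>x. F (x mod M) = F x"
    obtain \<alpha> where \<alpha>: "F = trig M \<alpha>" using periodic_trig[where F=F, OF M F] by blast
    have eq: "digit_avg d D l F (x + v * d ^ l) - digit_avg d D l F x
       = trig M (\<lambda>\<xi>. ((uroot M \<xi> ^ (v * d ^ l) - 1) * symb d D l (uroot M \<xi>)) * \<alpha> \<xi>) x" for l x
      unfolding \<alpha> digit_avg_trig trig_shift trig_diff[symmetric] by (simp add: algebra_simps)
    show "(\<Sum>x<M. \<Sum>l<L. (cmod (digit_avg d D l F (x + v * d ^ l) - digit_avg d D l F x))\<^sup>2)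
      \<le> (real b)\<^sup>2 * C * (\<Sum>x<M. (cmod (F x))\<^sup>2)"
      unfolding eq unfolding \<alpha>
    proof (rule trig_square_family)
      fix \<xi>
      define z where "z = uroot M \<xi>"
      have z: "cmod z = 1" by (simp add: z_def)
      have "(\<Sum>l<L. (cmod ((z ^ (v * d ^ l) - 1) * symb d D l z))\<^sup>2)
        \<le> (\<Sum>l<L. (real b)\<^sup>2 * (cmod (symb d D l z) * dist_one D (z ^ (d ^ l)))\<^sup>2)"
      proof (rule sum_mono)
        fix l
        have "z ^ (v * d ^ l) = ((z ^ d ^ l) ^ Gcd D) ^ b"
          unfolding b by (simp add: power_mult[symmetric] mult_ac)
        then have "cmod (z ^ (v * d ^ l) - 1) \<le> real b * dist_one D (z ^ d ^ l)"
          unfolding dist_one_def using norm_one_minus_power[of "(z ^ d ^ l) ^ Gcd D" b] z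
          by (simp add: norm_power norm_minus_commute)
        then have "(cmod (z ^ (v * d ^ l) - 1))\<^sup>2 \<le> (real b * dist_one D (z ^ d ^ l))\<^sup>2" by (intro power_mono) auto
        then have "(cmod (z ^ (v * d ^ l) - 1))\<^sup>2 * (cmod (symb d D l z))\<^sup>2 
            \<le> (real b * dist_one D (z ^ d ^ l))\<^sup>2 * (cmod (symb d D l z))\<^sup>2" by (intro mult_right_mono) auto
        then show "(cmod ((z ^ (v * d ^ l) - 1) * symb d D l z))\<^sup>2
           \<le> (real b)\<^sup>2 * (cmod (symb d D l z) * dist_one D (z ^ (d ^ l)))\<^sup>2"
          by (simp add: norm_mult power_mult_distrib mult_ac)
      qed
      also have "\<dots> \<le> (real b)\<^sup>2 * C" 
        unfolding sum_distrib_left[symmetric] by (intro mult_left_mono C z) auto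
      finally show "(\<Sum>l<L. (cmod ((uroot M \<xi> ^ (v * d ^ l) - 1) * symb d D l (uroot M \<xi>)))\<^sup>2) \<le> (real b)\<^sup>2 * C"
        by (simp add: z_def)
    qed
  qed
qed

section \<open>Transference and convergence over blocks\<close>

lemma digit_avg_cong:
  assumes "\<And>i. n \<le> i \<Longrightarrow> i < n + d ^ J \<Longrightarrow> F i = G i" and D: "D \<subseteq> {0..<d}" and d: "0 < d"
  shows "digit_avg d D J F n = digit_avg d D J G n"
  using assms(1)
proof (induction J arbitrary: n)
  case (Suc J)
  have "digit_avg d D J F (n + a * d ^ J) = digit_avg d D J G (n + a * d ^ J)" if "a \<in> D" for a
  proof (rule Suc.IH)
    fix i assume i: "n + a * d ^ J \<le> i" "i < n + a * d ^ J + d ^ J"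
    have "Suc a * d ^ J \<le> d * d ^ J" using that D by (intro mult_right_mono) auto
    then show "F i = G i" using i by (intro Suc.prems) auto
  qed
  then show ?case by simp
qed (use d in simp)

lemma digit_avg_translate: "digit_avg d D J (\<lambda>i. F (m + i)) n = digit_avg d D J F (m + n)"
  by (induction J arbitrary: n) (simp_all add: add.assoc)

lemma orbit_shift: "(T ^^ i) ((T ^^ n) x) = (T ^^ (n + i)) x"
  by (simp add: funpow_add add.commute[of n i])

lemma digit_avg_orbit: "digit_avg d D J (\<lambda>i. f ((T ^^ i) ((T ^^ n) x))) m = digit_avg d D J (\<lambda>i. f ((T ^^ i) x)) (n + m)"
  unfolding orbit_shift by (rule digit_avg_translate)

lemma measure_preserving_funpow:
  assumes "measure_preserving_map M T"
  shows "T ^^ n \<in> measurable M M"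
    and "\<And>g. g \<in> borel_measurable M \<Longrightarrow> (\<integral>\<^sup>+x. g ((T ^^ n) x) \<partial>M) = (\<integral>\<^sup>+x. (g x :: ennreal) \<partial>M)"
proof -
  have T: "T \<in> measurable M M" and em: "\<And>A. A \<in> sets M \<Longrightarrow> emeasure M (T -` A \<inter> space M) = emeasure M A"
    using assms by (auto simp: measure_preserving_map_def)
  show Tn: "T ^^ n \<in> measurable M M" for n
  proof (induction n)
    case (Suc n)
    show ?case using measurable_compose[OF Suc T] by (simp add: comp_def)
  qed (simp add: id_def)
  have distr: "distr M M T = M"
    using T em by (intro measure_eqI) (auto simp: emeasure_distr)
  have step: "(\<integral>\<^sup>+x. g (T x) \<partial>M) = (\<integral>\<^sup>+x. g x \<partial>M)" if "g \<in> borel_measurable M" for g :: "'a \<Rightarrow> ennreal"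
    using nn_integral_distr[OF T, of g] that by (simp add: distr)
  show "(\<integral>\<^sup>+x. g ((T ^^ n) x) \<partial>M) = (\<integral>\<^sup>+x. g x \<partial>M)" if g: "g \<in> borel_measurable M" for g :: "'a \<Rightarrow> ennreal"
  proof (induction n)
    case (Suc n)
    have "(\<integral>\<^sup>+x. g ((T ^^ Suc n) x) \<partial>M) = (\<integral>\<^sup>+x. (\<lambda>y. g ((T ^^ n) y)) (T x) \<partial>M)"
      by (simp add: funpow_swap1)
    also have "\<dots> = (\<integral>\<^sup>+x. g ((T ^^ n) x) \<partial>M)"
      by (rule step) (rule measurable_compose[OF Tn g])
    finally show ?case using Suc by simp
  qed simp
qed

text \<open>Calderon's transference: an inequality along orbits of length \<open>2 * N\<close>, with only the first half on the
  left, integrates to an inequality on the whole space. The factor \<open>2\<close> pays for the boundary.\<close>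

lemma transference:
  fixes G H :: "'a \<Rightarrow> ennreal"
  assumes T: "measure_preserving_map M T" and "0 < N"
    and [measurable]: "G \<in> borel_measurable M" "H \<in> borel_measurable M"
    and le: "\<And>x. x \<in> space M \<Longrightarrow> (\<Sum>n<N. G ((T ^^ n) x)) \<le> c * (\<Sum>n<2 * N. H ((T ^^ n) x))"
  shows "(\<integral>\<^sup>+x. G x \<partial>M) \<le> 2 * c * (\<integral>\<^sup>+x. H x \<partial>M)"
proof -
  note [measurable] = measure_preserving_funpow(1)[OF T]
  have "of_nat N * (\<integral>\<^sup>+x. G x \<partial>M) = (\<integral>\<^sup>+x. (\<Sum>n<N. G ((T ^^ n) x)) \<partial>M)"
    by (simp add: nn_integral_sum measure_preserving_funpow(2)[OF T])
  also have "\<dots> \<le> (\<integral>\<^sup>+x. c * (\<Sum>n<2 * N. H ((T ^^ n) x)) \<partial>M)"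
    by (intro nn_integral_mono le)
  also have "\<dots> = c * (of_nat (2 * N) * (\<integral>\<^sup>+x. H x \<partial>M))"
    by (simp add: nn_integral_cmult nn_integral_sum measure_preserving_funpow(2)[OF T])
  also have "\<dots> = of_nat N * (2 * c * (\<integral>\<^sup>+x. H x \<partial>M))"
    by (simp add: mult_ac)
  finally show ?thesis using \<open>0 < N\<close>
    by (simp add: ennreal_mult_le_mult_iff)
qed

text \<open>A square-integrable function on a system with a measure-preserving, possibly non-invertible, transformation.\<close>

locale cantor_system =
  fixes d :: nat and D :: "nat set" and M :: "'a measure" and T :: "'a \<Rightarrow> 'a" and f :: "'a \<Rightarrow> complex"
  assumes d: "3 \<le> d" and D: "D \<subseteq> {0..<d}" "0 \<in> D"
    and T: "measure_preserving_map M T"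
    and f [measurable]: "f \<in> borel_measurable M"
    and f2: "(\<integral>\<^sup>+x. ennreal ((cmod (f x))\<^sup>2) \<partial>M) < \<infinity>"
begin

lemma T_measurable [measurable]: "T ^^ n \<in> measurable M M"
  by (rule measure_preserving_funpow(1)[OF T])

text \<open>The averages of \<open>f\<close> over the numbers with \<open>J\<close> digits from \<open>D\<close>.\<close>

definition A :: "nat \<Rightarrow> 'a \<Rightarrow> complex" where
  "A J x = digit_avg d D J (\<lambda>i. f ((T ^^ i) x)) 0"

lemma A_funpow: "A J ((T ^^ n) x) = digit_avg d D J (\<lambda>i. f ((T ^^ i) x)) n"
  unfolding A_def digit_avg_orbit by simp

lemma A_measurable [measurable]: "A J \<in> borel_measurable M"
proof -
  have "(\<lambda>x. digit_avg d D J (\<lambda>i. f ((T ^^ i) x)) n) \<in> borel_measurable M" for n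
  proof (induction J arbitrary: n)
    case (Suc J)
    note Suc[measurable]
    show ?case unfolding digit_avg.simps by measurable
  qed simp
  then show ?thesis by (simp add: A_def[abs_def])
qed

text \<open>Only a stretch of length \<open>d ^ J\<close> of the orbit enters, so that it may be continued periodically.\<close>

lemma A_periodized:
  assumes "n + d ^ J \<le> N"
  shows "digit_avg d D J (\<lambda>i. f ((T ^^ (i mod N)) x)) n = A J ((T ^^ n) x)"
  unfolding A_funpow
proof (rule digit_avg_cong[OF _ D(1)])
  fix i assume "n \<le> i" "i < n + d ^ J"
  then have "i mod N = i" using assms by simp
  then show "f ((T ^^ (i mod N)) x) = f ((T ^^ i) x)" by simp
qed (use d in simp)

text \<open>The oscillation of the averages over the block \<open>{i..<j}\<close>, measured from its left end.\<close>

definition osc :: "nat \<Rightarrow> nat \<Rightarrow> 'a \<Rightarrow> ennreal" where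
  "osc i j x = (SUP J\<in>{i..<j}. ennreal ((cmod (A J x - A i x))\<^sup>2))"

lemma osc_measurable [measurable]: "osc i j \<in> borel_measurable M"
  unfolding osc_def[abs_def] by measurable

lemma osc_attained:
  assumes "i < j" obtains J where "i \<le> J" "J < j" "osc i j x = ennreal ((cmod (A J x - A i x))\<^sup>2)"
proof -
  have "osc i j x = Max ((\<lambda>J. ennreal ((cmod (A J x - A i x))\<^sup>2)) ` {i..<j})"
    unfolding osc_def using assms by (intro Max_Sup[symmetric]) auto
  moreover have "\<dots> \<in> (\<lambda>J. ennreal ((cmod (A J x - A i x))\<^sup>2)) ` {i..<j}"
    using assms by (intro Max_in) auto
  ultimately show thesis using that by auto
qed

lemma oscillation_integral:
  obtains C :: real where "\<And>n js. (\<And>k. k < n \<Longrightarrow> js k < js (Suc k)) \<Longrightarrow>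
     (\<Sum>k<n. \<integral>\<^sup>+x. osc (js k) (js (Suc k)) x \<partial>M) \<le> ennreal C * (\<integral>\<^sup>+x. ennreal ((cmod (f x))\<^sup>2) \<partial>M)"
proof -
  obtain C where C: "\<And>N n (js :: nat \<Rightarrow> nat) (\<kappa> :: nat \<Rightarrow> nat \<Rightarrow> nat) F. 
     0 < N \<Longrightarrow> (\<And>x. F (x mod N) = F x) \<Longrightarrow>
     (\<And>x k. x < N \<Longrightarrow> k < n \<Longrightarrow> js k \<le> \<kappa> x k \<and> \<kappa> x k < js (Suc k)) \<Longrightarrow>
     (\<Sum>x<N. \<Sum>k<n. (cmod (digit_avg d D (\<kappa> x k) F x - digit_avg d D (js k) F x))\<^sup>2)
      \<le> C * (\<Sum>x<N. (cmod (F x))\<^sup>2)"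
    using digit_avg_oscillation_cyclic[OF d D] by blast
  define C' where "C' = max C 0"
  show thesis
  proof (rule that[of "2 * C'"])
    fix n :: nat and js :: "nat \<Rightarrow> nat"
    assume js: "\<And>k. k < n \<Longrightarrow> js k < js (Suc k)"
    define L where "L = (\<Sum>k<n. js (Suc k))"
    have top: "js (Suc k) \<le> L" if "k < n" for k
      unfolding L_def using that by (intro member_le_sum) auto
    define N where "N = d ^ L"
    have N: "0 < N" using d by (simp add: N_def)
    have "(\<integral>\<^sup>+x. (\<Sum>k<n. osc (js k) (js (Suc k)) x) \<partial>M) \<le> 2 * ennreal C' * (\<integral>\<^sup>+x. ennreal ((cmod (f x))\<^sup>2) \<partial>M)"
    proof (rule transference[OF T N])
      fix x assume "x \<in> space M"
      define F where "F i = f ((T ^^ (i mod (2 * N))) x)" for i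
      have "\<exists>J. js k \<le> J \<and> J < js (Suc k) \<and>
           osc (js k) (js (Suc k)) ((T ^^ m) x) = ennreal ((cmod (A J ((T ^^ m) x) - A (js k) ((T ^^ m) x)))\<^sup>2)"
        if "k < n" for m k
        using osc_attained[OF js[OF that], of "(T ^^ m) x"] by metis
      then have "\<forall>m k. \<exists>J. k < n \<longrightarrow> js k \<le> J \<and> J < js (Suc k) \<and>
           osc (js k) (js (Suc k)) ((T ^^ m) x) = ennreal ((cmod (A J ((T ^^ m) x) - A (js k) ((T ^^ m) x)))\<^sup>2)"
        by blast
      then obtain \<kappa> where \<kappa>: "\<And>m k. k < n \<Longrightarrow> js k \<le> \<kappa> m k \<and> \<kappa> m k < js (Suc k) \<and>
           osc (js k) (js (Suc k)) ((T ^^ m) x) = ennreal ((cmod (A (\<kappa> m k) ((T ^^ m) x) - A (js k) ((T ^^ m) x)))\<^sup>2)"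
        by metis
      have per: "digit_avg d D J F m = A J ((T ^^ m) x)" if "m < N" "J \<le> L" for m J
      proof -
        have "d ^ J \<le> N" unfolding N_def using that d by (intro power_increasing) auto
        then show ?thesis unfolding F_def[abs_def] using that by (intro A_periodized) simp
      qed
      have "(\<Sum>m<N. \<Sum>k<n. osc (js k) (js (Suc k)) ((T ^^ m) x))
         = (\<Sum>m<N. \<Sum>k<n. ennreal ((cmod (digit_avg d D (\<kappa> m k) F m - digit_avg d D (js k) F m))\<^sup>2))"
      proof (intro sum.cong refl)
        fix m k assume "m \<in> {..<N}" "k \<in> {..<n}"
        then have "m < N" "\<kappa> m k \<le> L" "js k \<le> L" "k < n" using \<kappa>[of k m] top[of k] js[of k] by auto
        then show "osc (js k) (js (Suc k)) ((T ^^ m) x) = ennreal ((cmod (digit_avg d D (\<kappa> m k) F m - digit_avg d D (js k) F m))\<^sup>2)"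
          using \<kappa>[of k m] by (simp add: per)
      qed
      also have "\<dots> = ennreal (\<Sum>m<N. \<Sum>k<n. (cmod (digit_avg d D (\<kappa> m k) F m - digit_avg d D (js k) F m))\<^sup>2)"
        by (simp add: sum_nonneg)
      also have "\<dots> \<le> ennreal (C' * (\<Sum>m<2 * N. (cmod (F m))\<^sup>2))"
      proof (rule ennreal_leI)
        have "(\<Sum>m<N. \<Sum>k<n. (cmod (digit_avg d D (\<kappa> m k) F m - digit_avg d D (js k) F m))\<^sup>2)
            \<le> (\<Sum>m<2 * N. \<Sum>k<n. (cmod (digit_avg d D (\<kappa> m k) F m - digit_avg d D (js k) F m))\<^sup>2)"
          by (intro sum_mono2) (auto intro: sum_nonneg)
        also have "\<dots> \<le> C * (\<Sum>m<2 * N. (cmod (F m))\<^sup>2)"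
          using N \<kappa> by (intro C) (auto simp: F_def)
        also have "\<dots> \<le> C' * (\<Sum>m<2 * N. (cmod (F m))\<^sup>2)"
          by (intro mult_right_mono) (auto simp: C'_def sum_nonneg)
        finally show "(\<Sum>m<N. \<Sum>k<n. (cmod (digit_avg d D (\<kappa> m k) F m - digit_avg d D (js k) F m))\<^sup>2)
          \<le> C' * (\<Sum>m<2 * N. (cmod (F m))\<^sup>2)" .
      qed
      also have "\<dots> = ennreal C' * (\<Sum>m<2 * N. ennreal ((cmod (f ((T ^^ m) x)))\<^sup>2))"
        by (simp add: ennreal_mult C'_def sum_nonneg F_def)
      finally show "(\<Sum>m<N. \<Sum>k<n. osc (js k) (js (Suc k)) ((T ^^ m) x))
        \<le> ennreal C' * (\<Sum>m<2 * N. ennreal ((cmod (f ((T ^^ m) x)))\<^sup>2))" .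
    qed measurable
    then show "(\<Sum>k<n. \<integral>\<^sup>+x. osc (js k) (js (Suc k)) x \<partial>M) \<le> ennreal (2 * C') * (\<integral>\<^sup>+x. ennreal ((cmod (f x))\<^sup>2) \<partial>M)"
      by (simp add: nn_integral_sum ennreal_mult C'_def)
  qed
qed

text \<open>If all tail oscillations were large, infinitely many disjoint blocks of large oscillation would contradict
  the bound of \<open>oscillation_integral\<close>, which does not depend on the number of blocks.\<close>

lemma tail_oscillation_small:
  assumes "0 < \<epsilon>"
  shows "\<exists>i. (\<integral>\<^sup>+x. (SUP j. osc i j x) \<partial>M) \<le> ennreal \<epsilon>"
proof (rule ccontr)
  assume "\<not> ?thesis"
  then have big: "ennreal \<epsilon> < (\<integral>\<^sup>+x. (SUP j. osc i j x) \<partial>M)" for i by (auto simp: not_le)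
  have "\<exists>j>i. ennreal \<epsilon> < (\<integral>\<^sup>+x. osc i j x \<partial>M)" for i
  proof -
    have inc: "incseq (osc i)"
      unfolding osc_def by (auto simp: incseq_def le_fun_def intro!: SUP_subset_mono)
    have "(\<integral>\<^sup>+x. (SUP j. osc i j x) \<partial>M) = (SUP j. \<integral>\<^sup>+x. osc i j x \<partial>M)"
      by (rule nn_integral_monotone_convergence_SUP[OF inc]) measurable
    then obtain j where j: "ennreal \<epsilon> < (\<integral>\<^sup>+x. osc i j x \<partial>M)" using big[of i] by (auto simp: less_SUP_iff)
    have "i < j"
    proof (rule ccontr)
      assume "\<not> i < j"
      then have "osc i j = (\<lambda>_. 0)" by (auto simp: osc_def bot_ennreal)
      then show False using j by simp
    qed
    then show ?thesis using j by blast
  qed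
  then obtain nx where nxt: "\<And>i. i < nx i" "\<And>i. ennreal \<epsilon> < (\<integral>\<^sup>+x. osc i (nx i) x \<partial>M)" by metis
  define js where "js k = (nx ^^ k) 0" for k
  obtain C :: real where C: "\<And>n js. (\<And>k. k < n \<Longrightarrow> js k < js (Suc k)) \<Longrightarrow>
     (\<Sum>k<n. \<integral>\<^sup>+x. osc (js k) (js (Suc k)) x \<partial>M) \<le> ennreal C * (\<integral>\<^sup>+x. ennreal ((cmod (f x))\<^sup>2) \<partial>M)"
    using oscillation_integral by blast
  define B where "B = ennreal C * (\<integral>\<^sup>+x. ennreal ((cmod (f x))\<^sup>2) \<partial>M)"
  have B: "B < \<infinity>" using f2 by (simp add: B_def ennreal_mult_less_top)
  have le: "ennreal (real n * \<epsilon>) \<le> B" for n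
  proof -
    have "ennreal (real n * \<epsilon>) = (\<Sum>k<n. ennreal \<epsilon>)"
      using assms by (simp add: ennreal_mult ennreal_of_nat_eq_real_of_nat)
    also have "\<dots> \<le> (\<Sum>k<n. \<integral>\<^sup>+x. osc (js k) (js (Suc k)) x \<partial>M)"
      by (intro sum_mono) (simp add: js_def nxt(2) less_imp_le)
    also have "\<dots> \<le> B" unfolding B_def by (rule C) (simp add: js_def nxt(1))
    finally show ?thesis .
  qed
  obtain n where "enn2real B / \<epsilon> < real n" using reals_Archimedean2 by blast
  then have "enn2real B < real n * \<epsilon>" using assms by (simp add: field_simps)
  then have "ennreal (enn2real B) < ennreal (real n * \<epsilon>)" using assms by (simp add: ennreal_less_iff)
  then show False using le[of n] B by simp
qed

lemma A_converges: "AE x in M. convergent (\<lambda>J. A J x)"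
proof -
  define s where "s i x = (SUP j. osc i j x)" for i x
  have [measurable]: "s i \<in> borel_measurable M" for i unfolding s_def[abs_def] by measurable
  have "(\<integral>\<^sup>+x. (INF i. s i x) \<partial>M) = 0"
  proof (rule ccontr)
    assume "(\<integral>\<^sup>+x. (INF i. s i x) \<partial>M) \<noteq> 0"
    then have "0 < (\<integral>\<^sup>+x. (INF i. s i x) \<partial>M)" by (simp add: zero_less_iff_neq_zero)
    then obtain y where y: "0 < y" "y < (\<integral>\<^sup>+x. (INF i. s i x) \<partial>M)" using dense by blast
    define \<epsilon> where "\<epsilon> = enn2real y"
    have "y < \<infinity>" using y(2) by (simp add: less_le_trans[OF _ top_greatest])
    then have "0 < \<epsilon>" "ennreal \<epsilon> < (\<integral>\<^sup>+x. (INF i. s i x) \<partial>M)"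
      using y by (simp_all add: \<epsilon>_def enn2real_positive_iff)
    then obtain i where i: "(\<integral>\<^sup>+x. s i x \<partial>M) \<le> ennreal \<epsilon>" using tail_oscillation_small[of \<epsilon>] by (auto simp: s_def)
    have "(\<integral>\<^sup>+x. (INF i. s i x) \<partial>M) \<le> (\<integral>\<^sup>+x. s i x \<partial>M)"
      by (intro nn_integral_mono INF_lower) auto
    then show False using i \<open>ennreal \<epsilon> < _\<close> by simp
  qed
  then have "AE x in M. (INF i. s i x) = 0"
    by (subst (asm) nn_integral_0_iff_AE) auto
  then show ?thesis
  proof eventually_elim
    case (elim x)
    have "Cauchy (\<lambda>J. A J x)"
    proof (rule metric_CauchyI)
      fix e :: real assume e: "0 < e"
      have "(INF i. s i x) < ennreal ((e / 2)\<^sup>2)" using elim e by simp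
      then obtain i where i: "s i x < ennreal ((e / 2)\<^sup>2)" by (auto simp: INF_less_iff)
      have close: "cmod (A J x - A i x) < e / 2" if "i \<le> J" for J
      proof -
        have "ennreal ((cmod (A J x - A i x))\<^sup>2) \<le> osc i (Suc J) x"
          unfolding osc_def using that by (intro SUP_upper) auto
        also have "\<dots> \<le> s i x" unfolding s_def by (intro SUP_upper) auto
        finally have "ennreal ((cmod (A J x - A i x))\<^sup>2) < ennreal ((e / 2)\<^sup>2)" using i by simp
        then have "(cmod (A J x - A i x))\<^sup>2 < (e / 2)\<^sup>2" by (simp add: ennreal_less_iff)
        then show ?thesis by (rule power2_less_imp_less) (use e in simp)
      qed
      show "\<exists>i. \<forall>J\<ge>i. \<forall>K\<ge>i. dist (A J x) (A K x) < e"
      proof (intro exI[of _ i] allI impI)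
        fix J K assume "i \<le> J" "i \<le> K"
        then have "dist (A J x) (A i x) < e / 2" "dist (A K x) (A i x) < e / 2"
          using close by (auto simp: dist_norm)
        then show "dist (A J x) (A K x) < e" by (rule dist_triangle_half_l)
      qed
    qed
    then show ?case by (simp add: Cauchy_convergent_iff)
  qed
qed

lemma A_shift_negligible:
  assumes v: "Gcd D dvd v"
  shows "AE x in M. (\<lambda>l. A l ((T ^^ (v * d ^ l)) x) - A l x) \<longlonglongrightarrow> 0"
proof -
  define g where "g l x = (cmod (A l ((T ^^ (v * d ^ l)) x) - A l x))\<^sup>2" for l x
  have [measurable]: "(\<lambda>x. g l x) \<in> borel_measurable M" for l unfolding g_def by measurable
  obtain C where C: "\<And>N L F. 
     0 < N \<Longrightarrow> (\<And>x. F (x mod N) = F x) \<Longrightarrow>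
     (\<Sum>x<N. \<Sum>l<L. (cmod (digit_avg d D l F (x + v * d ^ l) - digit_avg d D l F x))\<^sup>2)
      \<le> C * (\<Sum>x<N. (cmod (F x))\<^sup>2)"
    using digit_avg_shift_cyclic[OF D v] by blast
  define C' where "C' = max C 0"
  have bound: "(\<integral>\<^sup>+x. (\<Sum>l<L. ennreal (g l x)) \<partial>M) \<le> 2 * ennreal C' * (\<integral>\<^sup>+x. ennreal ((cmod (f x))\<^sup>2) \<partial>M)" for L
  proof -
    define N where "N = Suc v * d ^ L"
    have N: "0 < N" using d by (simp add: N_def)
    show ?thesis
    proof (rule transference[OF T N])
      fix x assume "x \<in> space M"
      define F where "F i = f ((T ^^ (i mod (2 * N))) x)" for i
      have per: "digit_avg d D l F m = A l ((T ^^ m) x)" "digit_avg d D l F (m + v * d ^ l) = A l ((T ^^ (v * d ^ l)) ((T ^^ m) x))"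
        if "m < N" "l < L" for m l
      proof -
        have "d ^ l \<le> d ^ L" using that d by (intro power_increasing) auto
        then have "Suc v * d ^ l \<le> N" unfolding N_def by (intro mult_left_mono) auto
        then have le: "m + v * d ^ l + d ^ l \<le> 2 * N" using that by simp
        show "digit_avg d D l F m = A l ((T ^^ m) x)" 
          unfolding F_def[abs_def] using le by (intro A_periodized) simp
        show "digit_avg d D l F (m + v * d ^ l) = A l ((T ^^ (v * d ^ l)) ((T ^^ m) x))"
          unfolding F_def[abs_def] orbit_shift using le by (intro A_periodized) simp
      qed
      have "(\<Sum>m<N. \<Sum>l<L. ennreal (g l ((T ^^ m) x)))
         = ennreal (\<Sum>m<N. \<Sum>l<L. (cmod (digit_avg d D l F (m + v * d ^ l) - digit_avg d D l F m))\<^sup>2)"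
        by (simp add: sum_nonneg g_def per)
      also have "\<dots> \<le> ennreal (C' * (\<Sum>m<2 * N. (cmod (F m))\<^sup>2))"
      proof (rule ennreal_leI)
        have "(\<Sum>m<N. \<Sum>l<L. (cmod (digit_avg d D l F (m + v * d ^ l) - digit_avg d D l F m))\<^sup>2)
            \<le> (\<Sum>m<2 * N. \<Sum>l<L. (cmod (digit_avg d D l F (m + v * d ^ l) - digit_avg d D l F m))\<^sup>2)"
          by (intro sum_mono2) (auto intro: sum_nonneg)
        also have "\<dots> \<le> C * (\<Sum>m<2 * N. (cmod (F m))\<^sup>2)"
          using N by (intro C) (auto simp: F_def)
        also have "\<dots> \<le> C' * (\<Sum>m<2 * N. (cmod (F m))\<^sup>2)"
          by (intro mult_right_mono) (auto simp: C'_def sum_nonneg)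
        finally show "(\<Sum>m<N. \<Sum>l<L. (cmod (digit_avg d D l F (m + v * d ^ l) - digit_avg d D l F m))\<^sup>2)
          \<le> C' * (\<Sum>m<2 * N. (cmod (F m))\<^sup>2)" .
      qed
      also have "\<dots> = ennreal C' * (\<Sum>m<2 * N. ennreal ((cmod (f ((T ^^ m) x)))\<^sup>2))"
        by (simp add: ennreal_mult C'_def sum_nonneg F_def)
      finally show "(\<Sum>m<N. \<Sum>l<L. ennreal (g l ((T ^^ m) x)))
        \<le> ennreal C' * (\<Sum>m<2 * N. ennreal ((cmod (f ((T ^^ m) x)))\<^sup>2))" .
    qed measurable
  qed
  have "(\<integral>\<^sup>+x. (\<Sum>l. ennreal (g l x)) \<partial>M) = (\<Sum>l. \<integral>\<^sup>+x. ennreal (g l x) \<partial>M)"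
    by (rule nn_integral_suminf) measurable
  also have "\<dots> = (SUP L. \<Sum>l<L. \<integral>\<^sup>+x. ennreal (g l x) \<partial>M)" by (rule suminf_eq_SUP)
  also have "\<dots> = (SUP L. \<integral>\<^sup>+x. (\<Sum>l<L. ennreal (g l x)) \<partial>M)"
    by (simp add: nn_integral_sum)
  also have "\<dots> \<le> 2 * ennreal C' * (\<integral>\<^sup>+x. ennreal ((cmod (f x))\<^sup>2) \<partial>M)"
    by (intro SUP_least bound)
  also have "\<dots> < \<infinity>" using f2 by (simp add: ennreal_mult_less_top)
  finally have "(\<integral>\<^sup>+x. (\<Sum>l. ennreal (g l x)) \<partial>M) \<noteq> \<infinity>" by simp
  then have "AE x in M. (\<Sum>l. ennreal (g l x)) \<noteq> \<infinity>"
    by (intro nn_integral_PInf_AE) auto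
  then show ?thesis
  proof eventually_elim
    case (elim x)
    have "summable (\<lambda>l. g l x)"
      using elim by (intro summable_suminf_not_top) (auto simp: g_def)
    then have "(\<lambda>l. g l x) \<longlonglongrightarrow> 0" by (rule summable_LIMSEQ_zero)
    then have "(\<lambda>l. sqrt (g l x)) \<longlonglongrightarrow> sqrt 0" by (rule tendsto_real_sqrt)
    then show ?case by (simp add: g_def tendsto_norm_zero_iff)
  qed
qed

end

section \<open>Initial segments of the Cantor set\<close>

text \<open>Membership in the Cantor set, digit by digit from below. That \<open>0\<close> is a digit makes leading zeros harmless.\<close>

lemma integer_cantor_rec:
  assumes D: "D \<subseteq> {0..<d}" "0 \<in> D"
  shows "n \<in> integer_cantor_set d D \<longleftrightarrow> n mod d \<in> D \<and> n div d \<in> integer_cantor_set d D"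
proof
  have d: "0 < d" using D by auto
  have zero: "0 \<in> integer_cantor_set d D"
    unfolding integer_cantor_set_def using D(2) by (auto intro!: exI[of _ 0] exI[of _ "\<lambda>_. 0"])
  assume "n \<in> integer_cantor_set d D"
  then obtain J a where n: "n = (\<Sum>j\<le>J. a j * d ^ j)" and a: "\<And>j. j \<le> J \<Longrightarrow> a j \<in> D"
    unfolding integer_cantor_set_def by auto
  have a0: "a 0 \<in> D" "a 0 < d" using a[of 0] D by auto
  show "n mod d \<in> D \<and> n div d \<in> integer_cantor_set d D"
  proof (cases J)
    case 0
    then show ?thesis using n a0 zero by simp
  next
    case (Suc K)
    have "n = a 0 + d * (\<Sum>j\<le>K. a (Suc j) * d ^ j)"
      unfolding n Suc sum.atMost_Suc_shift by (simp add: sum_distrib_left mult_ac)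
    then have "n mod d = a 0" "n div d = (\<Sum>j\<le>K. a (Suc j) * d ^ j)" using a0(2) by auto
    moreover have "(\<Sum>j\<le>K. a (Suc j) * d ^ j) \<in> integer_cantor_set d D"
      unfolding integer_cantor_set_def using a Suc by (intro UN_I[of K] UNIV_I CollectI exI[of _ "\<lambda>j. a (Suc j)"]) auto
    ultimately show ?thesis using a0 by simp
  qed
next
  assume *: "n mod d \<in> D \<and> n div d \<in> integer_cantor_set d D"
  then obtain J b where n: "n div d = (\<Sum>j\<le>J. b j * d ^ j)" and b: "\<And>j. j \<le> J \<Longrightarrow> b j \<in> D"
    unfolding integer_cantor_set_def by auto
  have "n = n mod d + d * (n div d)" by simp
  also have "\<dots> = (\<Sum>j\<le>Suc J. (case j of 0 \<Rightarrow> n mod d | Suc i \<Rightarrow> b i) * d ^ j)"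
    unfolding n sum.atMost_Suc_shift by (simp add: sum_distrib_left mult_ac)
  finally have "n = (\<Sum>j\<le>Suc J. (case j of 0 \<Rightarrow> n mod d | Suc i \<Rightarrow> b i) * d ^ j)" .
  moreover have "(case j of 0 \<Rightarrow> n mod d | Suc i \<Rightarrow> b i) \<in> D" if "j \<le> Suc J" for j
    using that * b by (cases j) auto
  ultimately show "n \<in> integer_cantor_set d D"
    unfolding integer_cantor_set_def by blast
qed

locale cantor_digits =
  fixes d :: nat and D :: "nat set"
  assumes D: "D \<subseteq> {0..<d}" "0 \<in> D" and card2: "2 \<le> card D"
begin

abbreviation "C \<equiv> integer_cantor_set d D"

lemma finite_D: "finite D" using D(1) finite_subset by blast

lemma d_ge: "2 \<le> d"
  using card_mono[OF _ D(1)] card2 by simp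

lemma C_rec: "n \<in> C \<longleftrightarrow> n mod d \<in> D \<and> n div d \<in> C"
  by (rule integer_cantor_rec[OF D])

lemma zero_C [simp]: "0 \<in> C"
  unfolding integer_cantor_set_def using D(2) by (auto intro!: exI[of _ 0] exI[of _ "\<lambda>_. 0"])

lemma digit_C: "a < d \<Longrightarrow> a \<in> C \<longleftrightarrow> a \<in> D"
  by (subst C_rec) simp

lemma C_split: "n \<in> C \<longleftrightarrow> n div d ^ l \<in> C \<and> n mod d ^ l \<in> C"
proof (induction l arbitrary: n)
  case (Suc l)
  have dv: "n div d div d ^ l = n div d ^ Suc l" by (simp add: div_mult2_eq)
  have "n mod d ^ Suc l = d * (n div d mod d ^ l) + n mod d" by (simp add: mod_mult2_eq)
  moreover have "n mod d < d" using d_ge by simp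
  ultimately have "n mod d ^ Suc l mod d = n mod d" "n mod d ^ Suc l div d = n div d mod d ^ l" by simp_all
  then have "n mod d ^ Suc l \<in> C \<longleftrightarrow> n mod d \<in> D \<and> n div d mod d ^ l \<in> C" using C_rec[of "n mod d ^ Suc l"] by simp
  then show ?case using C_rec[of n] Suc[of "n div d"] unfolding dv by blast
qed simp

lemma C_div: "n \<in> C \<Longrightarrow> n div d ^ l \<in> C"
  using C_split[of n l] by blast

lemma C_mod: "n \<in> C \<Longrightarrow> n mod d ^ l \<in> C"
  using C_split[of n l] by blast

lemma card_C_pos: "0 < card (C \<inter> {..N})"
proof -
  have "0 \<in> C \<inter> {..N}" by simp
  then show ?thesis unfolding card_gt_0_iff by blast
qed

lemma block_div: "m < d ^ l \<Longrightarrow> (q * d ^ l + m) div d ^ l = q"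
  using d_ge by auto

lemma C_block: "m < d ^ l \<Longrightarrow> q * d ^ l + m \<in> C \<longleftrightarrow> q \<in> C \<and> m \<in> C"
proof -
  assume "m < d ^ l"
  then have "(q * d ^ l + m) div d ^ l = q" "(q * d ^ l + m) mod d ^ l = m" using d_ge by auto
  then show ?thesis using C_split[of "q * d ^ l + m" l] by simp
qed

text \<open>The elements of the Cantor set with at most \<open>J\<close> digits, including \<open>0\<close>.\<close>

definition block :: "nat \<Rightarrow> nat set" where "block J = C \<inter> {..<d ^ J}"

lemma finite_block [simp]: "finite (block J)" by (simp add: block_def)

lemma sum_blocks:
  fixes F :: "nat \<Rightarrow> 'b::comm_monoid_add"
  assumes "Q \<subseteq> C" "finite Q"
  shows "(\<Sum>n | n \<in> C \<and> n div d ^ l \<in> Q. F n) = (\<Sum>q\<in>Q. \<Sum>m\<in>block l. F (q * d ^ l + m))"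
proof -
  have pos: "0 < d ^ l" using d_ge by simp
  have "bij_betw (\<lambda>(q, m). q * d ^ l + m) (Q \<times> block l) {n \<in> C. n div d ^ l \<in> Q}"
  proof (rule bij_betw_byWitness[where f' = "\<lambda>n. (n div d ^ l, n mod d ^ l)"])
    show "(\<lambda>n. (n div d ^ l, n mod d ^ l)) ` {n \<in> C. n div d ^ l \<in> Q} \<subseteq> Q \<times> block l"
      using pos by (auto simp: block_def C_mod)
    show "(\<lambda>(q, m). q * d ^ l + m) ` (Q \<times> block l) \<subseteq> {n \<in> C. n div d ^ l \<in> Q}"
      using assms(1) C_block[of _ l] by (auto simp: block_def block_div)
  qed (auto simp: block_def block_div div_mult_mod_eq)
  from sum.reindex_bij_betw[OF this, of F] show ?thesis
    by (simp add: sum.cartesian_product case_prod_unfold)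
qed

lemma sum_block_Suc:
  fixes F :: "nat \<Rightarrow> 'b::comm_monoid_add"
  shows "(\<Sum>n\<in>block (Suc J). F n) = (\<Sum>a\<in>D. \<Sum>m\<in>block J. F (a * d ^ J + m))"
proof -
  have DC: "D \<subseteq> C" using D(1) digit_C by auto
  have "n \<in> block (Suc J) \<longleftrightarrow> n \<in> C \<and> n div d ^ J \<in> D" for n
  proof -
    have "n < d ^ Suc J \<longleftrightarrow> n div d ^ J < d" using d_ge by (simp add: div_less_iff_less_mult)
    then show ?thesis using C_split[of n J] digit_C[of "n div d ^ J"] D(1) by (auto simp: block_def)
  qed
  then have "block (Suc J) = {n. n \<in> C \<and> n div d ^ J \<in> D}" by blast
  then show ?thesis using sum_blocks[OF DC finite_D, of F J] by simp
qed

lemma card_block: "card (block J) = card D ^ J"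
proof (induction J)
  case (Suc J)
  then show ?case using sum_block_Suc[of "\<lambda>_. 1 :: nat" J] by simp
next
  case 0
  have "block 0 = {0}" by (auto simp: block_def)
  then show ?case by simp
qed

lemma digit_avg_eq_block_avg:
  "digit_avg d D J F n = (\<Sum>m\<in>block J. F (n + m)) / of_nat (card D ^ J)"
proof (induction J arbitrary: n)
  case (Suc J)
  have "(\<Sum>m\<in>block (Suc J). F (n + m)) = (\<Sum>a\<in>D. \<Sum>m\<in>block J. F (n + a * d ^ J + m))"
    unfolding sum_block_Suc by (simp add: add.assoc)
  then show ?case by (simp add: Suc sum_divide_distrib mult.commute)
next
  case 0
  have "block 0 = {0}" by (auto simp: block_def)
  then show ?case by simp
qed

lemma sum_block_eq: "(\<Sum>m\<in>block J. F (n + m)) = of_nat (card D ^ J) * digit_avg d D J F n"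
  using card2 by (simp add: digit_avg_eq_block_avg)

lemma Gcd_dvd_C: "n \<in> C \<Longrightarrow> Gcd D dvd n"
  unfolding integer_cantor_set_def by (auto intro!: dvd_sum dvd_mult2)

text \<open>Let \<open>N\<close> have \<open>m + 1 + l\<close> digits in base \<open>d\<close>. The part of the Cantor set up to \<open>N\<close> consists of the
  complete blocks of length \<open>d ^ l\<close> whose leading part \<open>v\<close> is less than \<open>q = N div d ^ l\<close>, and of a
  piece of one further block. There are at least \<open>card D ^ m\<close> complete blocks, so that the last piece is a small
  proportion, and it is estimated by the average of \<open>\<bar>F\<bar>\<close> over its block.\<close>

lemma block_deviation:
  assumes l: "\<And>v. v \<in> C \<Longrightarrow> v < d ^ Suc m \<Longrightarrow> cmod (digit_avg d D l F (v * d ^ l) - y) \<le> \<epsilon>"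
    and b: "\<And>v. v \<in> C \<Longrightarrow> v < d ^ Suc m \<Longrightarrow> cmod (digit_avg d D l (\<lambda>i. of_real (cmod (F i))) (v * d ^ l)) \<le> B"
    and N: "d ^ m * d ^ l \<le> N" "N < d ^ Suc m * d ^ l" and "0 \<le> \<epsilon>" "0 \<le> B"
  shows "cmod (\<Sum>n\<in>C \<inter> {..N}. F n - y) \<le> (\<epsilon> + (B + cmod y) / real (card D ^ m)) * real (card (C \<inter> {..N}))"
proof -
  define k where "k = card D"
  have k: "0 < k" using card2 by (simp add: k_def)
  have pos: "0 < d ^ l" using d_ge by simp
  define q where "q = N div d ^ l"
  have q: "d ^ m \<le> q" "q < d ^ Suc m"
    using N pos by (simp_all add: q_def less_eq_div_iff_mult_less_eq div_less_iff_less_mult)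
  define Q where "Q = C \<inter> {..<q}"
  define S1 where "S1 = {n. n \<in> C \<and> n div d ^ l \<in> Q}"
  define S2 where "S2 = {n. n \<in> C \<and> n div d ^ l \<in> C \<inter> {q}}"
  define R where "R = S2 \<inter> {..N}"
  have Qfin: "finite Q" "Q \<subseteq> C" by (auto simp: Q_def)
  have eq: "C \<inter> {..N} = S1 \<union> R"
  proof -
    have "n div d ^ l < q \<or> n div d ^ l = q" if "n \<le> N" for n
      using div_le_mono[OF that, of "d ^ l"] by (auto simp: q_def)
    moreover have "n \<le> N" if "n div d ^ l < q" for n
      using that div_le_mono[of N n "d ^ l"] by (fastforce simp: q_def not_le[symmetric])
    ultimately show ?thesis by (auto simp: S1_def S2_def R_def Q_def C_div)
  qed
  have S1fin: "finite S1"
    using eq by (intro finite_subset[of S1 "{..N}"]) auto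
  have Rfin: "finite R" by (simp add: R_def)
  have disj: "S1 \<inter> R = {}" by (auto simp: S1_def R_def S2_def Q_def)
  have split: "(\<Sum>n\<in>C \<inter> {..N}. F n - y) = (\<Sum>n\<in>S1. F n - y) + (\<Sum>n\<in>R. F n - y)"
    and card_split: "card (C \<inter> {..N}) = card S1 + card R"
    unfolding eq using S1fin Rfin disj by (simp_all add: sum.union_disjoint card_Un_disjoint)
  have cardS1: "card S1 = card Q * k ^ l"
    using sum_blocks[OF Qfin(2,1), of "\<lambda>_. 1 :: nat" l] by (simp add: S1_def card_block k_def)
  have cardQ: "k ^ m \<le> card Q"
    unfolding k_def card_block[symmetric] by (rule card_mono) (use q in \<open>auto simp: Q_def block_def\<close>)
  have "(\<Sum>n\<in>S1. F n - y) = (\<Sum>v\<in>Q. of_nat (k ^ l) * (digit_avg d D l F (v * d ^ l) - y))"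
    unfolding S1_def sum_blocks[OF Qfin(2,1)]
    by (simp add: sum_subtractf sum_block_eq card_block k_def right_diff_distrib)
  also have "cmod \<dots> \<le> (\<Sum>v\<in>Q. real (k ^ l) * \<epsilon>)"
  proof (rule sum_norm_le)
    fix v assume "v \<in> Q"
    then have "v \<in> C" "v < d ^ Suc m" using q by (auto simp: Q_def)
    from l[OF this] show "cmod (of_nat (k ^ l) * (digit_avg d D l F (v * d ^ l) - y)) \<le> real (k ^ l) * \<epsilon>"
      unfolding norm_mult norm_of_nat by (intro mult_left_mono) auto
  qed
  also have "\<dots> = \<epsilon> * real (card S1)" by (simp add: cardS1)
  finally have part1: "cmod (\<Sum>n\<in>S1. F n - y) \<le> \<epsilon> * real (card S1)" .
  have part2: "cmod (\<Sum>n\<in>R. F n - y) \<le> real (k ^ l) * (B + cmod y)"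
  proof (cases "q \<in> C")
    case True
    have S2: "S2 = {n. n \<in> C \<and> n div d ^ l \<in> {q}}" using True by (auto simp: S2_def)
    have fin2: "finite S2"
    proof (rule finite_subset)
      show "S2 \<subseteq> {..<(q + 1) * d ^ l}"
      proof
        fix x assume "x \<in> S2"
        then have "x = q * d ^ l + x mod d ^ l" using div_mult_mod_eq[of x "d ^ l"] by (simp add: S2_def)
        moreover have "x mod d ^ l < d ^ l" using pos by simp
        ultimately show "x \<in> {..<(q + 1) * d ^ l}" by (simp only: lessThan_iff distrib_right mult_1)
      qed
    qed simp
    have sum2: "(\<Sum>n\<in>S2. G n) = (\<Sum>j\<in>block l. G (q * d ^ l + j))" for G :: "nat \<Rightarrow> real"
      unfolding S2 using True by (subst sum_blocks) auto
    have "cmod (\<Sum>n\<in>R. F n - y) \<le> (\<Sum>n\<in>R. cmod (F n) + cmod y)"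
      by (intro sum_norm_le norm_triangle_ineq4)
    also have "\<dots> \<le> (\<Sum>n\<in>S2. cmod (F n) + cmod y)"
      using fin2 by (intro sum_mono2) (auto simp: R_def)
    also have "\<dots> = (\<Sum>j\<in>block l. cmod (F (q * d ^ l + j))) + real (k ^ l) * cmod y"
      unfolding sum2 by (simp add: sum.distrib card_block k_def)
    also have "(\<Sum>j\<in>block l. cmod (F (q * d ^ l + j))) = cmod (\<Sum>j\<in>block l. complex_of_real (cmod (F (q * d ^ l + j))))"
      unfolding of_real_sum[symmetric] norm_of_real by (simp add: sum_nonneg)
    also have "\<dots> = real (k ^ l) * cmod (digit_avg d D l (\<lambda>i. of_real (cmod (F i))) (q * d ^ l))"
      unfolding sum_block_eq[of "\<lambda>i. complex_of_real (cmod (F i))"] norm_mult norm_of_nat k_def ..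
    also have "\<dots> \<le> real (k ^ l) * B" using b[OF True q(2)] by (intro mult_left_mono) auto
    finally show ?thesis by (simp add: distrib_left)
  next
    case False
    then have "R = {}" by (auto simp: R_def S2_def)
    then show ?thesis using \<open>0 \<le> B\<close> by simp
  qed
  have "real (k ^ l) * (B + cmod y) = (B + cmod y) / real (k ^ m) * (real (k ^ m) * real (k ^ l))"
    using k by simp
  also have "\<dots> \<le> (B + cmod y) / real (k ^ m) * real (card S1)"
    using cardQ \<open>0 \<le> B\<close> by (intro mult_left_mono) (auto simp: cardS1 simp flip: of_nat_mult of_nat_power)
  finally have part2': "cmod (\<Sum>n\<in>R. F n - y) \<le> (B + cmod y) / real (k ^ m) * real (card S1)"
    using part2 by linarith
  have "cmod (\<Sum>n\<in>C \<inter> {..N}. F n - y) \<le> (\<epsilon> + (B + cmod y) / real (k ^ m)) * real (card S1)"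
    unfolding split using norm_triangle_ineq[of "\<Sum>n\<in>S1. F n - y" "\<Sum>n\<in>R. F n - y"] part1 part2'
    by (simp add: distrib_right)
  also have "\<dots> \<le> (\<epsilon> + (B + cmod y) / real (k ^ m)) * real (card (C \<inter> {..N}))"
    using \<open>0 \<le> \<epsilon>\<close> \<open>0 \<le> B\<close> by (intro mult_left_mono) (auto simp: card_split)
  finally show ?thesis by (simp add: k_def)
qed

lemma card_C_unbounded: "filterlim (\<lambda>N. card (C \<inter> {..N})) at_top sequentially"
  unfolding filterlim_at_top
proof
  fix Z
  have "Z \<le> card (C \<inter> {..N})" if "d ^ Z \<le> N" for N
  proof -
    have "Z < 2 ^ Z" by (rule less_exp)
    also have "(2::nat) ^ Z \<le> card D ^ Z" using card2 by (rule power_mono) simp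
    also have "\<dots> = card (block Z)" by (simp add: card_block)
    also have "\<dots> \<le> card (C \<inter> {..N})" using that by (intro card_mono) (auto simp: block_def)
    finally show ?thesis by simp
  qed
  then show "\<forall>\<^sub>F N in sequentially. Z \<le> card (C \<inter> {..N})"
    unfolding eventually_sequentially by blast
qed

lemma averages_with_zero_converge:
  assumes F: "\<And>v. v \<in> C \<Longrightarrow> (\<lambda>l. digit_avg d D l F (v * d ^ l)) \<longlonglongrightarrow> y"
    and absF: "\<And>v. v \<in> C \<Longrightarrow> (\<lambda>l. digit_avg d D l (\<lambda>i. of_real (cmod (F i))) (v * d ^ l)) \<longlonglongrightarrow> y'"
  shows "(\<lambda>N. (\<Sum>n\<in>C \<inter> {..N}. F n) / of_nat (card (C \<inter> {..N}))) \<longlonglongrightarrow> y"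
proof (rule metric_LIMSEQ_I)
  fix e :: real assume e: "0 < e"
  define B where "B = cmod y' + 1"
  obtain m where m: "(B + cmod y) / (e / 3) < real (card D) ^ m"
    using real_arch_pow[of "real (card D)"] card2 by auto
  have k: "0 < real (card D) ^ m" using card2 by simp
  have tail: "(B + cmod y) / real (card D ^ m) < e / 3"
    using m e k by (simp add: field_simps)
  define G where "G = C \<inter> {..<d ^ Suc m}"
  have "\<forall>\<^sub>F l in sequentially. \<forall>v\<in>G. cmod (digit_avg d D l F (v * d ^ l) - y) \<le> e / 3 \<and>
     cmod (digit_avg d D l (\<lambda>i. of_real (cmod (F i))) (v * d ^ l)) \<le> B"
  proof (rule eventually_ball_finite)
    show "finite G" by (simp add: G_def)
    show "\<forall>v\<in>G. \<forall>\<^sub>F l in sequentially. cmod (digit_avg d D l F (v * d ^ l) - y) \<le> e / 3 \<and>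
       cmod (digit_avg d D l (\<lambda>i. of_real (cmod (F i))) (v * d ^ l)) \<le> B"
    proof
      fix v assume "v \<in> G"
      then have v: "v \<in> C" by (simp add: G_def)
      have "\<forall>\<^sub>F l in sequentially. dist (digit_avg d D l F (v * d ^ l)) y < e / 3"
        using e by (intro tendstoD[OF F[OF v]]) simp
      moreover have "\<forall>\<^sub>F l in sequentially. cmod (digit_avg d D l (\<lambda>i. of_real (cmod (F i))) (v * d ^ l)) < B"
        using order_tendstoD(2)[OF tendsto_norm[OF absF[OF v]], of B] by (simp add: B_def)
      ultimately show "\<forall>\<^sub>F l in sequentially. cmod (digit_avg d D l F (v * d ^ l) - y) \<le> e / 3 \<and>
         cmod (digit_avg d D l (\<lambda>i. of_real (cmod (F i))) (v * d ^ l)) \<le> B"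
        by eventually_elim (auto simp: dist_norm)
    qed
  qed
  then obtain l0 where l0: "\<And>l v. l0 \<le> l \<Longrightarrow> v \<in> G \<Longrightarrow> cmod (digit_avg d D l F (v * d ^ l) - y) \<le> e / 3 \<and>
     cmod (digit_avg d D l (\<lambda>i. of_real (cmod (F i))) (v * d ^ l)) \<le> B"
    unfolding eventually_sequentially by blast
  show "\<exists>N0. \<forall>N\<ge>N0. dist ((\<Sum>n\<in>C \<inter> {..N}. F n) / of_nat (card (C \<inter> {..N}))) y < e"
  proof (intro exI[of _ "d ^ (l0 + m)"] allI impI)
    fix N assume N: "d ^ (l0 + m) \<le> N"
    have "\<exists>p. d ^ p \<le> N \<and> N < d ^ Suc p"
    proof -
      define p where "p = (LEAST p. N < d ^ Suc p)"
      have ex: "N < d ^ Suc N" using d_ge power_gt_expt[of d "Suc N"] by simp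
      have p: "N < d ^ Suc p" unfolding p_def by (rule LeastI) (rule ex)
      have "d ^ p \<le> N"
      proof (cases p)
        case 0
        have "0 < d ^ (l0 + m)" using d_ge by simp
        from order_less_le_trans[OF this N] show ?thesis using 0 by simp
      next
        case (Suc r)
        then have "r < p" by simp
        then have "\<not> N < d ^ Suc r" unfolding p_def by (rule not_less_Least)
        then show ?thesis using Suc by simp
      qed
      then show ?thesis using p by blast
    qed
    then obtain p where p: "d ^ p \<le> N" "N < d ^ Suc p" by blast
    have "d ^ (l0 + m) < d ^ Suc p" using N p by simp
    then have "l0 + m \<le> p" using d_ge by (simp only: power_strict_increasing_iff)
    define l where "l = p - m"
    have l: "l0 \<le> l" "p = m + l" using \<open>l0 + m \<le> p\<close> by (auto simp: l_def)
    have C0: "0 < card (C \<inter> {..N})" by (rule card_C_pos)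
    have "cmod (\<Sum>n\<in>C \<inter> {..N}. F n - y) \<le> (e / 3 + (B + cmod y) / real (card D ^ m)) * real (card (C \<inter> {..N}))"
      using l0[OF l(1)] p e unfolding l(2)
      by (intro block_deviation[where l = l]) (auto simp: G_def power_add B_def mult_ac)
    also have "\<dots> < e * real (card (C \<inter> {..N}))"
    proof (rule mult_strict_right_mono)
      show "e / 3 + (B + cmod y) / real (card D ^ m) < e" using tail e by linarith
    qed (use C0 in simp)
    finally have "cmod (\<Sum>n\<in>C \<inter> {..N}. F n - y) / real (card (C \<inter> {..N})) < e"
      using C0 by (simp add: divide_less_eq)
    moreover have "(\<Sum>n\<in>C \<inter> {..N}. F n) / of_nat (card (C \<inter> {..N})) - y = (\<Sum>n\<in>C \<inter> {..N}. F n - y) / of_nat (card (C \<inter> {..N}))"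
    proof -
      have "complex_of_nat (card (C \<inter> {..N})) \<noteq> 0" using C0 by (simp only: of_nat_eq_0_iff)
      from nonzero_mult_div_cancel_left[OF this, of y] show ?thesis
        by (simp only: sum_subtractf sum_constant diff_divide_distrib)
    qed
    ultimately show "dist ((\<Sum>n\<in>C \<inter> {..N}. F n) / of_nat (card (C \<inter> {..N}))) y < e"
      by (simp add: dist_norm norm_divide)
  qed
qed

text \<open>The initial segments in \<open>cantor_upto\<close> leave out \<open>0\<close>, which does not change the limit.\<close>

lemma averages_converge:
  assumes F: "\<And>v. v \<in> C \<Longrightarrow> (\<lambda>l. digit_avg d D l F (v * d ^ l)) \<longlonglongrightarrow> y"
    and absF: "\<And>v. v \<in> C \<Longrightarrow> (\<lambda>l. digit_avg d D l (\<lambda>i. of_real (cmod (F i))) (v * d ^ l)) \<longlonglongrightarrow> y'"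
  shows "(\<lambda>N. (\<Sum>n\<in>cantor_upto d D N. F n) / of_nat (card (cantor_upto d D N))) \<longlonglongrightarrow> y"
proof -
  define c where "c N = card (C \<inter> {..N})" for N
  have c: "0 < c N" for N unfolding c_def by (rule card_C_pos)
  have "filterlim (\<lambda>N. real (c N)) at_top sequentially"
    unfolding c_def by (rule filterlim_compose[OF filterlim_real_sequentially card_C_unbounded])
  then have inv: "(\<lambda>N. 1 / of_nat (c N) :: complex) \<longlonglongrightarrow> 0"
  proof -
    assume "filterlim (\<lambda>N. real (c N)) at_top sequentially"
    then have "(\<lambda>N. inverse (real (c N))) \<longlonglongrightarrow> 0" by (rule tendsto_inverse_0_at_top)
    then have "(\<lambda>N. complex_of_real (inverse (real (c N)))) \<longlonglongrightarrow> of_real 0" by (rule tendsto_of_real)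
    then show ?thesis by (simp add: inverse_eq_divide)
  qed
  have upto: "C \<inter> {..N} = insert 0 (cantor_upto d D N)" "0 \<notin> cantor_upto d D N" "finite (cantor_upto d D N)" for N
    by (auto simp: cantor_upto_def)
  have c_eq: "c N = Suc (card (cantor_upto d D N))" for N unfolding c_def upto(1) using upto(2,3) by simp
  have lim: "(\<lambda>N. ((\<Sum>n\<in>C \<inter> {..N}. F n) / of_nat (c N) - F 0 * (1 / of_nat (c N))) / (1 - 1 / of_nat (c N))) \<longlonglongrightarrow> (y - F 0 * 0) / (1 - 0)"
    unfolding c_def by (intro tendsto_intros averages_with_zero_converge[OF F absF] inv[unfolded c_def]) auto
  have "((\<Sum>n\<in>C \<inter> {..N}. F n) / of_nat (c N) - F 0 * (1 / of_nat (c N))) / (1 - 1 / of_nat (c N))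
     = (\<Sum>n\<in>cantor_upto d D N. F n) / of_nat (card (cantor_upto d D N))" for N
  proof -
    have "(\<Sum>n\<in>C \<inter> {..N}. F n) = F 0 + (\<Sum>n\<in>cantor_upto d D N. F n)"
      unfolding upto(1) using upto(2,3) by simp
    then have "(\<Sum>n\<in>C \<inter> {..N}. F n) / of_nat (c N) - F 0 * (1 / of_nat (c N)) = (\<Sum>n\<in>cantor_upto d D N. F n) / of_nat (c N)"
      by (simp add: add_divide_distrib)
    moreover have ne: "(of_nat (c N) :: complex) \<noteq> 0" using c[of N] by simp
    moreover have "of_nat (c N) - 1 = (of_nat (card (cantor_upto d D N)) :: complex)" by (simp add: c_eq)
    then have "1 - 1 / of_nat (c N) = of_nat (card (cantor_upto d D N)) / (of_nat (c N) :: complex)"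
      using ne by (metis diff_divide_distrib divide_self)
    ultimately show ?thesis by simp
  qed
  then show ?thesis using lim by simp
qed

end

section \<open>Pointwise convergence\<close>

text \<open>The averages over initial segments are compared with averages over blocks starting at \<open>v * d ^ l\<close> for
  \<open>v\<close> in the Cantor set; for these both \<open>f\<close> and \<open>\<bar>f\<bar>\<close> are needed.\<close>

lemma cantor_average_L2:
  assumes d: "3 \<le> d" and D: "D \<subseteq> {0..<d}" "0 \<in> D" "2 \<le> card D"
    and T: "measure_preserving_map M T" and f: "f \<in> borel_measurable M"
    and f2: "(\<integral>\<^sup>+x. ennreal ((cmod (f x))\<^sup>2) \<partial>M) < \<infinity>"
  shows "AE x in M. convergent (\<lambda>N. cantor_average d D T f N x)"
proof -
  interpret cantor_digits d D by unfold_locales (use D in auto)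
  define f' where "f' x = complex_of_real (cmod (f x))" for x
  have f': "f' \<in> borel_measurable M" unfolding f'_def[abs_def] using f by measurable
  interpret S: cantor_system d D M T f by unfold_locales (use d D T f f2 in auto)
  interpret S': cantor_system d D M T f'
    by unfold_locales (use d D T f' f2 in \<open>auto simp: f'_def\<close>)
  have shift: "AE x in M. \<forall>v\<in>C. (\<lambda>l. S.A l ((T ^^ (v * d ^ l)) x) - S.A l x) \<longlonglongrightarrow> 0"
    by (intro AE_ball_countable' S.A_shift_negligible Gcd_dvd_C) auto
  have shift': "AE x in M. \<forall>v\<in>C. (\<lambda>l. S'.A l ((T ^^ (v * d ^ l)) x) - S'.A l x) \<longlonglongrightarrow> 0"
    by (intro AE_ball_countable' S'.A_shift_negligible Gcd_dvd_C) auto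
  from S.A_converges S'.A_converges shift shift' show ?thesis
  proof eventually_elim
    case (elim x)
    obtain y y' where y: "(\<lambda>J. S.A J x) \<longlonglongrightarrow> y" "(\<lambda>J. S'.A J x) \<longlonglongrightarrow> y'"
      using elim(1,2) by (auto simp: convergent_def)
    have "(\<lambda>l. digit_avg d D l (\<lambda>i. f ((T ^^ i) x)) (v * d ^ l)) \<longlonglongrightarrow> y" if "v \<in> C" for v
      using tendsto_add[OF elim(3)[rule_format, OF that] y(1)] by (simp add: S.A_funpow)
    moreover have "(\<lambda>l. digit_avg d D l (\<lambda>i. of_real (cmod (f ((T ^^ i) x)))) (v * d ^ l)) \<longlonglongrightarrow> y'" if "v \<in> C" for v
      using tendsto_add[OF elim(4)[rule_format, OF that] y(2)] by (simp add: S'.A_funpow f'_def)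
    ultimately have "(\<lambda>N. (\<Sum>n\<in>cantor_upto d D N. f ((T ^^ n) x)) / of_nat (card (cantor_upto d D N))) \<longlonglongrightarrow> y"
      by (rule averages_converge)
    then show ?case unfolding cantor_average_def convergent_def by blast
  qed
qed

lemma square_le_powr:
  fixes t c p :: real
  assumes "0 < c" "c < t" "2 \<le> p"
  shows "t\<^sup>2 \<le> c powr (2 - p) * t powr p"
proof -
  have "t\<^sup>2 = t powr (2 - p) * t powr p"
    using assms by (simp add: powr_add[symmetric] powr_numeral)
  also have "\<dots> \<le> c powr (2 - p) * t powr p"
    using assms by (intro mult_right_mono powr_mono2') auto
  finally show ?thesis .
qed

lemma norm_cantor_average_le:
  assumes "\<And>y. cmod (h y) \<le> c" "0 \<le> c"
  shows "cmod (cantor_average d D T h N x) \<le> c"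
proof (cases "card (cantor_upto d D N) = 0")
  case False
  have "cmod (\<Sum>n\<in>cantor_upto d D N. h ((T ^^ n) x)) \<le> real (card (cantor_upto d D N)) * c"
    using sum_norm_le[of "cantor_upto d D N" "\<lambda>n. h ((T ^^ n) x)" "\<lambda>_. c"] assms by simp
  then show ?thesis using False by (simp add: cantor_average_def norm_divide divide_le_eq mult.commute)
qed (use assms in \<open>simp add: cantor_average_def\<close>)

text \<open>For \<open>p \<ge> 2\<close> the part of \<open>f\<close> where \<open>\<bar>f\<bar>\<close> exceeds a positive level is square-integrable,
  and the averages of the rest are bounded by the level.\<close>

theorem theorem1p2:
  fixes d :: nat and D :: "nat set"
    and M :: "'a measure" and T :: "'a \<Rightarrow> 'a"
    and p :: real and f :: "'a \<Rightarrow> complex"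
  assumes "3 \<le> d"
    and "D \<subset> {0..<d}"
    and "2 \<le> card D"
    and "0 \<in> D"
    and "sigma_finite_measure M"
    and "measure_preserving_map M T"
    and "2 \<le> p"
    and "f \<in> Lp_functions p M"
  shows "AE x in M. convergent (\<lambda>N. cantor_average d D T f N x)"
proof -
  define \<mu> where "\<mu> i = inverse (real (Suc i))" for i
  have \<mu>: "0 < \<mu> i" for i by (simp add: \<mu>_def)
  \<comment> \<open>The square-integrable part of \<open>f\<close> above the level \<open>\<mu> i\<close>.\<close>
  define g where "g i x = (if \<mu> i < cmod (f x) then f x else 0)" for i x
  have f [measurable]: "f \<in> borel_measurable M" and int: "integrable M (\<lambda>x. cmod (f x) powr p)"
    using assms(8) by (auto simp: Lp_functions_def)
  have g [measurable]: "g i \<in> borel_measurable M" for i unfolding g_def[abs_def] by measurable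
  have "AE x in M. convergent (\<lambda>N. cantor_average d D T (g i) N x)" for i
  proof (rule cantor_average_L2)
    have "(\<integral>\<^sup>+x. ennreal ((cmod (g i x))\<^sup>2) \<partial>M) \<le> (\<integral>\<^sup>+x. ennreal (\<mu> i powr (2 - p) * cmod (f x) powr p) \<partial>M)"
      using square_le_powr[OF \<mu> _ assms(7), of i] \<mu>[of i]
      by (intro nn_integral_mono ennreal_leI) (auto simp: g_def)
    also have "\<dots> < \<infinity>"
      using integrableD(2)[OF integrable_mult_right[OF int, of "\<mu> i powr (2 - p)"]]
      by (simp add: top.not_eq_extremum)
    finally show "(\<integral>\<^sup>+x. ennreal ((cmod (g i x))\<^sup>2) \<partial>M) < \<infinity>" .
  qed (use assms g in auto)
  then have "AE x in M. \<forall>i. convergent (\<lambda>N. cantor_average d D T (g i) N x)"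
    by (simp add: AE_all_countable)
  then show ?thesis
  proof eventually_elim
    case (elim x)
    have close: "cmod (cantor_average d D T f N x - cantor_average d D T (g i) N x) \<le> \<mu> i" for N i
    proof -
      have "cantor_average d D T f N x - cantor_average d D T (g i) N x = cantor_average d D T (\<lambda>y. f y - g i y) N x"
        by (simp add: cantor_average_def sum_subtractf diff_divide_distrib)
      then show ?thesis using norm_cantor_average_le[of "\<lambda>y. f y - g i y" "\<mu> i"] \<mu>[of i]
        by (simp add: g_def)
    qed
    have "Cauchy (\<lambda>N. cantor_average d D T f N x)"
    proof (rule metric_CauchyI)
      fix e :: real assume e: "0 < e"
      obtain i where i: "\<mu> i < e / 3" using reals_Archimedean[of "e / 3"] e by (auto simp: \<mu>_def)
      obtain n0 where n0: "\<And>m n. n0 \<le> m \<Longrightarrow> n0 \<le> n \<Longrightarrow>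
          dist (cantor_average d D T (g i) m x) (cantor_average d D T (g i) n x) < e / 3"
        using metric_CauchyD[OF convergent_Cauchy[OF elim[rule_format, of i]], of "e / 3"] e by auto
      show "\<exists>n0. \<forall>m\<ge>n0. \<forall>n\<ge>n0. dist (cantor_average d D T f m x) (cantor_average d D T f n x) < e"
      proof (intro exI[of _ n0] allI impI)
        fix m n assume "n0 \<le> m" "n0 \<le> n"
        from n0[OF this] show "dist (cantor_average d D T f m x) (cantor_average d D T f n x) < e"
          using close[of m i] close[of n i] i
            dist_triangle[of "cantor_average d D T f m x" "cantor_average d D T f n x" "cantor_average d D T (g i) m x"]
            dist_triangle[of "cantor_average d D T (g i) m x" "cantor_average d D T f n x" "cantor_average d D T (g i) n x"]
          by (simp add: dist_norm norm_minus_commute)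
      qed
    qed
    then show ?case by (simp add: Cauchy_convergent_iff)
  qed
qed

end
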